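(* Let $\varphi(z_1,z_2)=(\phi(z_1),\psi(z_2))$, where $\phi$ and $\psi$ are parabolic Möbius transformations of $\mathbb{U}$. Let $\varsigma$ and $\zeta$ be the fixed points of $\phi$ and $\psi$, respectively. Let $w\in\mathbb{A}^2$ and let $T:\mathbb{A}^2\to\mathbb{A}^2$ be the operator $(Tf)(z)=w(z)f(\varphi(z))$. (1) If $w$ is invertible in $\mathbb{A}^2$, then $\sigma(T)=\sigma_{sf}(T)=w(\varsigma,\zeta)\mathbb{T}$. (2) If $w$ is not invertible in $C(\mathbb{T}^2)$, then $\sigma(T)=\sigma_{sf}(T)=w(\varsigma,\zeta)\mathbb{D}$. (3) If $w$ is not invertible in $\mathbb{A}^2$ but invertible in $C(\mathbb{T}^2)$, then $\sigma_{a.p.}(T)=\sigma_{sf}(T)=w(\varsigma,\zeta)\mathbb{T}$ and $\sigma(T)=\sigma_{lsf}(T)=w(\varsigma,\zeta)\mathbb{D}$.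
   Context: $\mathbb{D}$, $\mathbb{U}$ and $\mathbb{T}$ are the closed unit disc, the open unit disc and the unit circle in $\mathbb{C}$. For $c\in\mathbb{C}$ and $S\subseteq\mathbb{C}$, $cS=\{cs:s\in S\}$. A Möbius transformation of $\mathbb{U}$ is a conformal automorphism of $\mathbb{U}$, extended to $\mathbb{D}$; it is parabolic if it is not the identity and has exactly one fixed point in $\mathbb{D}$, lying on $\mathbb{T}$. $\mathbb{A}^2$ is the bidisc algebra: all functions continuous on $\mathbb{D}^2$ and analytic in $\mathbb{U}^2$, with the sup norm. Invertibility of $w$ in $C(\mathbb{T}^2)$ refers to the restriction of $w$ to $\mathbb{T}^2$. For a bounded linear operator $T$ on a Banach space $X$: $T$ is upper semi-Fredholm if its range is closed and $\dim\ker T<\infty$; lower semi-Fredholm if its range has finite codimension; semi-Fredholm if it is upper or lower semi-Fredholm. $\sigma(T)$ is the spectrum; $\sigma_{a.p.}(T)$ is the approximate point spectrum (the set of $\lambda$ for which there are $x_n\in X$, $\|x_n\|=1$, with $Tx_n-\lambda x_n\to0$); $\sigma_{sf}(T)$ and $\sigma_{lsf}(T)$ are the sets of $\lambda\in\mathbb{C}$ such that $\lambda I-T$ is not semi-Fredholm, respectively not lower semi-Fredholm. *)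

theory Defs
  imports "HOL-Complex_Analysis.Complex_Analysis"
begin

section \<open>Complex Banach spaces\<close>

text \<open>
  The type class \<^class>\<open>banach\<close> only provides real scalars. The class below adds complex scalars
  acting compatibly with the real ones and with the norm.
\<close>

class complex_banach = banach +
  fixes scaleC :: "complex \<Rightarrow> 'a \<Rightarrow> 'a"  (infixr \<open>*\<^sub>C\<close> 75)
  assumes scaleC_add_right: "c *\<^sub>C (x + y) = c *\<^sub>C x + c *\<^sub>C y"
    and scaleC_add_left: "(c + d) *\<^sub>C x = c *\<^sub>C x + d *\<^sub>C x"
    and scaleC_scaleC: "c *\<^sub>C d *\<^sub>C x = (c * d) *\<^sub>C x"
    and scaleR_scaleC: "r *\<^sub>R x = complex_of_real r *\<^sub>C x"
    and norm_scaleC: "norm (c *\<^sub>C x) = cmod c * norm x"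

lemma scaleC_one: "1 *\<^sub>C x = (x :: 'a :: complex_banach)"
  by (metis of_real_1 scaleR_one scaleR_scaleC)

interpretation complex_vector: vector_space "scaleC :: complex \<Rightarrow> 'a \<Rightarrow> 'a :: complex_banach"
  by unfold_locales (simp_all add: scaleC_add_right scaleC_add_left scaleC_scaleC scaleC_one)

definition bounded_clinear :: "('a::complex_banach \<Rightarrow> 'b::complex_banach) \<Rightarrow> bool" where
  "bounded_clinear T \<longleftrightarrow> bounded_linear T \<and> (\<forall>c x. T (c *\<^sub>C x) = c *\<^sub>C T x)"


section \<open>Semi-Fredholm operators and parts of the spectrum\<close>

definition fin_dim_kernel :: "('a::complex_banach \<Rightarrow> 'a) \<Rightarrow> bool" where
  "fin_dim_kernel T \<longleftrightarrow> (\<exists>B. finite B \<and> {x. T x = 0} = complex_vector.span B)"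

text \<open>
  The quotient of the whole space by the subspace \<open>range T\<close> is spanned by finitely many classes
  iff finitely many vectors together with \<open>range T\<close> span the whole space.
\<close>

definition fin_codim_range :: "('a::complex_banach \<Rightarrow> 'a) \<Rightarrow> bool" where
  "fin_codim_range T \<longleftrightarrow> (\<exists>B. finite B \<and> complex_vector.span (range T \<union> B) = UNIV)"

definition upper_semi_Fredholm :: "('a::complex_banach \<Rightarrow> 'a) \<Rightarrow> bool" where
  "upper_semi_Fredholm T \<longleftrightarrow> closed (range T) \<and> fin_dim_kernel T"

definition lower_semi_Fredholm :: "('a::complex_banach \<Rightarrow> 'a) \<Rightarrow> bool" where
  "lower_semi_Fredholm T \<longleftrightarrow> fin_codim_range T"

definition semi_Fredholm :: "('a::complex_banach \<Rightarrow> 'a) \<Rightarrow> bool" where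
  "semi_Fredholm T \<longleftrightarrow> upper_semi_Fredholm T \<or> lower_semi_Fredholm T"

definition invertible_op :: "('a::complex_banach \<Rightarrow> 'a) \<Rightarrow> bool" where
  "invertible_op T \<longleftrightarrow> (\<exists>S. bounded_clinear S \<and> S \<circ> T = id \<and> T \<circ> S = id)"

definition op_spectrum :: "('a::complex_banach \<Rightarrow> 'a) \<Rightarrow> complex set" where
  "op_spectrum T = {l. \<not> invertible_op (\<lambda>x. l *\<^sub>C x - T x)}"

definition ap_spectrum :: "('a::complex_banach \<Rightarrow> 'a) \<Rightarrow> complex set" where
  "ap_spectrum T = {l. \<exists>x :: nat \<Rightarrow> 'a. (\<forall>n. norm (x n) = 1) \<and>
     (\<lambda>n. T (x n) - l *\<^sub>C x n) \<longlonglongrightarrow> 0}"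

definition sf_spectrum :: "('a::complex_banach \<Rightarrow> 'a) \<Rightarrow> complex set" where
  "sf_spectrum T = {l. \<not> semi_Fredholm (\<lambda>x. l *\<^sub>C x - T x)}"

definition lsf_spectrum :: "('a::complex_banach \<Rightarrow> 'a) \<Rightarrow> complex set" where
  "lsf_spectrum T = {l. \<not> lower_semi_Fredholm (\<lambda>x. l *\<^sub>C x - T x)}"


section \<open>Analytic functions of two variables\<close>

abbreviation closed_bidisc :: "(complex \<times> complex) set" where
  "closed_bidisc \<equiv> cball 0 1 \<times> cball 0 1"

abbreviation open_bidisc :: "(complex \<times> complex) set" where
  "open_bidisc \<equiv> ball 0 1 \<times> ball 0 1"

abbreviation torus :: "(complex \<times> complex) set" where
  "torus \<equiv> sphere 0 1 \<times> sphere 0 1"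

text \<open>
  Analyticity on an open set: the (Frechet) derivative exists and is complex linear at every point.
\<close>

definition analytic2_on :: "(complex \<times> complex \<Rightarrow> complex) \<Rightarrow> (complex \<times> complex) set \<Rightarrow> bool" where
  "analytic2_on f S \<longleftrightarrow>
     (\<forall>z\<in>S. \<exists>a b. (f has_derivative (\<lambda>h. a * fst h + b * snd h)) (at z))"

lemma analytic2_on_imp_holomorphic_fst:
  assumes f: "analytic2_on f (A \<times> B)" and y: "y \<in> B"
  shows "(\<lambda>x. f (x, y)) holomorphic_on A"
  unfolding holomorphic_on_def
proof
  fix x assume "x \<in> A"
  then obtain a b where d: "(f has_derivative (\<lambda>h. a * fst h + b * snd h)) (at (x, y))"
    using f y unfolding analytic2_on_def by blast
  have "((\<lambda>x. (x, y)) has_derivative (\<lambda>h. (h, 0))) (at x)"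
    by (auto intro!: derivative_eq_intros)
  from has_derivative_compose[OF this d]
  have "((\<lambda>x. f (x, y)) has_field_derivative a) (at x)"
    by (simp add: has_field_derivative_def)
  then show "(\<lambda>x. f (x, y)) field_differentiable at x within A"
    using field_differentiable_at_within field_differentiable_def by blast
qed

lemma analytic2_on_imp_holomorphic_snd:
  assumes f: "analytic2_on f (A \<times> B)" and x: "x \<in> A"
  shows "(\<lambda>y. f (x, y)) holomorphic_on B"
  unfolding holomorphic_on_def
proof
  fix y assume "y \<in> B"
  then obtain a b where d: "(f has_derivative (\<lambda>h. a * fst h + b * snd h)) (at (x, y))"
    using f x unfolding analytic2_on_def by blast
  have "((\<lambda>y. (x, y)) has_derivative (\<lambda>h. (0, h))) (at y)"
    by (auto intro!: derivative_eq_intros)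
  from has_derivative_compose[OF this d]
  have "((\<lambda>y. f (x, y)) has_field_derivative b) (at y)"
    by (simp add: has_field_derivative_def)
  then show "(\<lambda>y. f (x, y)) field_differentiable at y within B"
    using field_differentiable_at_within field_differentiable_def by blast
qed

lemma isCont_partial_deriv:
  fixes f :: "complex \<times> complex \<Rightarrow> complex"
  assumes A: "open A" and B: "open B" and cont: "continuous_on (A \<times> B) f"
    and hol: "\<And>x. x \<in> A \<Longrightarrow> (\<lambda>y. f (x, y)) holomorphic_on B"
    and ab: "a \<in> A" "b \<in> B"
  shows "isCont (\<lambda>(x, y). deriv (\<lambda>v. f (x, v)) y) (a, b)"
proof -
  let ?D = "\<lambda>x y. deriv (\<lambda>v. f (x, v)) y"
  obtain s where s: "s > 0" "cball a s \<subseteq> A"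
    using A ab open_contains_cball by blast
  obtain r0 where r0: "r0 > 0" "cball b r0 \<subseteq> B"
    using B ab open_contains_cball by blast
  define r where "r = r0 / 2"
  have r: "r > 0" using r0 by (simp add: r_def)
  let ?K = "cball a s \<times> cball b r0"
  have "compact ?K" by (intro compact_Times compact_cball)
  moreover have "continuous_on ?K f"
    by (rule continuous_on_subset[OF cont]) (use s r0 in auto)
  ultimately have uc: "uniformly_continuous_on ?K f"
    by (rule compact_uniformly_continuous[rotated])
  have sub: "cball y r \<subseteq> cball b r0" if "dist b y < r" for y
  proof
    fix v assume "v \<in> cball y r"
    with that dist_triangle[of b v y] show "v \<in> cball b r0"
      by (simp add: r_def)
  qed
  have "\<exists>d>0. \<forall>z. dist z (a, b) < d \<longrightarrow> dist (?D (fst z) (snd z)) (?D a b) < e"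
    if e: "e > 0" for e
  proof -
    from uc obtain d1 where d1: "d1 > 0"
      and d1': "\<And>z z'. z \<in> ?K \<Longrightarrow> z' \<in> ?K \<Longrightarrow> dist z' z < d1 \<Longrightarrow> dist (f z') (f z) < e * r / 2"
      unfolding uniformly_continuous_on_def using e r by (metis half_gt_zero mult_pos_pos)
    have "deriv (\<lambda>v. f (a, v)) holomorphic_on B"
      using hol[OF ab(1)] B by (rule holomorphic_deriv)
    then have "isCont (?D a) b"
      using B ab continuous_on_eq_continuous_at holomorphic_on_imp_continuous_on by blast
    then obtain d2 where d2: "d2 > 0" "\<And>y. dist y b < d2 \<Longrightarrow> dist (?D a y) (?D a b) < e / 2"
      unfolding continuous_at_eps_delta using e by (metis half_gt_zero)
    define d where "d = Min {d1, d2, s, r}"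
    have d: "d > 0" "d \<le> d1" "d \<le> d2" "d \<le> s" "d \<le> r"
      using d1 d2 s r by (auto simp: d_def)
    have "dist (?D x y) (?D a b) < e" if "dist (x, y) (a, b) < d" for x y
    proof -
      have dx: "dist x a < d" and dy: "dist y b < d"
        using that dist_fst_le[of "(x, y)" "(a, b)"] dist_snd_le[of "(x, y)" "(a, b)"] by auto
      have xs: "x \<in> cball a s" using dx d by (simp add: dist_commute)
      have cb: "cball y r \<subseteq> cball b r0" using sub dy d by (simp add: dist_commute)
      have hx: "(\<lambda>v. f (x, v)) holomorphic_on cball y r"
        and ha: "(\<lambda>v. f (a, v)) holomorphic_on cball y r"
        using hol s xs ab cb r0 by (meson holomorphic_on_subset order_trans subsetD)+
      have hxa: "(\<lambda>v. f (x, v) - f (a, v)) holomorphic_on cball y r"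
        by (intro holomorphic_intros hx ha)
      have bd: "cmod ((deriv ^^ 1) (\<lambda>v. f (x, v) - f (a, v)) y) \<le> fact 1 * (e * r / 2) / r ^ 1"
      proof (rule Cauchy_inequality)
        show "(\<lambda>v. f (x, v) - f (a, v)) holomorphic_on ball y r"
          using hxa ball_subset_cball holomorphic_on_subset by blast
        show "continuous_on (cball y r) (\<lambda>v. f (x, v) - f (a, v))"
          using hxa by (rule holomorphic_on_imp_continuous_on)
        show "0 < r" by (fact r)
        fix v assume "cmod (y - v) = r"
        then have "v \<in> cball b r0" using cb by (auto simp: dist_norm)
        then have "dist (f (x, v)) (f (a, v)) < e * r / 2"
          using xs s dx d by (intro d1') (auto simp: dist_Pair_Pair)
        then show "cmod (f (x, v) - f (a, v)) \<le> e * r / 2"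
          by (simp add: dist_norm)
      qed
      have "y \<in> cball y r" using r by simp
      then have yB: "y \<in> B" using cb r0 by blast
      have xA: "x \<in> A" using xs s by auto
      have "deriv (\<lambda>v. f (x, v) - f (a, v)) y = ?D x y - ?D a y"
        by (intro deriv_diff holomorphic_on_imp_differentiable_at[OF _ B] hol xA ab yB)
      with bd r have "dist (?D x y) (?D a y) \<le> e / 2"
        by (simp add: dist_norm)
      moreover have "dist (?D a y) (?D a b) < e / 2"
        using d2 dy d by force
      ultimately show ?thesis
        using dist_triangle[of "?D x y" "?D a b" "?D a y"] by linarith
    qed
    with d(1) show ?thesis by (metis prod.collapse)
  qed
  then show ?thesis
    unfolding continuous_at_eps_delta by (auto simp: case_prod_unfold)
qed

lemma analytic2_onI:
  assumes A: "open A" and B: "open B" and cont: "continuous_on (A \<times> B) f"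
    and hol1: "\<And>y. y \<in> B \<Longrightarrow> (\<lambda>x. f (x, y)) holomorphic_on A"
    and hol2: "\<And>x. x \<in> A \<Longrightarrow> (\<lambda>y. f (x, y)) holomorphic_on B"
  shows "analytic2_on f (A \<times> B)"
  unfolding analytic2_on_def
proof safe
  fix a b assume a: "a \<in> A" and b: "b \<in> B"
  obtain s where s: "s > 0" "ball b s \<subseteq> B"
    using B b open_contains_ball by blast
  let ?Y = "ball b s"
  let ?fy = "\<lambda>x y. blinfun_mult_right (deriv (\<lambda>v. f (x, v)) y)"
  have "((\<lambda>(x, y). f (x, y)) has_derivative
      (\<lambda>(tx, ty). deriv (\<lambda>x. f (x, b)) a * tx + blinfun_apply (?fy a b) ty)) (at (a, b) within A \<times> ?Y)"
  proof (rule has_derivative_partialsI)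
    have "(\<lambda>x. f (x, b)) field_differentiable at a"
      using hol1[OF b] A a by (rule holomorphic_on_imp_differentiable_at)
    then show "((\<lambda>x. f (x, b)) has_derivative (*) (deriv (\<lambda>x. f (x, b)) a)) (at a within A)"
      using field_differentiable_derivI has_derivative_at_withinI has_field_derivative_def by blast
    show "((\<lambda>y. f (x, y)) has_derivative blinfun_apply (?fy x y)) (at y within ?Y)"
      if "x \<in> A" "y \<in> ?Y" for x y
    proof -
      have "(\<lambda>y. f (x, y)) field_differentiable at y"
        using hol2[OF that(1)] B by (rule holomorphic_on_imp_differentiable_at) (use that s in auto)
      then have "((\<lambda>y. f (x, y)) has_derivative (*) (deriv (\<lambda>v. f (x, v)) y)) (at y within ?Y)"
        using field_differentiable_derivI has_derivative_at_withinI has_field_derivative_def by blast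
      then show ?thesis by simp
    qed
    have "isCont (\<lambda>(x, y). deriv (\<lambda>v. f (x, v)) y) (a, b)"
      by (rule isCont_partial_deriv[OF A B cont hol2 a b])
    then have "isCont (\<lambda>z. blinfun_mult_right ((\<lambda>(x, y). deriv (\<lambda>v. f (x, v)) y) z)) (a, b)"
      by (rule bounded_linear.continuous[OF bounded_linear_blinfun_mult_right])
    then show "continuous (at (a, b) within A \<times> ?Y) (\<lambda>(x, y). ?fy x y)"
      by (simp add: case_prod_unfold continuous_at_imp_continuous_at_within)
    show "b \<in> ?Y" using s by simp
    show "convex ?Y" by simp
  qed
  then have "(f has_derivative
      (\<lambda>h. deriv (\<lambda>x. f (x, b)) a * fst h + deriv (\<lambda>v. f (a, v)) b * snd h)) (at (a, b) within A \<times> ?Y)"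
    by (simp add: case_prod_unfold)
  moreover have "at (a, b) within A \<times> ?Y = at (a, b)"
    using A a s by (intro at_within_open) (auto intro: open_Times)
  ultimately show "\<exists>c d. (f has_derivative (\<lambda>h. c * fst h + d * snd h)) (at (a, b))"
    by auto
qed


section \<open>The bidisc algebra\<close>

text \<open>
  Elements are represented by functions on \<open>\<complex> \<times> \<complex>\<close> normalised to vanish off the closed bidisc, so
  that equality in the type is equality on the closed bidisc.
\<close>

typedef bidisc_alg =
  "{f :: complex \<times> complex \<Rightarrow> complex.
      continuous_on closed_bidisc f \<and> analytic2_on f open_bidisc \<and> (\<forall>z. z \<notin> closed_bidisc \<longrightarrow> f z = 0)}"
  morphisms apply_bidisc Abs_bidisc
proof
  let ?z = "\<lambda>_ :: complex \<times> complex. 0 :: complex"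
  show "?z \<in> {f. continuous_on closed_bidisc f \<and> analytic2_on f open_bidisc \<and>
      (\<forall>z. z \<notin> closed_bidisc \<longrightarrow> f z = 0)}"
    unfolding analytic2_on_def by (auto intro!: exI[of _ 0])
qed

definition of_bidisc_fun :: "(complex \<times> complex \<Rightarrow> complex) \<Rightarrow> bidisc_alg" where
  "of_bidisc_fun f = Abs_bidisc (\<lambda>z. if z \<in> closed_bidisc then f z else 0)"

definition separately_holomorphic :: "(complex \<times> complex \<Rightarrow> complex) \<Rightarrow> bool" where
  "separately_holomorphic f \<longleftrightarrow>
     (\<forall>y\<in>ball 0 1. (\<lambda>x. f (x, y)) holomorphic_on ball 0 1) \<and>
     (\<forall>x\<in>ball 0 1. (\<lambda>y. f (x, y)) holomorphic_on ball 0 1)"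

lemma apply_of_bidisc_fun:
  assumes cont: "continuous_on closed_bidisc f" and hol: "separately_holomorphic f"
    and z: "z \<in> closed_bidisc"
  shows "apply_bidisc (of_bidisc_fun f) z = f z"
proof -
  let ?g = "\<lambda>z. if z \<in> closed_bidisc then f z else 0"
  have c: "continuous_on closed_bidisc ?g"
    using cont by (rule continuous_on_eq) auto
  have "analytic2_on ?g open_bidisc"
  proof (rule analytic2_onI)
    show "continuous_on open_bidisc ?g"
      by (rule continuous_on_subset[OF c]) auto
    show "(\<lambda>x. ?g (x, y)) holomorphic_on ball 0 1" if "y \<in> ball 0 1" for y
      by (rule holomorphic_transform[of "\<lambda>x. f (x, y)"])
        (use hol that in \<open>auto simp: separately_holomorphic_def\<close>)
    show "(\<lambda>y. ?g (x, y)) holomorphic_on ball 0 1" if "x \<in> ball 0 1" for x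
      by (rule holomorphic_transform[of "\<lambda>y. f (x, y)"])
        (use hol that in \<open>auto simp: separately_holomorphic_def\<close>)
  qed auto
  with c have "apply_bidisc (Abs_bidisc ?g) = ?g"
    by (intro Abs_bidisc_inverse) simp
  then show ?thesis
    using z by (simp add: of_bidisc_fun_def)
qed

lemma continuous_on_apply_bidisc: "continuous_on closed_bidisc (apply_bidisc f)"
  and analytic2_on_apply_bidisc: "analytic2_on (apply_bidisc f) open_bidisc"
  and apply_bidisc_outside: "z \<notin> closed_bidisc \<Longrightarrow> apply_bidisc f z = 0"
  using apply_bidisc[of f] by blast+

lemma separately_holomorphic_apply_bidisc: "separately_holomorphic (apply_bidisc f)"
  unfolding separately_holomorphic_def
  by (metis analytic2_on_apply_bidisc analytic2_on_imp_holomorphic_fst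
      analytic2_on_imp_holomorphic_snd)

lemma bidisc_eqI:
  assumes "\<And>z. z \<in> closed_bidisc \<Longrightarrow> apply_bidisc f z = apply_bidisc g z"
  shows "f = g"
proof -
  have "apply_bidisc f z = apply_bidisc g z" for z
    by (cases "z \<in> closed_bidisc") (use assms apply_bidisc_outside in auto)
  then show ?thesis
    using apply_bidisc_inject by blast
qed

lemma bounded_apply_bidisc: "bounded (apply_bidisc f ` closed_bidisc)"
  by (intro compact_imp_bounded compact_continuous_image continuous_on_apply_bidisc
      compact_Times compact_cball)

instantiation bidisc_alg :: "{zero, one, plus, minus, uminus, times, scaleR}"
begin

definition zero_bidisc_alg :: bidisc_alg where "0 = of_bidisc_fun (\<lambda>z. 0)"
definition one_bidisc_alg :: bidisc_alg where "1 = of_bidisc_fun (\<lambda>z. 1)"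
definition plus_bidisc_alg :: "bidisc_alg \<Rightarrow> bidisc_alg \<Rightarrow> bidisc_alg" where
  "f + g = of_bidisc_fun (\<lambda>z. apply_bidisc f z + apply_bidisc g z)"
definition minus_bidisc_alg :: "bidisc_alg \<Rightarrow> bidisc_alg \<Rightarrow> bidisc_alg" where
  "f - g = of_bidisc_fun (\<lambda>z. apply_bidisc f z - apply_bidisc g z)"
definition uminus_bidisc_alg :: "bidisc_alg \<Rightarrow> bidisc_alg" where
  "- f = of_bidisc_fun (\<lambda>z. - apply_bidisc f z)"
definition times_bidisc_alg :: "bidisc_alg \<Rightarrow> bidisc_alg \<Rightarrow> bidisc_alg" where
  "f * g = of_bidisc_fun (\<lambda>z. apply_bidisc f z * apply_bidisc g z)"
definition scaleR_bidisc_alg :: "real \<Rightarrow> bidisc_alg \<Rightarrow> bidisc_alg" where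
  "r *\<^sub>R f = of_bidisc_fun (\<lambda>z. of_real r * apply_bidisc f z)"

instance ..

end

lemma apply_bidisc_simps:
  assumes z: "z \<in> closed_bidisc"
  shows "apply_bidisc 0 z = 0"
    and "apply_bidisc 1 z = 1"
    and "apply_bidisc (f + g) z = apply_bidisc f z + apply_bidisc g z"
    and "apply_bidisc (f - g) z = apply_bidisc f z - apply_bidisc g z"
    and "apply_bidisc (- f) z = - apply_bidisc f z"
    and "apply_bidisc (f * g) z = apply_bidisc f z * apply_bidisc g z"
    and "apply_bidisc (r *\<^sub>R f) z = of_real r * apply_bidisc f z"
    and "apply_bidisc (of_bidisc_fun (\<lambda>z. c * apply_bidisc f z)) z = c * apply_bidisc f z"
  using z separately_holomorphic_apply_bidisc
  unfolding zero_bidisc_alg_def one_bidisc_alg_def plus_bidisc_alg_def minus_bidisc_alg_def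
    uminus_bidisc_alg_def times_bidisc_alg_def scaleR_bidisc_alg_def
  by (subst apply_of_bidisc_fun;
      auto intro!: continuous_intros holomorphic_intros continuous_on_apply_bidisc
        simp: separately_holomorphic_def)+

instance bidisc_alg :: comm_ring_1
proof
  show "0 \<noteq> (1 :: bidisc_alg)"
    using apply_bidisc_simps(1)[of "(0, 0)"] apply_bidisc_simps(2)[of "(0, 0)"] by fastforce
qed (rule bidisc_eqI; simp add: apply_bidisc_simps algebra_simps)+

instantiation bidisc_alg :: real_normed_algebra_1
begin

definition norm_bidisc_alg :: "bidisc_alg \<Rightarrow> real" where
  "norm f = (SUP z\<in>closed_bidisc. cmod (apply_bidisc f z))"
definition dist_bidisc_alg :: "bidisc_alg \<Rightarrow> bidisc_alg \<Rightarrow> real" where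
  "dist_bidisc_alg f g = norm (f - g)"
definition sgn_bidisc_alg :: "bidisc_alg \<Rightarrow> bidisc_alg" where
  "sgn_bidisc_alg f = inverse (norm f) *\<^sub>R f"
definition uniformity_bidisc_alg :: "(bidisc_alg \<times> bidisc_alg) filter" where
  "uniformity_bidisc_alg = (INF e\<in>{0<..}. principal {(f, g). dist f g < e})"
definition open_bidisc_alg :: "bidisc_alg set \<Rightarrow> bool" where
  "open_bidisc_alg S = (\<forall>f\<in>S. \<forall>\<^sub>F (f', g) in uniformity. f' = f \<longrightarrow> g \<in> S)"

lemma norm_apply_bidisc_le:
  assumes "z \<in> closed_bidisc"
  shows "cmod (apply_bidisc f z) \<le> norm f"
proof -
  obtain B where "\<And>v. v \<in> closed_bidisc \<Longrightarrow> cmod (apply_bidisc f v) \<le> B"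
    using bounded_apply_bidisc[of f] unfolding bounded_iff by blast
  then have "bdd_above ((\<lambda>v. cmod (apply_bidisc f v)) ` closed_bidisc)"
    by (rule bdd_aboveI2)
  with assms show ?thesis
    unfolding norm_bidisc_alg_def by (rule cSUP_upper)
qed

lemma norm_bidisc_leI:
  assumes "\<And>z. z \<in> closed_bidisc \<Longrightarrow> cmod (apply_bidisc f z) \<le> B"
  shows "norm f \<le> B"
  unfolding norm_bidisc_alg_def by (rule cSUP_least) (use assms in auto)

lemma norm_bidisc_scale:
  assumes "\<And>z. z \<in> closed_bidisc \<Longrightarrow> cmod (apply_bidisc g z) = a * cmod (apply_bidisc f z)"
    and a: "0 \<le> a"
  shows "norm g = a * norm f"
proof (cases "a = 0")
  case True
  then have "norm g \<le> 0"
    by (intro norm_bidisc_leI) (use assms in auto)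
  moreover have "0 \<le> norm g"
    by (rule order_trans[OF norm_ge_zero norm_apply_bidisc_le[of "(0, 0)"]]) simp
  ultimately show ?thesis using True by simp
next
  case False
  then have a': "a > 0" using a by simp
  have "norm g \<le> a * norm f"
    by (rule norm_bidisc_leI) (metis a assms(1) norm_apply_bidisc_le mult_left_mono)
  moreover have "norm f \<le> norm g / a"
  proof (rule norm_bidisc_leI)
    fix z assume "z \<in> closed_bidisc"
    with norm_apply_bidisc_le[of z g] assms(1)[of z] a' show "cmod (apply_bidisc f z) \<le> norm g / a"
      by (simp add: field_simps)
  qed
  ultimately show ?thesis using a' by (simp add: field_simps)
qed

instance
proof
  fix f g :: bidisc_alg and a :: real
  show "dist f g = norm (f - g)"
    by (rule dist_bidisc_alg_def)
  show "sgn f = inverse (norm f) *\<^sub>R f"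
    by (rule sgn_bidisc_alg_def)
  show "uniformity = (INF e\<in>{0<..}. principal {(x :: bidisc_alg, y). dist x y < e})"
    by (rule uniformity_bidisc_alg_def)
  show "open U = (\<forall>x\<in>U. \<forall>\<^sub>F (x', y) in uniformity. x' = x \<longrightarrow> y \<in> U)" for U :: "bidisc_alg set"
    by (rule open_bidisc_alg_def)
  show "norm f = 0 \<longleftrightarrow> f = 0"
  proof
    assume "norm f = 0"
    then show "f = 0"
      by (intro bidisc_eqI) (use norm_apply_bidisc_le[of _ f] in \<open>auto simp: apply_bidisc_simps\<close>)
  next
    assume "f = 0"
    then show "norm f = 0"
      using norm_bidisc_scale[of f 0 f] by (simp add: apply_bidisc_simps)
  qed
  show "norm (f + g) \<le> norm f + norm g"
    by (intro norm_bidisc_leI)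
      (simp add: apply_bidisc_simps norm_triangle_mono norm_apply_bidisc_le)
  show "norm (a *\<^sub>R f) = \<bar>a\<bar> * norm f"
    by (rule norm_bidisc_scale) (auto simp: apply_bidisc_simps norm_mult)
  show "norm (f * g) \<le> norm f * norm g"
  proof (rule norm_bidisc_leI)
    fix z assume z: "z \<in> closed_bidisc"
    then have "0 \<le> norm f"
      by (rule order_trans[OF norm_ge_zero norm_apply_bidisc_le])
    with z show "cmod (apply_bidisc (f * g) z) \<le> norm f * norm g"
      by (simp add: apply_bidisc_simps norm_mult mult_mono norm_apply_bidisc_le)
  qed
  have "norm (1 :: bidisc_alg) \<le> 1"
    by (rule norm_bidisc_leI) (simp add: apply_bidisc_simps)
  then show "norm (1 :: bidisc_alg) = 1"
    using norm_apply_bidisc_le[of "(0, 0)" 1] by (simp add: apply_bidisc_simps)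
qed (rule bidisc_eqI; simp add: apply_bidisc_simps algebra_simps)+

end

instance bidisc_alg :: banach
proof
  fix X :: "nat \<Rightarrow> bidisc_alg"
  assume X: "Cauchy X"
  let ?F = "\<lambda>n. apply_bidisc (X n)"
  have le: "cmod (?F m z - ?F n z) \<le> dist (X m) (X n)" if "z \<in> closed_bidisc" for m n z
    using norm_apply_bidisc_le[OF that, of "X m - X n"] that
    by (simp add: apply_bidisc_simps dist_norm)
  have "uniformly_Cauchy_on closed_bidisc ?F"
    unfolding uniformly_Cauchy_on_def
  proof safe
    fix e :: real assume "e > 0"
    then obtain M where "\<forall>m\<ge>M. \<forall>n\<ge>M. dist (X m) (X n) < e"
      using X unfolding Cauchy_def by blast
    with le show "\<exists>M. \<forall>z\<in>closed_bidisc. \<forall>m\<ge>M. \<forall>n\<ge>M. dist (?F m z) (?F n z) < e"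
      by (metis dist_norm le_less_trans)
  qed
  then obtain g where g: "uniform_limit closed_bidisc ?F g sequentially"
    using Cauchy_uniformly_convergent uniformly_convergent_on_def by blast
  have cont: "continuous_on closed_bidisc g"
    by (rule uniform_limit_theorem[OF _ g]) (simp_all add: continuous_on_apply_bidisc)
  have hol: "h holomorphic_on ball 0 1"
    if u: "uniform_limit (cball 0 1) H h sequentially"
      and c: "\<And>n. continuous_on (cball 0 1) (H n)" and "\<And>n. H n holomorphic_on ball 0 1"
    for H :: "nat \<Rightarrow> complex \<Rightarrow> complex" and h
    by (rule holomorphic_uniform_limit[OF _ u]) (use that in auto)
  have sep: "separately_holomorphic g"
    unfolding separately_holomorphic_def
  proof safe
    fix y :: complex assume y: "y \<in> ball 0 1"
    show "(\<lambda>x. g (x, y)) holomorphic_on ball 0 1"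
    proof (rule hol)
      show "uniform_limit (cball 0 1) (\<lambda>n x. ?F n (x, y)) (\<lambda>x. g (x, y)) sequentially"
        using g y unfolding uniform_limit_iff by (force elim!: eventually_mono)
      show "continuous_on (cball 0 1) (\<lambda>x. ?F n (x, y))" for n
        by (rule continuous_on_compose2[OF continuous_on_apply_bidisc])
          (use y in \<open>auto intro!: continuous_intros\<close>)
      show "(\<lambda>x. ?F n (x, y)) holomorphic_on ball 0 1" for n
        using separately_holomorphic_apply_bidisc y unfolding separately_holomorphic_def by blast
    qed
  next
    fix x :: complex assume x: "x \<in> ball 0 1"
    show "(\<lambda>y. g (x, y)) holomorphic_on ball 0 1"
    proof (rule hol)
      show "uniform_limit (cball 0 1) (\<lambda>n y. ?F n (x, y)) (\<lambda>y. g (x, y)) sequentially"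
        using g x unfolding uniform_limit_iff by (force elim!: eventually_mono)
      show "continuous_on (cball 0 1) (\<lambda>y. ?F n (x, y))" for n
        by (rule continuous_on_compose2[OF continuous_on_apply_bidisc])
          (use x in \<open>auto intro!: continuous_intros\<close>)
      show "(\<lambda>y. ?F n (x, y)) holomorphic_on ball 0 1" for n
        using separately_holomorphic_apply_bidisc x unfolding separately_holomorphic_def by blast
    qed
  qed
  have "X \<longlonglongrightarrow> of_bidisc_fun g"
  proof (rule metric_LIMSEQ_I)
    fix e :: real assume e: "e > 0"
    then have "\<forall>\<^sub>F n in sequentially. \<forall>z\<in>closed_bidisc. dist (?F n z) (g z) < e / 2"
      using g unfolding uniform_limit_iff by (meson half_gt_zero)
    then obtain N where N: "\<And>n z. n \<ge> N \<Longrightarrow> z \<in> closed_bidisc \<Longrightarrow> dist (?F n z) (g z) < e / 2"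
      unfolding eventually_sequentially by blast
    have "dist (X n) (of_bidisc_fun g) < e" if "n \<ge> N" for n
    proof -
      have "norm (X n - of_bidisc_fun g) \<le> e / 2"
        by (rule norm_bidisc_leI)
          (use N[OF that] in \<open>force simp: apply_bidisc_simps apply_of_bidisc_fun[OF cont sep] dist_norm\<close>)
      with e show ?thesis by (simp add: dist_norm)
    qed
    then show "\<exists>N. \<forall>n\<ge>N. dist (X n) (of_bidisc_fun g) < e" by blast
  qed
  then show "convergent X" by (rule convergentI)
qed

instantiation bidisc_alg :: complex_banach
begin

definition scaleC_bidisc_alg :: "complex \<Rightarrow> bidisc_alg \<Rightarrow> bidisc_alg" where
  "c *\<^sub>C f = of_bidisc_fun (\<lambda>z. c * apply_bidisc f z)"

lemma apply_bidisc_scaleC: "z \<in> closed_bidisc \<Longrightarrow> apply_bidisc (c *\<^sub>C f) z = c * apply_bidisc f z"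
  unfolding scaleC_bidisc_alg_def by (rule apply_bidisc_simps)

instance
proof
  fix f :: bidisc_alg and c :: complex
  show "norm (c *\<^sub>C f) = cmod c * norm f"
    by (rule norm_bidisc_scale) (auto simp: apply_bidisc_scaleC norm_mult)
qed (rule bidisc_eqI; simp add: apply_bidisc_simps apply_bidisc_scaleC algebra_simps)+

end

definition invertible_on_torus :: "bidisc_alg \<Rightarrow> bool" where
  "invertible_on_torus w \<longleftrightarrow>
     (\<exists>g. continuous_on torus g \<and> (\<forall>z\<in>torus. apply_bidisc w z * g z = 1))"


section \<open>Moebius transformations of the disc and weighted composition operators\<close>

text \<open>
  Only the values on the closed disc matter. A holomorphic bijection of the open disc onto itself
  has holomorphic inverse; the continuity clause makes the values on the circle those of the
  extension.
\<close>

definition disc_moebius :: "(complex \<Rightarrow> complex) \<Rightarrow> bool" where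
  "disc_moebius p \<longleftrightarrow> p holomorphic_on ball 0 1 \<and> bij_betw p (ball 0 1) (ball 0 1) \<and>
     continuous_on (cball 0 1) p"

definition parabolic_moebius :: "(complex \<Rightarrow> complex) \<Rightarrow> bool" where
  "parabolic_moebius p \<longleftrightarrow> disc_moebius p \<and> (\<exists>z\<in>cball 0 1. p z \<noteq> z) \<and>
     (\<exists>s\<in>sphere 0 1. {z \<in> cball 0 1. p z = z} = {s})"

definition weighted_comp :: "bidisc_alg \<Rightarrow> (complex \<times> complex \<Rightarrow> complex \<times> complex) \<Rightarrow>
    bidisc_alg \<Rightarrow> bidisc_alg" where
  "weighted_comp w p f = of_bidisc_fun (\<lambda>z. apply_bidisc w z * apply_bidisc f (p z))"

lemma disc_moebius_cball:
  assumes "disc_moebius p" "z \<in> cball 0 1"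
  shows "p z \<in> cball 0 1"
proof -
  have "p ` closure (ball 0 1) \<subseteq> cball 0 1"
    by (rule image_closure_subset) (use assms in \<open>auto simp: disc_moebius_def bij_betw_def\<close>)
  with assms(2) show ?thesis by (simp add: image_subset_iff)
qed

text \<open>The operator is the intended one, i.e. the product on the right is in the bidisc algebra.\<close>

lemma apply_weighted_comp:
  assumes p: "disc_moebius p" and q: "disc_moebius q" and z: "z \<in> closed_bidisc"
  shows "apply_bidisc (weighted_comp w (\<lambda>(z1, z2). (p z1, q z2)) f) z =
    apply_bidisc w z * apply_bidisc f (p (fst z), q (snd z))"
proof -
  let ?h = "\<lambda>z. apply_bidisc w z * apply_bidisc f (case z of (z1, z2) \<Rightarrow> (p z1, q z2))"
  have pc: "continuous_on (cball 0 1) p" and qc: "continuous_on (cball 0 1) q"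
    and ph: "p holomorphic_on ball 0 1" and qh: "q holomorphic_on ball 0 1"
    and pb: "p ` ball 0 1 = ball 0 1" and qb: "q ` ball 0 1 = ball 0 1"
    using p q by (auto simp: disc_moebius_def bij_betw_def)
  have w: "(\<lambda>x. apply_bidisc w (x, y)) holomorphic_on ball 0 1"
    "(\<lambda>x. apply_bidisc w (y, x)) holomorphic_on ball 0 1" if "y \<in> ball 0 1" for y
    using separately_holomorphic_apply_bidisc[of w] that by (auto simp: separately_holomorphic_def)
  have f: "(\<lambda>x. apply_bidisc f (x, y)) holomorphic_on ball 0 1"
    "(\<lambda>x. apply_bidisc f (y, x)) holomorphic_on ball 0 1" if "y \<in> ball 0 1" for y
    using separately_holomorphic_apply_bidisc[of f] that by (auto simp: separately_holomorphic_def)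
  have "continuous_on closed_bidisc (\<lambda>z. (p (fst z), q (snd z)))"
    by (intro continuous_on_Pair continuous_on_compose2[OF pc] continuous_on_compose2[OF qc]
        continuous_intros) auto
  then have c: "continuous_on closed_bidisc ?h"
    unfolding case_prod_unfold
    by (intro continuous_on_mult continuous_on_apply_bidisc
        continuous_on_compose2[OF continuous_on_apply_bidisc[of f]])
      (use disc_moebius_cball[OF p] disc_moebius_cball[OF q] in auto)
  have "separately_holomorphic ?h"
    unfolding separately_holomorphic_def
  proof (intro conjI ballI)
    fix y :: complex assume y: "y \<in> ball 0 1"
    then have qy: "q y \<in> ball 0 1" using qb by blast
    show "(\<lambda>x. ?h (x, y)) holomorphic_on ball 0 1"
      using w(1)[OF y] holomorphic_on_compose_gen[OF ph f(1)[OF qy]] pb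
      by (auto intro!: holomorphic_on_mult simp: o_def)
  next
    fix y :: complex assume y: "y \<in> ball 0 1"
    then have py: "p y \<in> ball 0 1" using pb by blast
    show "(\<lambda>x. ?h (y, x)) holomorphic_on ball 0 1"
      using w(2)[OF y] holomorphic_on_compose_gen[OF qh f(2)[OF py]] qb
      by (auto intro!: holomorphic_on_mult simp: o_def)
  qed
  from apply_of_bidisc_fun[OF c this z] show ?thesis
    by (simp add: weighted_comp_def case_prod_unfold)
qed

lemma bounded_clinear_weighted_comp:
  assumes p: "disc_moebius p" and q: "disc_moebius q"
  shows "bounded_clinear (weighted_comp w (\<lambda>(z1, z2). (p z1, q z2)))"
proof -
  let ?T = "weighted_comp w (\<lambda>(z1, z2). (p z1, q z2))"
  have mem: "(p (fst z), q (snd z)) \<in> closed_bidisc" if "z \<in> closed_bidisc" for z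
    using disc_moebius_cball[OF p, of "fst z"] disc_moebius_cball[OF q, of "snd z"] that
    by (auto simp: mem_Times_iff)
  note T = apply_weighted_comp[OF p q]
  have "bounded_linear ?T"
  proof (rule bounded_linear_intro)
    show "?T (f + g) = ?T f + ?T g" for f g
      by (rule bidisc_eqI)
        (simp only: T mem apply_bidisc_simps(3) distrib_left)
    show "?T (r *\<^sub>R f) = r *\<^sub>R ?T f" for r f
      by (rule bidisc_eqI) (simp only: T mem apply_bidisc_simps(7) mult.left_commute)
    show "norm (?T f) \<le> norm f * norm w" for f
    proof (rule norm_bidisc_leI)
      fix z assume z: "z \<in> closed_bidisc"
      have "cmod (apply_bidisc w z * apply_bidisc f (p (fst z), q (snd z))) \<le> norm w * norm f"
        unfolding norm_mult using z mem[OF z] by (intro mult_mono norm_apply_bidisc_le) simp_all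
      then show "cmod (apply_bidisc (?T f) z) \<le> norm f * norm w"
        by (simp only: T[OF z] mult.commute)
    qed
  qed
  moreover have "?T (c *\<^sub>C f) = c *\<^sub>C ?T f" for c f
    by (rule bidisc_eqI) (simp only: T mem apply_bidisc_scaleC mult.left_commute)
  ultimately show ?thesis
    by (simp add: bounded_clinear_def)
qed

end

theory Submission
  imports Defs
begin

text \<open>
  In the coordinate \<open>u = (\<xi> + z) / (\<xi> - z)\<close>, which turns the disc into the right half-plane and \<open>\<xi>\<close> into
  infinity, a parabolic transformation fixing \<open>\<xi>\<close> is the translation \<open>u \<mapsto> u + \<i>\<tau>\<close> with a real
  \<open>\<tau> \<noteq> 0\<close> (\<open>parabolic_moebius_normal_form\<close>). Hence all orbits of the product map \<open>\<Phi>\<close> tend to the common fixed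
  point, whose weight is \<open>c\<close>, and the time an orbit spends outside a neighbourhood of that point is bounded
  independently of the orbit (\<open>few_visits\<close>).

  The regular points follow from this. The product of the weights along \<open>n\<close> steps is
  \<open>O(a ^ n)\<close> for every \<open>a > \<bar>c\<bar>\<close>, so a Neumann series inverts \<open>l - T\<close> for \<open>\<bar>l\<bar> > \<bar>c\<bar>\<close>
  (\<open>resolvent_outer\<close>). If \<open>w\<close> is a unit, the inverse of \<open>T\<close> is an operator of the same kind with
  \<open>1 / c\<close> in place of \<open>c\<close>, which covers \<open>\<bar>l\<bar> < \<bar>c\<bar>\<close> (\<open>resolvent_inner_invertible\<close>). If \<open>w\<close> merely has no
  zero on the torus, where every element attains its norm, then the weight products on the torus are at
  least \<open>d * b ^ n\<close> for every \<open>b < \<bar>c\<bar>\<close>, and \<open>l - T\<close> is bounded below for \<open>\<bar>l\<bar> < \<bar>c\<bar>\<close>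
  (\<open>resolvent_inner_bounded_below\<close>).

  The singular points come from two criteria. The operator \<open>l - T\<close> is not upper semi-Fredholm once it
  has approximate null vectors of norm bounded away from zero that vanish pointwise in the limit on the
  open bidisc (\<open>not_upper_semi_Fredholm_bidisc\<close>). Its range has infinite codimension once there are functionals that are
  arbitrarily large in norm, while they stay bounded on the image of the unit ball and small on any
  prescribed finite set of elements (\<open>not_fin_codim_rangeI\<close>).

  \<^item> On the circle \<open>\<bar>l\<bar> = \<bar>c\<bar>\<close> the null vectors are \<open>exp (- s u)\<close> times slowly varying rational functions of
    \<open>u\<close> that concentrate near the fixed point; translation multiplies them by nearly \<open>l / c\<close>
    (\<open>approximate_eigenvectors\<close>). The functionals are weighted sums of point evaluations over a long piece of orbit near the
    fixed point (\<open>not_lower_circle\<close>). For \<open>c = 0\<close> the circle is the point \<open>0\<close> and the fixed point is a zero of \<open>w\<close>, to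
    which the construction of the next item applies (\<open>not_lower_zero\<close>).
  \<^item> For \<open>\<bar>l\<bar> < \<bar>c\<bar>\<close>, a zero \<open>q\<close> of \<open>w\<close> with a coordinate on the unit circle yields functionals supported on
    the backward orbits of \<open>q\<close> and of nearby points (\<open>not_lower_inner\<close>). The coefficients decay geometrically
    because the weights tend to \<open>c\<close>, and the coordinate on the circle admits peak functions that see only one point.
  \<^item> For \<open>\<bar>l\<bar> < \<bar>c\<bar>\<close> and a zero on the torus, dually, sums of peak functions along the forward orbit are
    approximate null vectors (\<open>not_upper_inner\<close>).

  A weight without inverse has a zero in the closed bidisc, and then also a zero with a coordinate on
  the unit circle (\<open>zero_reaches_boundary\<close>). So in both remaining cases the range of \<open>l - T\<close> has infinite
  codimension for \<open>\<bar>l\<bar> < \<bar>c\<bar>\<close>; whether \<open>l - T\<close> is upper semi-Fredholm there depends on the zeros on the torus.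
\<close>


section \<open>Consequences of the Baire category theorem\<close>

lemma Baire_closed_cover:
  fixes R :: "'a::{complete_space,metric_space} set"
  assumes R: "closed R" "R \<noteq> {}" and cover: "R = (\<Union>k. A (k::nat))"
  shows "\<exists>k. \<exists>y\<in>R. \<exists>r>0. ball y r \<inter> R \<subseteq> closure (A k)"
proof (rule ccontr)
  assume neg: "\<not> ?thesis"
  let ?X = "top_of_set R"
  have sub: "closure (A k) \<subseteq> R" for k
    using R(1) cover by (metis UN_upper UNIV_I closure_minimal)
  have "?X interior_of \<Union>(range (\<lambda>k. closure (A k))) = {}"
  proof (rule Baire_category_alt)
    have "completely_metrizable_space ?X"
      using R(1) by (simp add: completely_metrizable_space_closedin completely_metrizable_space_euclidean)
    then show "completely_metrizable_space ?X \<or> locally_compact_space ?X \<and> regular_space ?X" ..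
    show "countable (range (\<lambda>k. closure (A k)))" by simp
    fix U assume "U \<in> range (\<lambda>k. closure (A k))"
    then obtain k where U: "U = closure (A k)" by auto
    have "closedin ?X U"
      using sub[of k] by (simp add: U closed_subset)
    moreover have "?X interior_of U = {}"
    proof (rule ccontr)
      assume "?X interior_of U \<noteq> {}"
      then obtain y V where "openin ?X V" "y \<in> V" "V \<subseteq> U"
        by (auto simp: interior_of_def)
      then have "V \<subseteq> R" "\<exists>e>0. ball y e \<inter> R \<subseteq> V"
        by (auto simp: openin_contains_ball)
      then obtain e where "y \<in> R" "e > 0" "ball y e \<inter> R \<subseteq> U"
        using \<open>y \<in> V\<close> \<open>V \<subseteq> U\<close> by blast
      with neg U show False by blast
    qed
    ultimately show "closedin ?X U \<and> ?X interior_of U = {}" ..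
  qed
  moreover have "\<Union>(range (\<lambda>k. closure (A k))) = R"
    using sub cover closure_subset by blast
  ultimately show False
    using R(2) interior_of_topspace[of ?X] by simp
qed

lemma uniform_boundedness:
  fixes \<mu> :: "'i \<Rightarrow> 'a::banach \<Rightarrow> 'b::real_normed_vector"
  assumes lin: "\<And>i. bounded_linear (\<mu> i)" and pt: "\<And>x. \<exists>K. \<forall>i. norm (\<mu> i x) \<le> K"
  shows "\<exists>C. \<forall>i x. norm (\<mu> i x) \<le> C * norm x"
proof -
  define A where "A k = {x. \<forall>i. norm (\<mu> i x) \<le> real k}" for k :: nat
  have clA: "closed (A k)" for k
  proof -
    have "A k = (\<Inter>i. {x. norm (\<mu> i x) \<le> real k})" by (auto simp: A_def)
    moreover have "closed {x. norm (\<mu> i x) \<le> real k}" for i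
      by (intro closed_Collect_le continuous_intros linear_continuous_on lin)
    ultimately show ?thesis by auto
  qed
  have cover: "(UNIV :: 'a set) = (\<Union>k. A k)"
  proof -
    have "\<exists>k. x \<in> A k" for x
    proof -
      obtain K where "\<forall>i. norm (\<mu> i x) \<le> K" using pt by blast
      moreover obtain k :: nat where "K \<le> real k" using real_arch_simple by blast
      ultimately have "x \<in> A k" by (auto simp: A_def intro: order_trans)
      then show ?thesis ..
    qed
    then show ?thesis by auto
  qed
  from Baire_closed_cover[OF _ _ cover] obtain k y r
    where r: "r > 0" and "ball y r \<subseteq> closure (A k)" by auto
  then have bA: "ball y r \<subseteq> A k" using clA by simp
  have "norm (\<mu> i x) \<le> 4 * real k / r * norm x" for i x
  proof (cases "x = 0")
    case True
    then show ?thesis using linear_0[OF bounded_linear.linear[OF lin]] by simp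
  next
    case False
    interpret bounded_linear "\<mu> i" by (rule lin)
    define t where "t = r / (2 * norm x)"
    have t: "t > 0" using r False by (simp add: t_def)
    have "y + t *\<^sub>R x \<in> ball y r" "y \<in> ball y r"
      using r False by (auto simp: dist_norm t_def)
    then have "norm (\<mu> i (y + t *\<^sub>R x)) \<le> k" "norm (\<mu> i y) \<le> k"
      using bA unfolding A_def by blast+
    moreover have eq: "t *\<^sub>R \<mu> i x = \<mu> i (y + t *\<^sub>R x) - \<mu> i y"
      by (simp add: add scaleR)
    ultimately have "norm (t *\<^sub>R \<mu> i x) \<le> 2 * real k"
      unfolding eq using norm_triangle_ineq4[of "\<mu> i (y + t *\<^sub>R x)" "\<mu> i y"] by linarith
    then show ?thesis using t r False by (simp add: t_def field_simps)
  qed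
  then show ?thesis by blast
qed

text \<open>
  The open mapping theorem for an operator onto its closed range. By the Baire property some multiple of the
  unit ball has an image that is dense near a point, hence, by symmetry and convexity, near zero. So every element
  of the range has a preimage of controlled norm up to half of its own norm; summing the corrections gives
  an exact preimage.
\<close>

lemma closed_range_bounded_preimages:
  fixes S :: "'a::banach \<Rightarrow> 'b::banach"
  assumes lin: "bounded_linear S" and cl: "closed (range S)"
  shows "\<exists>C>0. \<forall>x. \<exists>x'. S x' = S x \<and> norm x' \<le> C * norm (S x)"
proof -
  interpret S: bounded_linear S by (rule lin)
  define A where "A k = S ` cball 0 (real k)" for k :: nat
  have cover: "range S = (\<Union>k. A k)"
  proof -
    have "S x \<in> (\<Union>k. A k)" for x
    proof -
      obtain k :: nat where "norm x \<le> real k" using real_arch_simple by blast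
      then have "S x \<in> A k" by (auto simp: A_def)
      then show ?thesis by blast
    qed
    then show ?thesis by (auto simp: A_def)
  qed
  have ne: "range S \<noteq> {}" by blast
  from Baire_closed_cover[OF cl ne cover] obtain k y r
    where r: "r > 0" and y: "y \<in> range S" and b: "ball y r \<inter> range S \<subseteq> closure (A k)" by blast
  have range_add: "a + b \<in> range S" and range_diff: "a - b \<in> range S"
    if "a \<in> range S" "b \<in> range S" for a b
    using that by (auto simp flip: S.add S.diff)
  have range_scale: "t *\<^sub>R a \<in> range S" if "a \<in> range S" for a t
    using that by (auto simp flip: S.scaleR)
  have approx: "\<exists>x. norm x \<le> real k \<and> norm (z - S x) < e"
    if z: "z \<in> range S" "norm z < r" and e: "e > 0" for z e
  proof -
    have "y + z \<in> range S" "y - z \<in> range S"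
      using y z range_add range_diff by blast+
    moreover have "y + z \<in> ball y r" "y - z \<in> ball y r"
      using z by (auto simp: dist_norm)
    ultimately have "y + z \<in> closure (A k)" "y - z \<in> closure (A k)" using b by blast+
    then obtain x1 x2 where x: "norm x1 \<le> k" "dist (S x1) (y + z) < e"
      "norm x2 \<le> k" "dist (S x2) (y - z) < e"
      using e unfolding closure_approachable A_def by force
    let ?x = "(1/2) *\<^sub>R (x1 - x2)"
    have "norm ?x \<le> k" using x norm_triangle_ineq4[of x1 x2] by simp
    moreover have "z - S ?x = (1/2) *\<^sub>R ((y + z - S x1) - (y - z - S x2))"
      by (simp add: S.scaleR S.diff algebra_simps flip: scaleR_left.add)
    then have "norm (z - S ?x) \<le> (norm (y + z - S x1) + norm (y - z - S x2)) / 2"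
      using norm_triangle_ineq4[of "y + z - S x1" "y - z - S x2"] by simp
    then have "norm (z - S ?x) < e"
      using x by (simp add: dist_norm norm_minus_commute)
    ultimately show ?thesis by blast
  qed
  define K where "K = 2 * real k / r"
  have half: "\<exists>x. norm x \<le> K * norm z \<and> norm (z - S x) \<le> norm z / 2" if z: "z \<in> range S" for z
  proof (cases "z = 0")
    case True
    then show ?thesis by (intro exI[of _ 0]) (simp add: S.zero)
  next
    case False
    define t where "t = r / (2 * norm z)"
    have t: "t > 0" using r False by (simp add: t_def)
    have "t *\<^sub>R z \<in> range S" using z by (rule range_scale)
    moreover have "norm (t *\<^sub>R z) < r" using r False by (simp add: t_def)
    moreover have "t * norm z / 2 > 0" using t False by simp
    ultimately obtain x where x: "norm x \<le> k" "norm (t *\<^sub>R z - S x) < t * norm z / 2"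
      using approx by blast
    have "norm ((1/t) *\<^sub>R x) \<le> K * norm z"
      using x(1) r False t by (simp add: K_def t_def field_simps)
    moreover have "z - S ((1/t) *\<^sub>R x) = (1/t) *\<^sub>R (t *\<^sub>R z - S x)"
      using t by (simp add: S.scaleR algebra_simps)
    then have "norm (z - S ((1/t) *\<^sub>R x)) = norm (t *\<^sub>R z - S x) / t"
      using t by simp
    then have "norm (z - S ((1/t) *\<^sub>R x)) \<le> norm z / 2"
      using x(2) t by (simp add: pos_divide_le_eq mult.commute)
    ultimately show ?thesis by blast
  qed
  then obtain g where g: "\<And>z. z \<in> range S \<Longrightarrow> norm (g z) \<le> K * norm z"
    "\<And>z. z \<in> range S \<Longrightarrow> norm (z - S (g z)) \<le> norm z / 2" by metis
  have K0: "K \<ge> 0" using r by (simp add: K_def)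
  have main: "\<exists>x'. S x' = z \<and> norm x' \<le> (2 * K + 1) * norm z" if z: "z \<in> range S" for z
  proof -
    define v where "v n = ((\<lambda>z. z - S (g z)) ^^ n) z" for n
    have v0: "v 0 = z" and vS: "v (Suc n) = v n - S (g (v n))" for n by (auto simp: v_def)
    have vR: "v n \<in> range S" for n
      by (induction n) (simp_all add: z v0 vS range_diff)
    have vn: "norm (v n) \<le> (1/2)^n * norm z" for n
    proof (induction n)
      case (Suc n)
      then show ?case using g(2)[OF vR[of n]] by (simp add: vS)
    qed (simp add: v0)
    have gn: "norm (g (v n)) \<le> (1/2)^n * (K * norm z)" for n
      using g(1)[OF vR[of n]] mult_left_mono[OF vn[of n] K0] by (simp add: algebra_simps)
    have sums: "(\<lambda>n. (1/2)^n * (K * norm z)) sums (2 * (K * norm z))"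
      using sums_mult2[OF geometric_sums[of "1/2::real"], of "K * norm z"] by simp
    have sg: "summable (\<lambda>n. norm (g (v n)))"
      by (rule summable_comparison_test'[OF sums_summable[OF sums], of 0]) (use gn in auto)
    then have sg': "summable (\<lambda>n. g (v n))" by (rule summable_norm_cancel)
    have "norm (\<Sum>n. g (v n)) \<le> (\<Sum>n. norm (g (v n)))" by (rule summable_norm[OF sg])
    also have "\<dots> \<le> (\<Sum>n. (1/2)^n * (K * norm z))"
      by (rule suminf_le[OF gn sg sums_summable[OF sums]])
    finally have nb: "norm (\<Sum>n. g (v n)) \<le> 2 * K * norm z"
      using sums_unique[OF sums] by simp
    have "v \<longlonglongrightarrow> 0"
    proof (rule Lim_null_comparison)
      show "\<forall>\<^sub>F n in sequentially. norm (v n) \<le> (1/2)^n * norm z" using vn by simp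
      show "(\<lambda>n. (1/2)^n * norm z) \<longlonglongrightarrow> 0"
        by (intro tendsto_mult_left_zero LIMSEQ_power_zero) simp
    qed
    then have "(\<lambda>n. v n - v (Suc n)) sums (v 0 - 0)" by (rule telescope_sums')
    then have "(\<lambda>n. S (g (v n))) sums z" by (simp add: vS v0)
    then have "S (\<Sum>n. g (v n)) = z"
      using S.suminf[OF sg'] sums_unique by metis
    moreover have "2 * K * norm z \<le> (2 * K + 1) * norm z" by (simp add: distrib_right)
    ultimately show ?thesis using nb by (intro exI[of _ "\<Sum>n. g (v n)"] conjI) linarith+
  qed
  then show ?thesis using K0 by (intro exI[of _ "2*K+1"]) auto
qed

section \<open>Criteria for failing to be semi-Fredholm\<close>

text \<open>
  A new spanning vector outside the old span has positive distance from it, because the old span is sequentially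
  closed by induction. That distance bounds the coefficient of the new vector along a bounded sequence.
\<close>

lemma finite_span_bounded_seq_compact:
  fixes B :: "'a::complex_banach set"
  assumes "finite B"
  shows "\<And>x :: nat \<Rightarrow> 'a. (\<And>n. x n \<in> complex_vector.span B) \<Longrightarrow> bounded (range x) \<Longrightarrow>
    \<exists>r l. strict_mono (r :: nat \<Rightarrow> nat) \<and> l \<in> complex_vector.span B \<and> (x \<circ> r) \<longlonglongrightarrow> l"
  using assms
proof (induction B rule: finite_induct)
  case empty
  then have "x n = 0" for n by (simp add: complex_vector.span_empty)
  then have "x = (\<lambda>_. 0)" by auto
  then show ?case
    by (intro exI[of _ id] exI[of _ 0]) (auto simp: strict_mono_def)
next
  case (insert b B)
  show ?case
  proof (cases "b \<in> complex_vector.span B")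
    case True
    then have "complex_vector.span (insert b B) = complex_vector.span B"
      by (rule complex_vector.span_redundant)
    then show ?thesis using insert by metis
  next
    case False
    have "\<exists>d>0. \<forall>y\<in>complex_vector.span B. d \<le> norm (b - y)"
    proof (rule ccontr)
      assume "\<not> ?thesis"
      then have "\<exists>y\<in>complex_vector.span B. norm (b - y) < inverse (real (Suc n))" for n
        by (meson inverse_Suc not_le)
      then obtain y where y: "\<And>n. y n \<in> complex_vector.span B"
        and yb: "\<And>n. norm (b - y n) < inverse (real (Suc n))" by metis
      have lim: "y \<longlonglongrightarrow> b"
        by (rule LIM_zero_cancel, rule Lim_null_comparison[OF _ LIMSEQ_inverse_real_of_nat])
          (use yb in \<open>simp add: norm_minus_commute less_imp_le del: of_nat_Suc\<close>)
      then have "bounded (range y)"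
        by (simp add: convergent_imp_bounded)
      with insert.IH[of y, OF y] obtain r l where r: "strict_mono (r :: nat \<Rightarrow> nat)" "l \<in> complex_vector.span B" "(y \<circ> r) \<longlonglongrightarrow> l"
        by blast
      then have "l = b" using LIMSEQ_subseq_LIMSEQ[OF lim] LIMSEQ_unique by blast
      with r(2) False show False by simp
    qed
    then obtain d where d: "d > 0" "\<And>y. y \<in> complex_vector.span B \<Longrightarrow> d \<le> norm (b - y)" by blast
    have "\<forall>n. \<exists>k. x n - k *\<^sub>C b \<in> complex_vector.span B"
      using insert.prems(1) by (simp add: complex_vector.span_breakdown_eq)
    then obtain c where c: "\<And>n. x n - c n *\<^sub>C b \<in> complex_vector.span B"
      by metis
    obtain M where M: "\<And>n. norm (x n) \<le> M"
      using insert.prems(2) by (auto simp: bounded_iff)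
    have cb: "cmod (c n) * d \<le> M" for n
    proof (cases "c n = 0")
      case True
      then show ?thesis using M[of n] norm_ge_zero[of "x n"] by (simp del: norm_ge_zero)
    next
      case nz: False
      let ?y = "(- inverse (c n)) *\<^sub>C (x n - c n *\<^sub>C b)"
      have "?y \<in> complex_vector.span B" by (intro complex_vector.span_scale c)
      then have "d \<le> norm (b - ?y)" by (rule d(2))
      moreover have "c n *\<^sub>C (b - ?y) = x n"
        using nz by (simp add: complex_vector.scale_right_diff_distrib complex_vector.scale_minus_left scaleC_one)
      then have "cmod (c n) * norm (b - ?y) = norm (x n)" by (metis norm_scaleC)
      ultimately show ?thesis
        using M[of n] mult_left_mono[of d "norm (b - ?y)" "cmod (c n)"] by simp
    qed
    have "bounded (range c)"
      unfolding bounded_iff using cb d(1) by (intro exI[of _ "M / d"]) (auto simp: field_simps)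
    then obtain r1 c0 where r1: "strict_mono (r1 :: nat \<Rightarrow> nat)" "(c \<circ> r1) \<longlonglongrightarrow> c0"
      using bounded_imp_convergent_subsequence by blast
    define y where "y n = x (r1 n) - c (r1 n) *\<^sub>C b" for n
    have "norm (y n) \<le> M + M / d * norm b" for n
    proof -
      have "cmod (c (r1 n)) * norm b \<le> M / d * norm b"
        using cb[of "r1 n"] d(1) by (intro mult_right_mono) (auto simp: field_simps)
      then show ?thesis
        using norm_triangle_ineq4[of "x (r1 n)" "c (r1 n) *\<^sub>C b"] M[of "r1 n"]
        by (simp add: y_def norm_scaleC)
    qed
    then have "bounded (range y)" unfolding bounded_iff by blast
    moreover have "y n \<in> complex_vector.span B" for n using c by (simp add: y_def)
    ultimately obtain r2 l where r2: "strict_mono (r2 :: nat \<Rightarrow> nat)" "l \<in> complex_vector.span B" "(y \<circ> r2) \<longlonglongrightarrow> l"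
      using insert.IH[of y] by blast
    have cl: "(\<lambda>n. c (r1 (r2 n))) \<longlonglongrightarrow> c0"
      using LIMSEQ_subseq_LIMSEQ[OF r1(2) r2(1)] by (simp add: o_def)
    have "(\<lambda>n. (c (r1 (r2 n))) *\<^sub>C b) \<longlonglongrightarrow> c0 *\<^sub>C b"
    proof (rule LIM_zero_cancel)
      have "(\<lambda>n. norm (c (r1 (r2 n)) - c0) * norm b) \<longlonglongrightarrow> 0"
        using cl by (intro tendsto_mult_left_zero tendsto_norm_zero LIM_zero)
      then show "(\<lambda>n. c (r1 (r2 n)) *\<^sub>C b - c0 *\<^sub>C b) \<longlonglongrightarrow> 0"
        by (simp add: tendsto_norm_zero_iff flip: norm_scaleC complex_vector.scale_left_diff_distrib)
    qed
    then have "(\<lambda>n. y (r2 n) + c (r1 (r2 n)) *\<^sub>C b) \<longlonglongrightarrow> l + c0 *\<^sub>C b"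
      using r2(3) by (intro tendsto_add) (auto simp: o_def)
    then have "(x \<circ> (r1 \<circ> r2)) \<longlonglongrightarrow> l + c0 *\<^sub>C b"
      by (simp add: y_def o_def)
    moreover have "l + c0 *\<^sub>C b \<in> complex_vector.span (insert b B)"
      using r2(2) by (auto simp: complex_vector.span_breakdown_eq intro!: exI[of _ c0])
    moreover have "strict_mono (r1 \<circ> r2)" using r1 r2 by (simp add: strict_mono_o)
    ultimately show ?thesis by blast
  qed
qed

text \<open>
  If the range were closed, each \<open>x n\<close> would differ from a kernel element by a vector of norm at most a constant
  times \<open>\<epsilon>\<close>. In a finite-dimensional kernel a subsequence of these kernel elements converges, and the limit, tested
  with the norming set \<open>E\<close>, is bounded by a multiple of \<open>\<epsilon>\<close>, whereas its norm is close to that of \<open>x n\<close>. As the constant is not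
  known in advance, \<open>d\<close> has to serve all \<open>\<epsilon>\<close>; for each single \<open>\<epsilon>\<close> the images only need to be of size \<open>\<epsilon>\<close>.
\<close>

lemma not_upper_semi_FredholmI:
  fixes S :: "'a::complex_banach \<Rightarrow> 'a" and E :: "('a \<Rightarrow> complex) set"
  assumes S: "bounded_clinear S"
    and E_diff: "\<And>e x y. e \<in> E \<Longrightarrow> e (x - y) = e x - e y"
    and E_le: "\<And>e x. e \<in> E \<Longrightarrow> cmod (e x) \<le> norm x"
    and E_norm: "\<And>x K. (\<And>e. e \<in> E \<Longrightarrow> cmod (e x) \<le> K) \<Longrightarrow> norm x \<le> K"
    and d: "d > 0"
    and seq: "\<And>\<epsilon>. \<epsilon> > 0 \<Longrightarrow> \<exists>x :: nat \<Rightarrow> 'a. bounded (range x) \<and> (\<forall>e\<in>E. (\<lambda>n. e (x n)) \<longlonglongrightarrow> 0) \<and>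
        (\<forall>\<^sub>F n in sequentially. d \<le> norm (x n) \<and> norm (S (x n)) \<le> \<epsilon>)"
  shows "\<not> upper_semi_Fredholm S"
proof
  assume "upper_semi_Fredholm S"
  then obtain B where cl: "closed (range S)" and B: "finite B" "{x. S x = 0} = complex_vector.span B"
    unfolding upper_semi_Fredholm_def fin_dim_kernel_def by blast
  have lin: "bounded_linear S" using S by (simp add: bounded_clinear_def)
  interpret S: bounded_linear S by (rule lin)
  obtain C where C: "C > 0" and pre: "\<And>x. \<exists>x'. S x' = S x \<and> norm x' \<le> C * norm (S x)"
    using closed_range_bounded_preimages[OF lin cl] by blast
  define \<epsilon> where "\<epsilon> = d / (4 * C)"
  have e: "\<epsilon> > 0" using C d by (simp add: \<epsilon>_def)
  from seq[OF e] obtain x :: "nat \<Rightarrow> 'a" where x: "bounded (range x)" "\<And>e. e \<in> E \<Longrightarrow> (\<lambda>n. e (x n)) \<longlonglongrightarrow> 0"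
    "\<forall>\<^sub>F n in sequentially. d \<le> norm (x n) \<and> norm (S (x n)) \<le> \<epsilon>" by blast
  then obtain N where N: "\<And>n. n \<ge> N \<Longrightarrow> d \<le> norm (x n) \<and> norm (S (x n)) \<le> \<epsilon>"
    unfolding eventually_sequentially by blast
  have "\<forall>n. \<exists>v. S v = S (x n) \<and> norm v \<le> C * norm (S (x n))"
    using pre by blast
  from choice[OF this] obtain u
    where u: "\<And>n. S (u n) = S (x n)" "\<And>n. norm (u n) \<le> C * norm (S (x n))" by blast
  have uN: "norm (u n) \<le> d / 4" if "n \<ge> N" for n
    using u(2)[of n] mult_left_mono[of "norm (S (x n))" \<epsilon> C] N[OF that] C by (simp add: \<epsilon>_def)
  define k where "k n = x (n + N) - u (n + N)" for n
  have "k n \<in> complex_vector.span B" for n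
  proof -
    have "S (k n) = 0" by (simp add: k_def S.diff u)
    then show ?thesis using B(2) by blast
  qed
  moreover have "bounded (range k)"
  proof -
    obtain M where M: "\<And>n. norm (x n) \<le> M" using x(1) by (auto simp: bounded_iff)
    have "norm (k n) \<le> M + d / 4" for n
      using norm_triangle_ineq4[of "x (n+N)" "u (n+N)"] M[of "n+N"] uN[of "n+N"] by (simp add: k_def)
    then show ?thesis unfolding bounded_iff by blast
  qed
  ultimately obtain r l where r: "strict_mono (r :: nat \<Rightarrow> nat)" "(k \<circ> r) \<longlonglongrightarrow> l"
    using finite_span_bounded_seq_compact[OF B(1), of k] by blast
  have "cmod (e l) \<le> d / 4" if "e \<in> E" for e
  proof -
    have "(\<lambda>n. cmod (e (x (r n + N))) + (d / 4 + norm (k (r n) - l))) \<longlonglongrightarrow> 0 + (d / 4 + 0)"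
    proof (intro tendsto_add tendsto_const)
      have "strict_mono (\<lambda>n. r n + N)" using r(1) by (simp add: strict_mono_def)
      from LIMSEQ_subseq_LIMSEQ[OF x(2)[OF that] this]
      show "(\<lambda>n. cmod (e (x (r n + N)))) \<longlonglongrightarrow> 0"
        by (intro tendsto_norm_zero) (simp add: o_def)
      show "(\<lambda>n. norm (k (r n) - l)) \<longlonglongrightarrow> 0"
        using r(2) by (intro tendsto_norm_zero LIM_zero) (simp add: o_def)
    qed
    moreover have "cmod (e l) \<le> cmod (e (x (r n + N))) + (d / 4 + norm (k (r n) - l))" for n
    proof -
      have "e l = e (x (r n + N)) - (e (u (r n + N)) + e (k (r n) - l))"
        unfolding E_diff[OF that] k_def by simp
      then have "cmod (e l) \<le> cmod (e (x (r n + N))) + cmod (e (u (r n + N)) + e (k (r n) - l))"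
        by (metis norm_triangle_ineq4)
      also have "\<dots> \<le> cmod (e (x (r n + N))) + (cmod (e (u (r n + N))) + cmod (e (k (r n) - l)))"
        using norm_triangle_ineq by auto
      also have "\<dots> \<le> cmod (e (x (r n + N))) + (d / 4 + norm (k (r n) - l))"
        using E_le[OF that, of "u (r n + N)"] E_le[OF that, of "k (r n) - l"] uN[of "r n + N"]
        by linarith
      finally show ?thesis .
    qed
    ultimately show ?thesis
      by (intro LIMSEQ_le_const[where X = "\<lambda>n. cmod (e (x (r n + N))) + (d / 4 + norm (k (r n) - l))"]) auto
  qed
  then have l: "norm l \<le> d / 4" by (rule E_norm)
  have "d - d / 4 \<le> norm (k (r n))" for n
    using norm_triangle_ineq2[of "x (r n + N)" "u (r n + N)"] N[of "r n + N"] uN[of "r n + N"]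
    by (simp add: k_def)
  moreover have "(\<lambda>n. norm (k (r n))) \<longlonglongrightarrow> norm l"
    using r(2) by (intro tendsto_norm) (simp add: o_def)
  ultimately have "d - d / 4 \<le> norm l" by (intro LIMSEQ_le_const) auto
  with l d show False by simp
qed

text \<open>
  If finitely many vectors \<open>B\<close> completed the range to the whole space, the functionals belonging to \<open>B\<close> would be
  bounded at each point, hence uniformly bounded in norm by the uniform boundedness principle.
\<close>

lemma not_fin_codim_rangeI:
  fixes S :: "'a::complex_banach \<Rightarrow> 'a"
  assumes test_functional: "\<And>B N. finite B \<Longrightarrow> \<exists>\<Lambda> :: 'a \<Rightarrow> complex. bounded_linear \<Lambda> \<and> (\<forall>c x. \<Lambda> (c *\<^sub>C x) = c * \<Lambda> x) \<and>
      (\<forall>x. cmod (\<Lambda> (S x)) \<le> norm x) \<and> (\<forall>b\<in>B. cmod (\<Lambda> b) \<le> 1) \<and> (\<exists>f. norm f \<le> 1 \<and> real N \<le> cmod (\<Lambda> f))"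
  shows "\<not> fin_codim_range S"
proof
  assume "fin_codim_range S"
  then obtain B where B: "finite B" "complex_vector.span (range S \<union> B) = UNIV"
    unfolding fin_codim_range_def by blast
  have "\<forall>N. \<exists>\<Lambda> :: 'a \<Rightarrow> complex. bounded_linear \<Lambda> \<and> (\<forall>c x. \<Lambda> (c *\<^sub>C x) = c * \<Lambda> x) \<and>
      (\<forall>x. cmod (\<Lambda> (S x)) \<le> norm x) \<and> (\<forall>b\<in>B. cmod (\<Lambda> b) \<le> 1) \<and> (\<exists>f. norm f \<le> 1 \<and> real N \<le> cmod (\<Lambda> f))"
    using test_functional[OF B(1)] by blast
  from choice[OF this] obtain \<Lambda> :: "nat \<Rightarrow> 'a \<Rightarrow> complex" where
    \<Lambda>: "\<And>N. bounded_linear (\<Lambda> N)" "\<And>N c x. \<Lambda> N (c *\<^sub>C x) = c * \<Lambda> N x"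
    "\<And>N x. cmod (\<Lambda> N (S x)) \<le> norm x" "\<And>N b. b \<in> B \<Longrightarrow> cmod (\<Lambda> N b) \<le> 1"
    "\<And>N. \<exists>f. norm f \<le> 1 \<and> real N \<le> cmod (\<Lambda> N f)"
    by blast
  have "\<exists>K. \<forall>N. cmod (\<Lambda> N y) \<le> K" for y
  proof -
    have "y \<in> complex_vector.span (range S \<union> B)" using B by simp
    then show ?thesis
    proof (induction rule: complex_vector.span_induct_alt)
      case base
      then show ?case
        using linear_0[OF bounded_linear.linear[OF \<Lambda>(1)]] by auto
    next
      case (step c x y)
      then obtain K where K: "\<And>N. cmod (\<Lambda> N y) \<le> K" by blast
      obtain L where L: "\<And>N. cmod (\<Lambda> N x) \<le> L"
        using step(1) \<Lambda>(3,4) by blast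
      have "cmod (\<Lambda> N (c *\<^sub>C x + y)) \<le> cmod c * L + K" for N
      proof -
        have "\<Lambda> N (c *\<^sub>C x + y) = c * \<Lambda> N x + \<Lambda> N y"
          by (simp add: linear_add[OF bounded_linear.linear[OF \<Lambda>(1)]] \<Lambda>(2))
        then have "cmod (\<Lambda> N (c *\<^sub>C x + y)) \<le> cmod c * cmod (\<Lambda> N x) + cmod (\<Lambda> N y)"
          by (metis norm_mult norm_triangle_ineq)
        also have "\<dots> \<le> cmod c * L + K" by (intro add_mono mult_left_mono L K) simp
        finally show ?thesis .
      qed
      then show ?case by blast
    qed
  qed
  from uniform_boundedness[OF \<Lambda>(1) this] obtain C where C: "\<And>N x. cmod (\<Lambda> N x) \<le> C * norm x" by blast
  obtain N :: nat where N: "\<bar>C\<bar> < real N" using reals_Archimedean2 by blast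
  obtain f where "norm f \<le> 1" "real N \<le> cmod (\<Lambda> N f)" using \<Lambda>(5) by blast
  moreover have "C * norm f \<le> \<bar>C\<bar> * 1"
    using \<open>norm f \<le> 1\<close> by (intro mult_mono) auto
  ultimately show False using C[of N f] N by linarith
qed


section \<open>Invertible and bounded below operators\<close>

lemma bounded_clinearD:
  assumes "bounded_clinear T"
  shows "bounded_linear T" "T (a *\<^sub>C x) = a *\<^sub>C T x" "T (x + y) = T x + T y" "T (x - y) = T x - T y" "T 0 = 0"
proof -
  show bl: "bounded_linear T" and "T (a *\<^sub>C x) = a *\<^sub>C T x" using assms by (auto simp: bounded_clinear_def)
  interpret bounded_linear T by (rule bl)
  show "T (x + y) = T x + T y" "T (x - y) = T x - T y" "T 0 = 0" by (rule add diff zero)+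
qed

lemma scaleC_scaleR: "a *\<^sub>C r *\<^sub>R x = r *\<^sub>R a *\<^sub>C (x :: 'a :: complex_banach)"
  by (simp add: scaleR_scaleC scaleC_scaleC mult.commute)

lemma bounded_clinear_scaleC: "bounded_clinear (\<lambda>x. a *\<^sub>C (x :: 'a :: complex_banach))"
  unfolding bounded_clinear_def
proof
  show "bounded_linear (\<lambda>x. a *\<^sub>C x)"
    by (rule bounded_linear_intro[where K = "cmod a"])
      (simp_all add: scaleC_add_right scaleC_scaleR norm_scaleC mult.commute)
qed (simp add: scaleC_scaleC mult.commute)

lemma bounded_clinear_compose: "bounded_clinear A \<Longrightarrow> bounded_clinear B \<Longrightarrow> bounded_clinear (A \<circ> B)"
  unfolding bounded_clinear_def by (auto simp: o_def intro: bounded_linear_compose)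

lemma bounded_clinear_diff:
  "bounded_clinear A \<Longrightarrow> bounded_clinear B \<Longrightarrow> bounded_clinear (\<lambda>x. A x - B x)"
  unfolding bounded_clinear_def
  by (auto intro: bounded_linear_sub simp: complex_vector.scale_right_diff_distrib)

lemma bounded_clinear_resolvent: "bounded_clinear T \<Longrightarrow> bounded_clinear (\<lambda>x. l *\<^sub>C x - T x)"
  by (intro bounded_clinear_diff bounded_clinear_scaleC)

lemma invertible_op_compose:
  assumes "invertible_op A" "invertible_op B"
  shows "invertible_op (A \<circ> B)"
proof -
  obtain A' B' where a: "bounded_clinear A'" "A' \<circ> A = id" "A \<circ> A' = id"
    and b: "bounded_clinear B'" "B' \<circ> B = id" "B \<circ> B' = id"
    using assms unfolding invertible_op_def by blast
  have a': "A' (A x) = x" "A (A' x) = x" and b': "B' (B x) = x" "B (B' x) = x" for x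
    using a b by (simp_all add: fun_eq_iff)
  show ?thesis
    unfolding invertible_op_def
    by (intro exI[of _ "B' \<circ> A'"] conjI bounded_clinear_compose a b) (auto simp: fun_eq_iff a' b')
qed

lemma invertible_op_scaleC: "a \<noteq> 0 \<Longrightarrow> invertible_op (\<lambda>x :: 'a :: complex_banach. a *\<^sub>C x)"
  unfolding invertible_op_def
  by (intro exI[of _ "\<lambda>x. inverse a *\<^sub>C x"] conjI bounded_clinear_scaleC)
    (auto simp: fun_eq_iff scaleC_scaleC scaleC_one)

lemma invertible_imp_lower: "invertible_op T \<Longrightarrow> lower_semi_Fredholm T"
proof -
  assume "invertible_op T"
  then obtain S where "T \<circ> S = id" unfolding invertible_op_def by blast
  then have "range T = UNIV" by (metis comp_def id_apply surjI)
  then have "complex_vector.span (range T \<union> {}) = UNIV" by simp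
  then show ?thesis unfolding lower_semi_Fredholm_def fin_codim_range_def by blast
qed

lemma invertible_imp_bounded_below:
  assumes "invertible_op T"
  shows "\<exists>d>0. \<forall>x. d * norm x \<le> norm (T x)"
proof -
  obtain S where S: "bounded_clinear S" "S \<circ> T = id" using assms unfolding invertible_op_def by blast
  obtain K where K: "K > 0" "\<And>x. norm (S x) \<le> norm x * K"
    using bounded_linear.pos_bounded[OF bounded_clinearD(1)[OF S(1)]] by blast
  have "1 / K * norm x \<le> norm (T x)" for x
    using K(2)[of "T x"] K(1) S(2) by (simp add: fun_eq_iff field_simps)
  then show ?thesis using K(1) by (intro exI[of _ "1 / K"]) auto
qed

lemma bounded_below_imp_upper:
  assumes T: "bounded_clinear T" and d: "d > 0" "\<And>x. d * norm x \<le> norm (T x)"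
  shows "upper_semi_Fredholm T"
proof -
  interpret bounded_linear T by (rule bounded_clinearD[OF T])
  have "complete (range T)"
    by (rule complete_isometric_image[OF d(1) subspace_UNIV bounded_linear_axioms])
      (use d(2) complete_UNIV in auto)
  then have "closed (range T)" by (rule complete_imp_closed)
  moreover have "{x. T x = 0} = complex_vector.span {}"
  proof -
    have "x = 0" if "T x = 0" for x using d(2)[of x] d(1) that by (simp add: mult_le_0_iff)
    then show ?thesis by (auto simp: complex_vector.span_empty zero)
  qed
  ultimately show ?thesis unfolding upper_semi_Fredholm_def fin_dim_kernel_def by blast
qed

lemma ap_spectrum_bounded_below:
  assumes d: "d > 0" "\<And>x. d * norm x \<le> norm (l *\<^sub>C x - T x)"
  shows "l \<notin> ap_spectrum T"
proof
  assume "l \<in> ap_spectrum T"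
  then obtain x where x: "\<And>n. norm (x n) = 1" "(\<lambda>n. T (x n) - l *\<^sub>C x n) \<longlonglongrightarrow> 0"
    unfolding ap_spectrum_def by blast
  have "(\<lambda>n. norm (T (x n) - l *\<^sub>C x n)) \<longlonglongrightarrow> 0" using x(2) by (rule tendsto_norm_zero)
  moreover have "d \<le> norm (T (x n) - l *\<^sub>C x n)" for n
    using d(2)[of "x n"] x(1) by (simp add: norm_minus_commute)
  ultimately have "d \<le> 0" by (intro LIMSEQ_le_const) auto
  with d(1) show False by simp
qed

lemma ap_spectrumI:
  assumes T: "bounded_clinear T" and d: "d > 0" and x: "\<forall>\<^sub>F n in sequentially. d \<le> norm (x n)"
    and lim: "(\<lambda>n. l *\<^sub>C x n - T (x n)) \<longlonglongrightarrow> 0"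
  shows "l \<in> ap_spectrum T"
proof -
  interpret bounded_linear T by (rule bounded_clinearD[OF T])
  obtain N where N: "\<And>n. n \<ge> N \<Longrightarrow> d \<le> norm (x n)" using x by (auto simp: eventually_sequentially)
  define y where "y n = (1 / norm (x (n + N))) *\<^sub>R x (n + N)" for n
  have pos: "norm (x (n + N)) > 0" for n by (rule less_le_trans[OF d N]) simp
  have y1: "norm (y n) = 1" for n using pos[of n] by (simp add: y_def)
  have yT: "norm (T (y n) - l *\<^sub>C y n) = norm (l *\<^sub>C x (n + N) - T (x (n + N))) / norm (x (n + N))" for n
    by (simp add: y_def scaleR scaleC_scaleR norm_minus_commute flip: scaleR_diff_right)
  have lim': "(\<lambda>n. norm (l *\<^sub>C x (n + N) - T (x (n + N))) / d) \<longlonglongrightarrow> 0"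
    using LIMSEQ_ignore_initial_segment[OF tendsto_norm_zero[OF lim], of N]
    by (auto intro: tendsto_divide_zero)
  have "(\<lambda>n. T (y n) - l *\<^sub>C y n) \<longlonglongrightarrow> 0"
  proof (rule Lim_null_comparison[OF _ lim'])
    show "\<forall>\<^sub>F n in sequentially. norm (T (y n) - l *\<^sub>C y n) \<le> norm (l *\<^sub>C x (n + N) - T (x (n + N))) / d"
    proof (intro always_eventually allI)
      fix n
      show "norm (T (y n) - l *\<^sub>C y n) \<le> norm (l *\<^sub>C x (n + N) - T (x (n + N))) / d"
        unfolding yT using N[of "n + N"] d by (intro divide_left_mono mult_pos_pos pos) auto
    qed
  qed
  with y1 show ?thesis unfolding ap_spectrum_def by blast
qed

lemma neumann_invertible:
  fixes T :: "'a::complex_banach \<Rightarrow> 'a"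
  assumes T: "bounded_clinear T" and bd: "\<And>n x. norm ((T ^^ n) x) \<le> C * a ^ n * norm x"
    and a: "0 < a" "a < cmod l"
  shows "invertible_op (\<lambda>x. l *\<^sub>C x - T x)"
proof -
  interpret T: bounded_linear T by (rule bounded_clinearD[OF T])
  have l0: "l \<noteq> 0" using a by auto
  define S where "S x = (\<Sum>n. inverse l ^ Suc n *\<^sub>C (T ^^ n) x)" for x
  let ?q = "a / cmod l"
  have lpos: "cmod l > 0" using l0 by simp
  have q: "0 < ?q" "?q < 1" using a lpos by (simp_all add: divide_less_eq)
  have summand_le: "norm (inverse l ^ Suc n *\<^sub>C (T ^^ n) x) \<le> ?q ^ n * (C / cmod l * norm x)" for n x
  proof -
    have "norm (inverse l ^ Suc n *\<^sub>C (T ^^ n) x) = norm ((T ^^ n) x) / cmod l ^ Suc n"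
      by (simp add: norm_scaleC norm_power norm_inverse norm_mult power_inverse divide_inverse)
    also have "\<dots> \<le> C * a ^ n * norm x / cmod l ^ Suc n"
      using bd[of n x] by (intro divide_right_mono) auto
    finally show ?thesis by (simp add: power_divide mult_ac)
  qed
  have geo: "(\<lambda>n. ?q ^ n * (C / cmod l * norm x)) sums (1 / (1 - ?q) * (C / cmod l * norm x))" for x
    using q by (intro sums_mult2 geometric_sums) auto
  have sn: "summable (\<lambda>n. norm (inverse l ^ Suc n *\<^sub>C (T ^^ n) x))" for x
    by (rule summable_comparison_test'[OF sums_summable[OF geo], of 0]) (use summand_le in auto)
  have sm: "summable (\<lambda>n. inverse l ^ Suc n *\<^sub>C (T ^^ n) x)" for x
    by (rule summable_norm_cancel[OF sn])
  have Tn: "(T ^^ n) (x + y) = (T ^^ n) x + (T ^^ n) y" "(T ^^ n) (b *\<^sub>C x) = b *\<^sub>C (T ^^ n) x" for n x y b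
    by (induction n) (auto simp: T.add bounded_clinearD(2)[OF T])
  have S_add: "S (x + y) = S x + S y" for x y
    unfolding S_def Tn scaleC_add_right using sm sm by (rule suminf_add[symmetric])
  have S_scale: "S (b *\<^sub>C x) = b *\<^sub>C S x" for b x
  proof -
    have "(\<lambda>n. b *\<^sub>C (inverse l ^ Suc n *\<^sub>C (T ^^ n) x)) = (\<lambda>n. inverse l ^ Suc n *\<^sub>C (T ^^ n) (b *\<^sub>C x))"
      by (simp add: Tn scaleC_scaleC mult.commute)
    then show ?thesis
      using bounded_linear.suminf[OF bounded_clinearD(1)[OF bounded_clinear_scaleC] sm, of b x]
      by (simp add: S_def)
  qed
  have S_norm: "norm (S x) \<le> norm x * (1 / (1 - ?q) * (C / cmod l))" for x
  proof -
    have "norm (S x) \<le> (\<Sum>n. norm (inverse l ^ Suc n *\<^sub>C (T ^^ n) x))"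
      unfolding S_def by (rule summable_norm[OF sn])
    also have "\<dots> \<le> (\<Sum>n. ?q ^ n * (C / cmod l * norm x))"
      by (rule suminf_le[OF summand_le sn sums_summable[OF geo]])
    also have "\<dots> = norm x * (1 / (1 - ?q) * (C / cmod l))"
      using sums_unique[OF geo, of x] by (simp add: mult.commute)
    finally show ?thesis .
  qed
  have "bounded_clinear S"
    unfolding bounded_clinear_def
    by (intro conjI allI S_scale bounded_linear_intro[OF S_add _ S_norm])
      (simp add: S_scale scaleR_scaleC)
  moreover have ST: "S (T x) = T (S x)" for x
    unfolding S_def using T.suminf[OF sm, of x] by (simp add: bounded_clinearD(2)[OF T] funpow_swap1)
  moreover have TS: "l *\<^sub>C S x - T (S x) = x" for x
  proof -
    have lS: "l *\<^sub>C (inverse l ^ Suc n *\<^sub>C y) = inverse l ^ n *\<^sub>C y" for n and y :: 'a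
      using l0 by (simp add: scaleC_scaleC flip: mult.assoc)
    have "l *\<^sub>C S x = (\<Sum>n. l *\<^sub>C (inverse l ^ Suc n *\<^sub>C (T ^^ n) x))"
      unfolding S_def by (rule bounded_linear.suminf[OF bounded_clinearD(1)[OF bounded_clinear_scaleC] sm])
    also have "\<dots> = (\<Sum>n. inverse l ^ n *\<^sub>C (T ^^ n) x)" by (simp only: lS)
    finally have 1: "l *\<^sub>C S x = (\<Sum>n. inverse l ^ n *\<^sub>C (T ^^ n) x)" .
    have "T (S x) = (\<Sum>n. T (inverse l ^ Suc n *\<^sub>C (T ^^ n) x))"
      unfolding S_def by (rule T.suminf[OF sm])
    also have "\<dots> = (\<Sum>n. inverse l ^ Suc n *\<^sub>C (T ^^ Suc n) x)"
      by (simp add: bounded_clinearD(2)[OF T])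
    finally have 2: "T (S x) = (\<Sum>n. inverse l ^ Suc n *\<^sub>C (T ^^ Suc n) x)" .
    have "summable (\<lambda>n. l *\<^sub>C (inverse l ^ Suc n *\<^sub>C (T ^^ n) x))"
      by (rule bounded_linear.summable[OF bounded_clinearD(1)[OF bounded_clinear_scaleC] sm])
    then have "summable (\<lambda>n. inverse l ^ n *\<^sub>C (T ^^ n) x)" by (simp only: lS)
    from suminf_split_head[OF this] show ?thesis using 1 2 by (simp add: scaleC_one)
  qed
  ultimately show ?thesis
    unfolding invertible_op_def
    by (intro exI[of _ S]) (auto simp: fun_eq_iff S_scale bounded_linear.linear linear_diff bounded_clinear_def)
qed

text \<open>
  For each \<open>n\<close> the norm of \<open>l ^ n x - T ^ n x\<close> is bounded by a multiple of the norm of \<open>l x - T x\<close>. For large \<open>n\<close> it is also at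
  least a multiple of the norm of \<open>x\<close>, since \<open>\<bar>l\<bar> ^ n\<close> is then at most half of \<open>d * b ^ n\<close>.
\<close>

lemma bounded_below_of_powers:
  fixes T :: "'a::complex_banach \<Rightarrow> 'a"
  assumes T: "bounded_clinear T" and bd: "\<And>n x. d * b ^ n * norm x \<le> norm ((T ^^ n) x)"
    and d: "d > 0" "cmod l < b"
  shows "\<exists>e>0. \<forall>x. e * norm x \<le> norm (l *\<^sub>C x - T x)"
proof -
  interpret T: bounded_linear T by (rule bounded_clinearD[OF T])
  obtain K where K: "K > 0" "\<And>x. norm (T x) \<le> norm x * K" using T.pos_bounded by blast
  have step: "\<exists>C>0. \<forall>x. norm (l ^ n *\<^sub>C x - (T ^^ n) x) \<le> C * norm (l *\<^sub>C x - T x)" for n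
  proof (induction n)
    case 0
    show ?case by (intro exI[of _ 1]) (simp add: scaleC_one)
  next
    case (Suc n)
    then obtain C where C: "C > 0" "\<And>x. norm (l ^ n *\<^sub>C x - (T ^^ n) x) \<le> C * norm (l *\<^sub>C x - T x)"
      by blast
    have "norm (l ^ Suc n *\<^sub>C x - (T ^^ Suc n) x) \<le> (cmod l ^ n + C * K) * norm (l *\<^sub>C x - T x)" for x
    proof -
      have "l ^ Suc n *\<^sub>C x - (T ^^ Suc n) x = l ^ n *\<^sub>C (l *\<^sub>C x - T x) + T (l ^ n *\<^sub>C x - (T ^^ n) x)"
        by (simp add: T.diff bounded_clinearD(2)[OF T] complex_vector.scale_right_diff_distrib scaleC_scaleC mult.commute)
      then have "norm (l ^ Suc n *\<^sub>C x - (T ^^ Suc n) x)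
          \<le> cmod l ^ n * norm (l *\<^sub>C x - T x) + norm (T (l ^ n *\<^sub>C x - (T ^^ n) x))"
        by (metis norm_triangle_ineq norm_scaleC norm_power)
      also have "norm (T (l ^ n *\<^sub>C x - (T ^^ n) x)) \<le> C * norm (l *\<^sub>C x - T x) * K"
        using K(2) C(2)[of x] K(1) by (meson less_imp_le mult_right_mono order_trans)
      finally show ?thesis by (simp add: algebra_simps)
    qed
    moreover have "cmod l ^ n + C * K > 0" using C(1) K(1) by (simp add: add_nonneg_pos)
    ultimately show ?case by blast
  qed
  have b: "b > 0" using d(2) norm_ge_zero[of l] by linarith
  have "(\<lambda>n. (cmod l / b) ^ n) \<longlonglongrightarrow> 0"
    using d(2) b by (intro LIMSEQ_power_zero) (auto simp: field_simps)
  then have "\<forall>\<^sub>F n in sequentially. (cmod l / b) ^ n < d / 2" by (rule order_tendstoD) (use d in auto)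
  then obtain n where n: "(cmod l / b) ^ n < d / 2" by (auto simp: eventually_sequentially)
  obtain C where C: "C > 0" "\<And>x. norm (l ^ n *\<^sub>C x - (T ^^ n) x) \<le> C * norm (l *\<^sub>C x - T x)"
    using step[of n] by blast
  have "d * b ^ n / (2 * C) * norm x \<le> norm (l *\<^sub>C x - T x)" for x
  proof -
    have "cmod l ^ n \<le> d * b ^ n / 2" using n b by (simp add: power_divide field_simps)
    then have "cmod l ^ n * norm x \<le> d * b ^ n / 2 * norm x" by (intro mult_right_mono) auto
    moreover have "norm ((T ^^ n) x) - cmod l ^ n * norm x \<le> norm (l ^ n *\<^sub>C x - (T ^^ n) x)"
      by (metis norm_minus_commute norm_triangle_ineq2 norm_scaleC norm_power)
    ultimately have "d * b ^ n / 2 * norm x \<le> C * norm (l *\<^sub>C x - T x)"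
      using bd[of n x] C(2)[of x] by simp
    then show ?thesis using C(1) by (simp add: field_simps)
  qed
  then show ?thesis using d b C by (intro exI[of _ "d * b ^ n / (2 * C)"]) auto
qed

text \<open>
  Factors above \<open>a\<close> cost \<open>M / a\<close> each, and there are at most \<open>N\<close> of them, however long the product is.
\<close>

lemma prod_le_except_few:
  fixes f :: "nat \<Rightarrow> real"
  assumes f: "\<And>k. 0 \<le> f k" "\<And>k. f k \<le> M" and a: "0 < a" "a \<le> M"
    and few: "finite {k. a < f k}" "card {k. a < f k} \<le> N"
  shows "(\<Prod>k<n. f k) \<le> (M / a) ^ N * a ^ n"
proof -
  have "(\<Prod>k<n. f k) \<le> (\<Prod>k<n. a * (if a < f k then M / a else 1))"
    using f a by (intro prod_mono) auto
  also have "\<dots> = a ^ n * (M / a) ^ card ({..<n} \<inter> {k. a < f k})"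
    by (simp add: prod.distrib prod.If_cases)
  also have "\<dots> \<le> a ^ n * (M / a) ^ N"
  proof (intro mult_left_mono power_increasing)
    have "card ({..<n} \<inter> {k. a < f k}) \<le> card {k. a < f k}" by (intro card_mono few) auto
    then show "card ({..<n} \<inter> {k. a < f k}) \<le> N" using few(2) by linarith
  qed (use a in auto)
  finally show ?thesis by (simp add: mult.commute)
qed


section \<open>The bidisc algebra: slices, maximum principle, units\<close>

definition disc_alg :: "(complex \<Rightarrow> complex) \<Rightarrow> bool" where
  "disc_alg g \<longleftrightarrow> continuous_on (cball 0 1) g \<and> g holomorphic_on ball 0 1"

lemma disc_alg_const [intro]: "disc_alg (\<lambda>_. a)"
  and disc_alg_ident [intro]: "disc_alg (\<lambda>z. z)"
  by (auto simp: disc_alg_def)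

lemma disc_alg_add [intro]: "disc_alg f \<Longrightarrow> disc_alg g \<Longrightarrow> disc_alg (\<lambda>z. f z + g z)"
  and disc_alg_diff [intro]: "disc_alg f \<Longrightarrow> disc_alg g \<Longrightarrow> disc_alg (\<lambda>z. f z - g z)"
  and disc_alg_mult [intro]: "disc_alg f \<Longrightarrow> disc_alg g \<Longrightarrow> disc_alg (\<lambda>z. f z * g z)"
  by (auto simp: disc_alg_def intro!: continuous_intros holomorphic_intros)

lemma disc_alg_divide [intro]:
  assumes "disc_alg f" "disc_alg g" "\<And>z. cmod z \<le> 1 \<Longrightarrow> g z \<noteq> 0"
  shows "disc_alg (\<lambda>z. f z / g z)"
  using assms by (auto simp: disc_alg_def intro!: continuous_intros holomorphic_intros)

lemma apply_lift_fst:
  assumes "disc_alg g" "z \<in> closed_bidisc"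
  shows "apply_bidisc (of_bidisc_fun (\<lambda>z. g (fst z))) z = g (fst z)"
proof (rule apply_of_bidisc_fun[OF _ _ assms(2)])
  show "continuous_on closed_bidisc (\<lambda>z. g (fst z))"
    by (rule continuous_on_compose2[of "cball 0 1" g]) (use assms in \<open>auto simp: disc_alg_def intro!: continuous_intros\<close>)
  show "separately_holomorphic (\<lambda>z. g (fst z))"
    using assms(1) by (auto simp: separately_holomorphic_def disc_alg_def)
qed

lemma apply_lift_snd:
  assumes "disc_alg g" "z \<in> closed_bidisc"
  shows "apply_bidisc (of_bidisc_fun (\<lambda>z. g (snd z))) z = g (snd z)"
proof (rule apply_of_bidisc_fun[OF _ _ assms(2)])
  show "continuous_on closed_bidisc (\<lambda>z. g (snd z))"
    by (rule continuous_on_compose2[of "cball 0 1" g]) (use assms in \<open>auto simp: disc_alg_def intro!: continuous_intros\<close>)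
  show "separately_holomorphic (\<lambda>z. g (snd z))"
    using assms(1) by (auto simp: separately_holomorphic_def disc_alg_def)
qed

text \<open>
  For \<open>y\<close> on the unit circle holomorphy is not part of the definition; such a slice is a uniform limit of slices over
  interior points.
\<close>

lemma disc_alg_slice_fst:
  assumes y: "cmod y \<le> 1"
  shows "disc_alg (\<lambda>x. apply_bidisc f (x, y))"
  unfolding disc_alg_def
proof
  let ?F = "apply_bidisc f"
  have c: "continuous_on (cball 0 1) (\<lambda>x. ?F (x, v))" if "cmod v \<le> 1" for v
    by (rule continuous_on_compose2[OF continuous_on_apply_bidisc])
      (use that in \<open>auto intro!: continuous_intros\<close>)
  then show "continuous_on (cball 0 1) (\<lambda>x. ?F (x, y))" using y .
  define r where "r n = of_real (1 - inverse (real (Suc n))) * y" for n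
  have r1: "cmod (r n) < 1" for n
  proof -
    have "cmod (r n) = (1 - inverse (real (Suc n))) * cmod y"
      unfolding r_def norm_mult norm_of_real by (simp add: field_simps)
    also have "\<dots> \<le> (1 - inverse (real (Suc n))) * 1"
      using y by (intro mult_left_mono) (auto simp: field_simps)
    also have "\<dots> < 1" by simp
    finally show ?thesis .
  qed
  have rlim: "r \<longlonglongrightarrow> y"
  proof -
    have "(\<lambda>n. complex_of_real (1 - inverse (real (Suc n))) * y) \<longlonglongrightarrow> complex_of_real (1 - 0) * y"
      by (intro tendsto_intros LIMSEQ_inverse_real_of_nat)
    moreover have "r = (\<lambda>n. complex_of_real (1 - inverse (real (Suc n))) * y)"
      by (rule ext) (rule r_def)
    ultimately show ?thesis by (simp del: of_nat_Suc)
  qed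
  have uc: "uniformly_continuous_on closed_bidisc ?F"
    by (intro compact_uniformly_continuous continuous_on_apply_bidisc compact_Times compact_cball)
  have lim: "uniform_limit (cball 0 1) (\<lambda>n x. ?F (x, r n)) (\<lambda>x. ?F (x, y)) sequentially"
    unfolding uniform_limit_iff
  proof (intro allI impI)
    fix e :: real assume "e > 0"
    then obtain d where d: "d > 0" "\<And>z z'. z \<in> closed_bidisc \<Longrightarrow> z' \<in> closed_bidisc \<Longrightarrow> dist z' z < d \<Longrightarrow> dist (?F z') (?F z) < e"
      using uc unfolding uniformly_continuous_on_def by metis
    have "\<forall>\<^sub>F n in sequentially. dist (r n) y < d" using rlim d(1) by (rule tendstoD)
    then show "\<forall>\<^sub>F n in sequentially. \<forall>x\<in>cball 0 1. dist (?F (x, r n)) (?F (x, y)) < e"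
    proof eventually_elim
      case (elim n)
      show ?case
        using r1[of n] y elim by (auto intro!: d(2) simp: dist_Pair_Pair)
    qed
  qed
  have ev: "\<forall>\<^sub>F n in sequentially. continuous_on (cball 0 1) (\<lambda>x. ?F (x, r n)) \<and>
      (\<lambda>x. ?F (x, r n)) holomorphic_on ball 0 1"
  proof (intro always_eventually allI conjI)
    fix n
    show "continuous_on (cball 0 1) (\<lambda>x. ?F (x, r n))"
      by (rule c) (use r1[of n] in simp)
    show "(\<lambda>x. ?F (x, r n)) holomorphic_on ball 0 1"
      using separately_holomorphic_apply_bidisc[of f] r1[of n] by (simp add: separately_holomorphic_def)
  qed
  show "(\<lambda>x. ?F (x, y)) holomorphic_on ball 0 1"
    by (rule holomorphic_uniform_limit[OF ev lim]) auto
qed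

text \<open>
  The exchange of the coordinates transfers statements about slices from one coordinate to the other.
\<close>

definition flip :: "bidisc_alg \<Rightarrow> bidisc_alg" where
  "flip f = of_bidisc_fun (\<lambda>z. apply_bidisc f (snd z, fst z))"

lemma apply_flip:
  assumes "z \<in> closed_bidisc"
  shows "apply_bidisc (flip f) z = apply_bidisc f (snd z, fst z)"
  unfolding flip_def
proof (rule apply_of_bidisc_fun[OF _ _ assms])
  show "continuous_on closed_bidisc (\<lambda>z. apply_bidisc f (snd z, fst z))"
    by (rule continuous_on_compose2[OF continuous_on_apply_bidisc]) (auto intro!: continuous_intros)
  show "separately_holomorphic (\<lambda>z. apply_bidisc f (snd z, fst z))"
    using separately_holomorphic_apply_bidisc[of f] by (auto simp: separately_holomorphic_def)
qed

lemma disc_alg_slice_snd: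
  assumes "cmod x \<le> 1"
  shows "disc_alg (\<lambda>y. apply_bidisc f (x, y))"
proof -
  have "disc_alg (\<lambda>y. apply_bidisc (flip f) (y, x))" using assms by (rule disc_alg_slice_fst)
  moreover have "apply_bidisc (flip f) (y, x) = apply_bidisc f (x, y)" if "cmod y \<le> 1" for y
    using assms that by (simp add: apply_flip)
  ultimately show ?thesis
    unfolding disc_alg_def
    by (metis (no_types, lifting) continuous_on_cong holomorphic_cong mem_ball_0 mem_cball_0 less_imp_le)
qed

lemma disc_alg_max_modulus:
  assumes g: "disc_alg g" and le: "\<And>z. cmod z = 1 \<Longrightarrow> cmod (g z) \<le> B" and z: "cmod z \<le> 1"
  shows "cmod (g z) \<le> B"
  by (rule maximum_modulus_frontier[of g "cball 0 1"])
    (use assms in \<open>auto simp: disc_alg_def\<close>)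

lemma norm_bidisc_le_torus:
  assumes "\<And>z. z \<in> torus \<Longrightarrow> cmod (apply_bidisc f z) \<le> B"
  shows "norm f \<le> B"
proof (rule norm_bidisc_leI)
  fix z :: "complex \<times> complex" assume "z \<in> closed_bidisc"
  moreover obtain x y where z: "z = (x, y)" by (cases z)
  ultimately have x: "cmod x \<le> 1" and y: "cmod y \<le> 1" by auto
  have "cmod (apply_bidisc f (x', y)) \<le> B" if x': "cmod x' = 1" for x'
    by (rule disc_alg_max_modulus[OF disc_alg_slice_snd _ y]) (use x' assms in auto)
  then show "cmod (apply_bidisc f z) \<le> B"
    unfolding z by (rule disc_alg_max_modulus[OF disc_alg_slice_fst[OF y] _ x])
qed

lemma bidisc_norm_attained_torus:
  obtains z where "z \<in> torus" "cmod (apply_bidisc f z) = norm f"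
proof -
  have "compact torus" "torus \<noteq> {}" by (auto intro!: compact_Times)
  moreover have "continuous_on torus (\<lambda>z. cmod (apply_bidisc f z))"
    by (intro continuous_on_norm continuous_on_subset[OF continuous_on_apply_bidisc]) auto
  ultimately obtain z where z: "z \<in> torus" "\<And>y. y \<in> torus \<Longrightarrow> cmod (apply_bidisc f y) \<le> cmod (apply_bidisc f z)"
    using continuous_attains_sup by metis
  then have "norm f \<le> cmod (apply_bidisc f z)" by (intro norm_bidisc_le_torus)
  moreover have "cmod (apply_bidisc f z) \<le> norm f"
    using z(1) by (intro norm_apply_bidisc_le) auto
  ultimately show ?thesis using z(1) by (intro that[of z]) auto
qed

lemma bidisc_unit_iff: "w dvd (1 :: bidisc_alg) \<longleftrightarrow> (\<forall>z\<in>closed_bidisc. apply_bidisc w z \<noteq> 0)"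
proof
  assume "w dvd 1"
  then obtain v where "1 = w * v" by (auto simp: dvd_def)
  then have "apply_bidisc w z * apply_bidisc v z = 1" if "z \<in> closed_bidisc" for z
    using that by (metis apply_bidisc_simps(2,6))
  then show "\<forall>z\<in>closed_bidisc. apply_bidisc w z \<noteq> 0" by fastforce
next
  assume nz: "\<forall>z\<in>closed_bidisc. apply_bidisc w z \<noteq> 0"
  let ?v = "of_bidisc_fun (\<lambda>z. inverse (apply_bidisc w z))"
  have v: "apply_bidisc ?v z = inverse (apply_bidisc w z)" if "z \<in> closed_bidisc" for z
  proof (rule apply_of_bidisc_fun[OF _ _ that])
    show "continuous_on closed_bidisc (\<lambda>z. inverse (apply_bidisc w z))"
      using nz by (intro continuous_on_inverse continuous_on_apply_bidisc)
    show "separately_holomorphic (\<lambda>z. inverse (apply_bidisc w z))"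
      using separately_holomorphic_apply_bidisc[of w] nz
      by (auto simp: separately_holomorphic_def intro!: holomorphic_on_inverse)
  qed
  have "1 = w * ?v"
    by (rule bidisc_eqI) (use nz v in \<open>auto simp: apply_bidisc_simps\<close>)
  then show "w dvd 1" by (rule dvdI)
qed

lemma invertible_on_torus_iff: "invertible_on_torus w \<longleftrightarrow> (\<forall>z\<in>torus. apply_bidisc w z \<noteq> 0)"
proof
  assume "\<forall>z\<in>torus. apply_bidisc w z \<noteq> 0"
  moreover have "continuous_on torus (apply_bidisc w)"
    by (rule continuous_on_subset[OF continuous_on_apply_bidisc]) auto
  ultimately show "invertible_on_torus w"
    unfolding invertible_on_torus_def
    by (intro exI[of _ "\<lambda>z. inverse (apply_bidisc w z)"]) (auto intro!: continuous_on_inverse)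
qed (force simp: invertible_on_torus_def)


section \<open>The half-plane model of the disc\<close>

text \<open>
  For \<open>\<bar>\<xi>\<bar> = 1\<close> this maps the unit disc onto the right half-plane and \<open>\<xi>\<close> to infinity. At \<open>\<xi>\<close> itself division by
  zero gives the value \<open>0\<close>, so statements have to exclude that point.
\<close>

definition cayley :: "complex \<Rightarrow> complex \<Rightarrow> complex" where
  "cayley \<xi> z = (\<xi> + z) / (\<xi> - z)"

lemma Re_cayley:
  assumes "cmod \<xi> = 1"
  shows "Re (cayley \<xi> z) = (1 - (cmod z)\<^sup>2) / (cmod (\<xi> - z))\<^sup>2"
proof -
  have "(Re \<xi>)\<^sup>2 + (Im \<xi>)\<^sup>2 = 1" using assms by (simp add: cmod_def)
  then show ?thesis
    unfolding cayley_def Re_divide cmod_power2 by (simp add: power2_eq_square algebra_simps)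
qed

lemma cayley_Re_nonneg: "cmod \<xi> = 1 \<Longrightarrow> cmod z \<le> 1 \<Longrightarrow> 0 \<le> Re (cayley \<xi> z)"
  by (simp add: Re_cayley power_le_one)

lemma dist_cayley: "cmod \<xi> = 1 \<Longrightarrow> z \<noteq> \<xi> \<Longrightarrow> cmod (\<xi> - z) * cmod (cayley \<xi> z + 1) = 2"
proof -
  assume x: "cmod \<xi> = 1" "z \<noteq> \<xi>"
  then have "(\<xi> - z) * (cayley \<xi> z + 1) = 2 * \<xi>" by (simp add: cayley_def field_simps)
  then show ?thesis using x by (metis norm_mult mult.right_neutral norm_numeral)
qed

lemma cayley_imaginary_surj:
  assumes "cmod \<xi> = 1"
  shows "\<exists>z. cmod z = 1 \<and> z \<noteq> \<xi> \<and> cayley \<xi> z = \<i> * of_real y"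
proof -
  define u where "u = \<i> * of_real y"
  have u1: "u + 1 \<noteq> 0" by (auto simp: u_def complex_eq_iff)
  define z where "z = \<xi> * ((u - 1) / (u + 1))"
  have xi: "\<xi> \<noteq> 0" using assms by auto
  have "cmod (u - 1) = cmod (u + 1)" by (simp add: u_def cmod_def)
  then have "cmod z = 1" using u1 assms by (simp add: z_def norm_mult norm_divide)
  moreover have d: "\<xi> - z = 2 * \<xi> / (u + 1)" using u1 by (simp add: z_def field_simps)
  moreover have "\<xi> + z = 2 * \<xi> * u / (u + 1)" using u1 by (simp add: z_def field_simps)
  ultimately have "cayley \<xi> z = u" using u1 xi by (simp add: cayley_def)
  moreover have "z \<noteq> \<xi>" using d xi u1 by auto
  ultimately show ?thesis using \<open>cmod z = 1\<close> by (auto simp: u_def)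
qed

text \<open>
  The function \<open>1 / (u + b)\<close> of \<open>u = cayley \<xi> z\<close>, with the fraction cleared so that it takes its limit \<open>0\<close> at \<open>\<xi>\<close>.
\<close>

definition half_plane_kernel :: "complex \<Rightarrow> complex \<Rightarrow> complex \<Rightarrow> complex" where
  "half_plane_kernel \<xi> b z = (\<xi> - z) / ((\<xi> + z) + b * (\<xi> - z))"

lemma half_plane_kernel_denom:
  assumes "cmod \<xi> = 1" "cmod z \<le> 1" "Re b > 0"
  shows "(\<xi> + z) + b * (\<xi> - z) \<noteq> 0"
proof (cases "z = \<xi>")
  case True
  then show ?thesis using assms(1) by auto
next
  case False
  have "Re (cayley \<xi> z + b) > 0" using cayley_Re_nonneg[OF assms(1,2)] assms(3) by simp
  then have "cayley \<xi> z + b \<noteq> 0" by (metis less_irrefl zero_complex.sel(1))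
  moreover have "(\<xi> + z) + b * (\<xi> - z) = (\<xi> - z) * (cayley \<xi> z + b)"
    using False by (simp add: cayley_def field_simps)
  ultimately show ?thesis using False by simp
qed

lemma half_plane_kernel_eq:
  assumes "z \<noteq> \<xi>"
  shows "half_plane_kernel \<xi> b z = 1 / (cayley \<xi> z + b)"
proof -
  have "(\<xi> + z) + b * (\<xi> - z) = (\<xi> - z) * (cayley \<xi> z + b)"
    using assms by (simp add: cayley_def field_simps)
  then show ?thesis using assms by (simp add: half_plane_kernel_def)
qed

lemma half_plane_kernel_fix [simp]: "half_plane_kernel \<xi> b \<xi> = 0"
  by (simp add: half_plane_kernel_def)

lemma disc_alg_half_plane_kernel:
  assumes "cmod \<xi> = 1" "Re b > 0"
  shows "disc_alg (half_plane_kernel \<xi> b)"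
  unfolding half_plane_kernel_def
  by (intro disc_alg_divide disc_alg_add disc_alg_diff disc_alg_mult disc_alg_const disc_alg_ident
      half_plane_kernel_denom assms)

text \<open>
  The factor \<open>exp (- s u)\<close> is an eigenfunction of imaginary translations of \<open>u\<close>, but it has no limit at \<open>\<xi>\<close>. As it is
  bounded, multiplication by a kernel that vanishes at \<open>\<xi>\<close> makes it an element of the disc algebra.
\<close>

definition exp_kernel :: "complex \<Rightarrow> real \<Rightarrow> complex \<Rightarrow> complex \<Rightarrow> complex" where
  "exp_kernel \<xi> s b z = (if z = \<xi> then 0 else exp (- of_real s * cayley \<xi> z) * half_plane_kernel \<xi> b z)"

lemma exp_cayley_le_1:
  assumes "cmod \<xi> = 1" "cmod z \<le> 1" "s \<ge> 0"
  shows "cmod (exp (- of_real s * cayley \<xi> z)) \<le> 1"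
  using cayley_Re_nonneg[OF assms(1,2)] assms(3) by simp

lemma disc_alg_exp_kernel:
  assumes "cmod \<xi> = 1" "Re b > 0" "s \<ge> 0"
  shows "disc_alg (exp_kernel \<xi> s b)"
proof -
  let ?k = "half_plane_kernel \<xi> b"
  let ?g = "\<lambda>z. exp (- of_real s * cayley \<xi> z) * ?k z"
  have k: "continuous_on (cball 0 1) ?k" "?k holomorphic_on ball 0 1"
    using disc_alg_half_plane_kernel[OF assms(1,2)] by (auto simp: disc_alg_def)
  have xi: "\<xi> \<notin> ball 0 1" "\<xi> \<in> cball 0 1" using assms(1) by auto
  have hol: "?g holomorphic_on ball 0 1"
    unfolding cayley_def using xi by (intro holomorphic_intros k) auto
  have h: "exp_kernel \<xi> s b holomorphic_on ball 0 1"
    by (rule holomorphic_transform[OF hol]) (use xi in \<open>auto simp: exp_kernel_def\<close>)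
  have "continuous_on (cball 0 1) (exp_kernel \<xi> s b)"
  proof (clarsimp simp: continuous_on_eq_continuous_within)
    fix z :: complex assume z: "cmod z \<le> 1"
    show "continuous (at z within cball 0 1) (exp_kernel \<xi> s b)"
    proof (cases "z = \<xi>")
      case True
      have "(?k \<longlongrightarrow> 0) (at \<xi> within cball 0 1)"
        using k(1) xi(2) unfolding continuous_on_def by (metis half_plane_kernel_fix)
      then have "((\<lambda>z. cmod (?k z)) \<longlongrightarrow> 0) (at \<xi> within cball 0 1)" by (rule tendsto_norm_zero)
      moreover have "\<forall>\<^sub>F v in at \<xi> within cball 0 1. cmod (exp_kernel \<xi> s b v) \<le> cmod (?k v)"
        unfolding eventually_at_filter
      proof (intro always_eventually allI impI)
        fix v assume "v \<noteq> \<xi>" "v \<in> cball 0 1"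
        then show "cmod (exp_kernel \<xi> s b v) \<le> cmod (?k v)"
          using exp_cayley_le_1[OF assms(1) _ assms(3), of v]
          by (auto simp: exp_kernel_def norm_mult mult_left_le_one_le simp del: norm_exp_eq_Re)
      qed
      ultimately have "(exp_kernel \<xi> s b \<longlongrightarrow> 0) (at \<xi> within cball 0 1)"
        by (rule Lim_null_comparison[rotated])
      then show ?thesis using True by (simp add: continuous_within exp_kernel_def)
    next
      case False
      have kz: "continuous (at z within cball 0 1) ?k"
        using k(1) z by (simp add: continuous_on_eq_continuous_within)
      have "continuous (at z within cball 0 1) ?g"
        unfolding cayley_def using False by (intro continuous_intros kz) auto
      then have lim: "(?g \<longlongrightarrow> ?g z) (at z within cball 0 1)" by (simp only: continuous_within)
      have ev: "\<forall>\<^sub>F v in at z within cball 0 1. ?g v = exp_kernel \<xi> s b v"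
      proof -
        have "\<forall>\<^sub>F v in nhds z. v \<noteq> \<xi>" using False t1_space_nhds by blast
        then show ?thesis unfolding eventually_at_filter
          by eventually_elim (auto simp: exp_kernel_def)
      qed
      have "?g z = exp_kernel \<xi> s b z" using False by (simp add: exp_kernel_def)
      with Lim_transform_eventually[OF lim ev] show ?thesis by (simp only: continuous_within)
    qed
  qed
  with h show ?thesis by (simp add: disc_alg_def)
qed


section \<open>Parabolic transformations are translations\<close>

text \<open>
  Composed with the standard transformation that moves the zero of \<open>p\<close> to the origin, \<open>p\<close> and its inverse both satisfy
  the hypotheses of the Schwarz lemma; so the composition preserves absolute values and is a rotation. The equation
  extends to the closed disc by continuity.
\<close>

lemma disc_moebius_normal_form:
  assumes p: "disc_moebius p"
  shows "\<exists>u a. cmod u = 1 \<and> cmod a < 1 \<and> (\<forall>z\<in>cball 0 1. p z * (1 - cnj a * z) = u * (z - a))"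
proof -
  have hol: "p holomorphic_on ball 0 1" and bij: "bij_betw p (ball 0 1) (ball 0 1)"
    and cont: "continuous_on (cball 0 1) p" using p by (auto simp: disc_moebius_def)
  have inj: "inj_on p (ball 0 1)" and img: "p ` ball 0 1 = ball 0 1"
    using bij by (auto simp: bij_betw_def)
  obtain q where q: "q holomorphic_on ball 0 1" "\<And>z. z \<in> ball 0 1 \<Longrightarrow> q (p z) = z"
    using holomorphic_has_inverse[OF hol open_ball inj] img by metis
  have q': "q z \<in> ball 0 1 \<and> p (q z) = z" if z: "z \<in> ball 0 1" for z
  proof -
    obtain y where "y \<in> ball 0 1" "z = p y" using z img by blast
    then show ?thesis using q(2) by simp
  qed
  define a where "a = q 0"
  have a: "cmod a < 1" "p a = 0" using q'[of 0] by (auto simp: a_def)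
  let ?M = "Moebius_function 0 (-a)" and ?N = "Moebius_function 0 a"
  have M: "?M holomorphic_on ball 0 1" "?N holomorphic_on ball 0 1"
    using a by (auto intro!: Moebius_function_holomorphic)
  have M1: "cmod (?M z) < 1" "cmod (?N z) < 1" if "cmod z < 1" for z
    using a that by (auto intro!: Moebius_function_norm_lt_1)
  have MN: "?M (?N z) = z" "?N (?M z) = z" if "cmod z < 1" for z
    using a that by (auto intro!: Moebius_function_compose)
  define F where "F = p \<circ> ?M"
  define G where "G = ?N \<circ> q"
  have F: "F holomorphic_on ball 0 1"
    unfolding F_def by (rule holomorphic_on_compose_gen[OF M(1) hol]) (use M1 in auto)
  have G: "G holomorphic_on ball 0 1"
    unfolding G_def by (rule holomorphic_on_compose_gen[OF q(1) M(2)]) (use q' in auto)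
  have F0: "F 0 = 0" using a by (simp add: F_def Moebius_function_of_zero)
  have G0: "G 0 = 0" using a_def by (simp add: G_def Moebius_function_eq_zero)
  have F1: "cmod (F z) < 1" if "cmod z < 1" for z
  proof -
    have "p (?M z) \<in> ball 0 1" using img M1[OF that] by (metis imageI mem_ball_0)
    then show ?thesis by (simp add: F_def)
  qed
  have G1: "cmod (G z) < 1" if "cmod z < 1" for z
    using q'[of z] M1(2) that by (simp add: G_def)
  have GF: "G (F z) = z" if "cmod z < 1" for z
    using that M1 MN q(2) by (simp add: F_def G_def)
  let ?h = "1/2 :: complex"
  have "cmod (F ?h) \<le> cmod ?h" by (rule Schwarz_Lemma(1)[OF F F0 F1]) auto
  moreover have "cmod (G (F ?h)) \<le> cmod (F ?h)"
    by (rule Schwarz_Lemma(1)[OF G G0 G1]) (auto intro!: F1)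
  ultimately have "cmod (F ?h) = cmod ?h" using GF[of ?h] by auto
  then have "cmod ?h < 1 \<and> ?h \<noteq> 0 \<and> cmod (F ?h) = cmod ?h" by simp
  then have "\<exists>u. (\<forall>z. cmod z < 1 \<longrightarrow> F z = u * z) \<and> cmod u = 1"
    by (intro Schwarz_Lemma(3)[OF F F0 F1, of 0] disjI1 exI[of _ ?h]) auto
  then obtain u where u: "\<And>z. cmod z < 1 \<Longrightarrow> F z = u * z" "cmod u = 1" by blast
  have eq: "p z * (1 - cnj a * z) = u * (z - a)" if z: "z \<in> ball 0 1" for z
  proof -
    have z1: "cmod z < 1" using z by simp
    have "p z = F (?N z)" using MN(1)[OF z1] by (simp add: F_def)
    also have "\<dots> = u * ?N z" by (rule u(1)) (use M1 z1 in auto)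
    finally have "p z = u * ((z - a) / (1 - cnj a * z))" by (simp add: Moebius_function_simple)
    moreover have "1 - cnj a * z \<noteq> 0"
    proof
      assume "1 - cnj a * z = 0"
      then have "cmod a * cmod z = 1" by (metis complex_mod_cnj eq_iff_diff_eq_0 norm_mult norm_one)
      moreover have "cmod a * cmod z < 1" using a(1) z1 by (metis norm_mult norm_mult_less mult_1)
      ultimately show False by simp
    qed
    ultimately show ?thesis by simp
  qed
  have "p z * (1 - cnj a * z) = u * (z - a)" if z: "z \<in> cball 0 1" for z
  proof -
    have "p z * (1 - cnj a * z) - u * (z - a) = 0"
    proof (rule continuous_constant_on_closure[where S = "ball 0 1" and x = z
          and f = "\<lambda>z. p z * (1 - cnj a * z) - u * (z - a)"])
      show "continuous_on (closure (ball 0 1)) (\<lambda>z. p z * (1 - cnj a * z) - u * (z - a))"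
        using cont by (auto intro!: continuous_intros)
      show "z \<in> closure (ball 0 1)" using z by simp
      show "p x * (1 - cnj a * x) - u * (x - a) = 0" if "x \<in> ball 0 1" for x
        using eq[OF that] by simp
    qed
    then show ?thesis by simp
  qed
  then show ?thesis using u(2) a(1) by blast
qed

text \<open>
  A parabolic transformation in normal form. The inverse map \<open>q\<close> is carried along, so that exchanging \<open>p\<close> and \<open>q\<close> and
  changing the sign of \<open>\<tau>\<close> gives another instance.
\<close>

locale parabolic_disc_map =
  fixes p q :: "complex \<Rightarrow> complex" and \<xi> :: complex and \<tau> :: real
  assumes xi: "cmod \<xi> = 1" and tau: "\<tau> \<noteq> 0"
    and moebius_p: "disc_moebius p" and moebius_q: "disc_moebius q"
    and fix_p: "p \<xi> = \<xi>" and fix_q: "q \<xi> = \<xi>"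
    and q_p: "\<And>z. cmod z \<le> 1 \<Longrightarrow> q (p z) = z" and p_q: "\<And>z. cmod z \<le> 1 \<Longrightarrow> p (q z) = z"
    and cayley_p: "\<And>z. cmod z \<le> 1 \<Longrightarrow> z \<noteq> \<xi> \<Longrightarrow> cayley \<xi> (p z) = cayley \<xi> z + \<i> * of_real \<tau>"

text \<open>
  The fixed points of \<open>p\<close> are the roots of a quadratic polynomial, and the product of the two roots has absolute value \<open>1\<close>.
  Since \<open>\<xi>\<close> is the only root in the closed disc, the roots coincide, and this determines \<open>p\<close> up to one real parameter.
\<close>

lemma parabolic_moebius_normal_form:
  assumes par: "parabolic_moebius p" and fixed: "\<xi> \<in> cball 0 1" "p \<xi> = \<xi>"
  shows "\<exists>q \<tau>. parabolic_disc_map p q \<xi> \<tau>"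
proof -
  have p: "disc_moebius p" using par by (simp add: parabolic_moebius_def)
  obtain s where s: "cmod s = 1" "{z \<in> cball 0 1. p z = z} = {s}"
    using par by (auto simp: parabolic_moebius_def)
  have only: "z = \<xi>" if "cmod z \<le> 1" "p z = z" for z
    using s(2) fixed that by (metis (mono_tags, lifting) mem_Collect_eq mem_cball_0 singletonD)
  have xi: "cmod \<xi> = 1" using s fixed by (metis (mono_tags, lifting) mem_Collect_eq singletonD)
  then have xi0: "\<xi> \<noteq> 0" and xx: "\<xi> * cnj \<xi> = 1" by (auto simp: complex_norm_square[symmetric])
  obtain u a where u: "cmod u = 1" and a: "cmod a < 1"
    and nf: "\<And>z. cmod z \<le> 1 \<Longrightarrow> p z * (1 - cnj a * z) = u * (z - a)"
    using disc_moebius_normal_form[OF p] by auto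
  have uu: "u * cnj u = 1" using u by (simp add: complex_norm_square[symmetric])
  have nz: "1 - cnj a * z \<noteq> 0" if "cmod z \<le> 1" for z
  proof
    assume "1 - cnj a * z = 0"
    then have "cmod a * cmod z = 1" by (metis complex_mod_cnj eq_iff_diff_eq_0 norm_mult norm_one)
    moreover have "cmod a * cmod z \<le> cmod a * 1" using that by (intro mult_left_mono) auto
    ultimately show False using a by simp
  qed
  have a0: "a \<noteq> 0"
  proof
    assume "a = 0"
    then have "p 0 = 0" using nf[of 0] by simp
    then show False using only[of 0] xi0 by simp
  qed
  \<comment> \<open>\<open>z2\<close> is the second root of the quadratic equation for fixed points.\<close>
  have q1: "cnj a * \<xi> * \<xi> + (u - 1) * \<xi> - u * a = 0"
    using nf[of \<xi>] fixed xi by (simp add: algebra_simps)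
  define z2 where "z2 = - (u * a) / (cnj a * \<xi>)"
  have z2n: "cmod z2 = 1" using u xi a0 by (simp add: z2_def norm_mult norm_divide)
  have z2: "cnj a * \<xi> * z2 = - (u * a)" using a0 xi0 by (simp add: z2_def)
  have "(u - 1) * \<xi> = (- cnj a * (\<xi> + z2)) * \<xi>"
    using q1 z2 by (simp add: algebra_simps)
  then have sum: "u - 1 = - cnj a * (\<xi> + z2)" using xi0 by (rule mult_right_cancel[THEN iffD1, rotated])
  have "p z2 * (1 - cnj a * z2) = z2 * (1 - cnj a * z2)"
  proof -
    have "p z2 * (1 - cnj a * z2) = u * z2 - u * a" using nf[of z2] z2n by (simp add: algebra_simps)
    also have "\<dots> = u * z2 + cnj a * \<xi> * z2" using z2 by simp
    also have "u = 1 - cnj a * (\<xi> + z2)" using sum by (simp add: algebra_simps)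
    finally show ?thesis by (simp add: algebra_simps)
  qed
  then have "p z2 = z2" using nz[of z2] z2n by simp
  then have "z2 = \<xi>" using only z2n by simp
  then have ua: "u * a = - (cnj a * \<xi> * \<xi>)" and u1: "u = 1 - 2 * (cnj a * \<xi>)"
    using z2 sum by (auto simp: algebra_simps)
  define t where "t = cnj a * \<xi>"
  have t1: "cmod t < 1" using a xi by (simp add: t_def norm_mult)
  then have t1': "1 - t \<noteq> 0" by auto
  have t0: "t \<noteq> 0" using a0 xi0 by (simp add: t_def)
  \<comment> \<open>\<open>\<bar>u\<bar> = 1\<close> says that \<open>t / (1 - t)\<close> is purely imaginary, so the translation is by \<open>\<i>\<tau>\<close> with \<open>\<tau>\<close> real.\<close>
  have "(cmod (1 - 2 * t))\<^sup>2 = 1" using u u1 by (simp add: t_def)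
  then have Ret: "Re t = (cmod t)\<^sup>2" by (simp add: cmod_power2) (simp add: power2_eq_square algebra_simps)
  define r where "r = t / (1 - t)"
  define \<tau> where "\<tau> = 2 * Im r"
  have "t * cnj (1 - t) = t - of_real ((cmod t)\<^sup>2)"
    by (simp add: algebra_simps complex_norm_square flip: of_real_power)
  then have "Re (t * cnj (1 - t)) = 0" using Ret by simp
  then have "Re r = 0"
    unfolding r_def by (subst complex_div_cnj) simp
  then have "2 * r = \<i> * of_real \<tau>" by (simp add: \<tau>_def complex_eq_iff)
  then have tau: "2 * t / (1 - t) = \<i> * of_real \<tau>" by (simp add: r_def)
  have tau0: "\<tau> \<noteq> 0" using tau t0 t1' by auto
  have pz: "p z - z = cnj a * (\<xi> - z)\<^sup>2 / (1 - cnj a * z)" if "cmod z \<le> 1" for z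
  proof -
    have "(p z - z) * (1 - cnj a * z) = u * z - u * a - z + cnj a * z * z"
      using nf[OF that] by (simp add: algebra_simps)
    also have "\<dots> = cnj a * (\<xi> - z)\<^sup>2"
      unfolding ua by (simp add: u1 power2_eq_square algebra_simps)
    finally show ?thesis using nz[OF that] by (simp add: field_simps)
  qed
  have xp: "\<xi> - p z = (\<xi> - z) * (1 - t) / (1 - cnj a * z)" if "cmod z \<le> 1" for z
  proof -
    have "(\<xi> - p z) * (1 - cnj a * z) = (\<xi> - z) * (1 - cnj a * z) - (p z - z) * (1 - cnj a * z)"
      by (simp add: algebra_simps)
    also have "\<dots> = (\<xi> - z) * (1 - cnj a * z) - cnj a * (\<xi> - z)\<^sup>2"
      using pz[OF that] nz[OF that] by simp
    also have "\<dots> = (\<xi> - z) * (1 - t)" by (simp add: t_def power2_eq_square algebra_simps)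
    finally show ?thesis using nz[OF that] by (simp add: field_simps)
  qed
  have cay: "cayley \<xi> (p z) = cayley \<xi> z + \<i> * of_real \<tau>" if z: "cmod z \<le> 1" "z \<noteq> \<xi>" for z
  proof -
    have c: "cayley \<xi> v = 2 * \<xi> / (\<xi> - v) - 1" if "v \<noteq> \<xi>" for v
      using that by (simp add: cayley_def field_simps)
    have "p z \<noteq> \<xi>" using xp[OF z(1)] z t1' nz[OF z(1)] by auto
    then have "cayley \<xi> (p z) = 2 * \<xi> / (\<xi> - p z) - 1" by (rule c)
    also have "2 * \<xi> / (\<xi> - p z) = 2 * \<xi> * (1 - cnj a * z) / ((\<xi> - z) * (1 - t))"
      using xp[OF z(1)] by simp
    also have "\<dots> = 2 * \<xi> / (\<xi> - z) + 2 * t / (1 - t)"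
      using z(2) t1' by (simp add: divide_simps) (simp add: t_def algebra_simps)
    finally show ?thesis using c[OF z(2)] tau by simp
  qed
  \<comment> \<open>solving \<open>nf\<close> for \<open>z\<close>\<close>
  define q where "q z = (z + u * a) / (u + cnj a * z)" for z
  have qn: "u + cnj a * z \<noteq> 0" if "cmod z \<le> 1" for z
  proof
    assume "u + cnj a * z = 0"
    then have "cmod a * cmod z = 1" using u by (metis add_eq_0_iff complex_mod_cnj norm_minus_cancel norm_mult)
    moreover have "cmod a * cmod z \<le> cmod a * 1" using that by (intro mult_left_mono) auto
    ultimately show False using a by simp
  qed
  have qp: "q (p z) = z" if z: "cmod z \<le> 1" for z
  proof -
    have "p z \<in> cball 0 1" using disc_moebius_cball[OF p] z by simp
    then have "u + cnj a * p z \<noteq> 0" by (intro qn) simp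
    moreover have "p z + u * a = z * (u + cnj a * p z)" using nf[OF z] by (simp add: algebra_simps)
    ultimately show ?thesis by (simp add: q_def)
  qed
  have bij: "bij_betw p (ball 0 1) (ball 0 1)" using p by (simp add: disc_moebius_def)
  have img: "p ` ball 0 1 = ball 0 1" using bij by (simp add: bij_betw_def)
  have qm: "disc_moebius q"
    unfolding disc_moebius_def
  proof (intro conjI)
    show "q holomorphic_on ball 0 1"
      unfolding q_def by (intro holomorphic_intros) (auto intro!: qn)
    show "continuous_on (cball 0 1) q"
      unfolding q_def by (intro continuous_intros) (auto intro!: qn)
    show "bij_betw q (ball 0 1) (ball 0 1)"
    proof (rule bij_betw_byWitness[where f' = p])
      show "\<forall>z\<in>ball 0 1. p (q z) = z"
      proof
        fix z assume "z \<in> ball (0::complex) 1"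
        then obtain y where "y \<in> ball 0 1" "z = p y" using img by blast
        then show "p (q z) = z" using qp by simp
      qed
      show "\<forall>z\<in>ball 0 1. q (p z) = z" using qp by simp
      show "p ` ball 0 1 \<subseteq> ball 0 1" using bij by (auto simp: bij_betw_def)
      show "q ` ball 0 1 \<subseteq> ball 0 1"
      proof
        fix v assume "v \<in> q ` ball 0 1"
        then obtain z where "z \<in> ball 0 1" "v = q z" by auto
        then obtain y where "y \<in> ball 0 1" "z = p y" using img by blast
        then show "v \<in> ball 0 1" using \<open>v = q z\<close> qp by simp
      qed
    qed
  qed
  have pq: "p (q z) = z" if z: "cmod z \<le> 1" for z
  proof -
    have "cmod (q z) \<le> 1" using disc_moebius_cball[OF qm] z by simp
    moreover have "q z * (u + cnj a * z) = z + u * a" using qn[OF z] by (simp add: q_def)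
    then have "z * (1 - cnj a * q z) = u * (q z - a)" by (simp add: algebra_simps)
    ultimately show ?thesis using nf[of "q z"] nz[of "q z"] by (metis mult_right_cancel)
  qed
  have "parabolic_disc_map p q \<xi> \<tau>"
    using xi tau0 p qm fixed qp pq cay qp[of \<xi>] by unfold_locales auto
  then show ?thesis by blast
qed

context parabolic_disc_map
begin

lemma p_le_1: "cmod z \<le> 1 \<Longrightarrow> cmod (p z) \<le> 1"
  using disc_moebius_cball[OF moebius_p] by simp

lemma q_le_1: "cmod z \<le> 1 \<Longrightarrow> cmod (q z) \<le> 1"
  using disc_moebius_cball[OF moebius_q] by simp

lemma q_lt_1: "cmod z < 1 \<Longrightarrow> cmod (q z) < 1"
  using moebius_q by (force simp: disc_moebius_def bij_betw_def)

lemma p_circle: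
  assumes "cmod z = 1"
  shows "cmod (p z) = 1"
proof -
  have "\<not> cmod (p z) < 1" using q_lt_1[of "p z"] q_p[of z] assms by auto
  then show ?thesis using p_le_1[of z] assms by simp
qed

lemma p_eq_xi_iff: "cmod z \<le> 1 \<Longrightarrow> p z = \<xi> \<longleftrightarrow> z = \<xi>"
  using q_p fix_p fix_q by metis

lemma inverse_map: "parabolic_disc_map q p \<xi> (- \<tau>)"
proof
  fix z assume z: "cmod z \<le> 1" "z \<noteq> \<xi>"
  then have "q z \<noteq> \<xi>" using p_q fix_p by metis
  with cayley_p[of "q z"] z p_q q_le_1 show "cayley \<xi> (q z) = cayley \<xi> z + \<i> * of_real (- \<tau>)"
    by simp
qed (use xi tau moebius_p moebius_q fix_p fix_q q_p p_q in auto)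

lemma funpow_p_le_1: "cmod z \<le> 1 \<Longrightarrow> cmod ((p ^^ k) z) \<le> 1"
  by (induction k) (auto intro: p_le_1)

lemma funpow_p_fix: "(p ^^ k) \<xi> = \<xi>"
  by (induction k) (auto simp: fix_p)

lemma funpow_p_eq_xi_iff: "cmod z \<le> 1 \<Longrightarrow> (p ^^ k) z = \<xi> \<longleftrightarrow> z = \<xi>"
  by (induction k) (auto simp: p_eq_xi_iff funpow_p_le_1)

lemma cayley_funpow:
  "cmod z \<le> 1 \<Longrightarrow> z \<noteq> \<xi> \<Longrightarrow> cayley \<xi> ((p ^^ k) z) = cayley \<xi> z + \<i> * of_real (real k * \<tau>)"
  by (induction k) (auto simp: cayley_p funpow_p_le_1 funpow_p_eq_xi_iff algebra_simps)

lemma funpow_p_eq_iff: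
  assumes "cmod z \<le> 1" "z \<noteq> \<xi>"
  shows "(p ^^ k) z = z \<longleftrightarrow> k = 0"
  using cayley_funpow[OF assms, of k] tau by (cases "k = 0") auto

lemma continuous_on_funpow: "continuous_on (cball 0 1) (p ^^ k)"
proof (induction k)
  case 0
  then show ?case by simp
next
  case (Suc k)
  have "continuous_on (cball 0 1) p" using moebius_p by (simp add: disc_moebius_def)
  then have "continuous_on (cball 0 1) (\<lambda>z. p ((p ^^ k) z))"
    by (rule continuous_on_compose2[OF _ Suc]) (use funpow_p_le_1 in auto)
  then show ?case by (simp add: o_def)
qed

text \<open>
  The bound does not depend on \<open>z\<close>: distance at least \<open>\<delta>\<close> from \<open>\<xi>\<close> confines the imaginary part of \<open>u\<close> to an interval of length
  \<open>4 / \<delta>\<close>, and the orbit moves through it in steps of size \<open>\<bar>\<tau>\<bar>\<close>.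
\<close>

lemma few_visits:
  assumes "\<delta> > 0"
  shows "\<exists>N. \<forall>z. cmod z \<le> 1 \<longrightarrow> finite {k. \<delta> \<le> cmod ((p ^^ k) z - \<xi>)} \<and>
    card {k. \<delta> \<le> cmod ((p ^^ k) z - \<xi>)} \<le> N"
proof -
  define D where "D = nat \<lfloor>4 / (\<delta> * \<bar>\<tau>\<bar>)\<rfloor>"
  have "finite {k. \<delta> \<le> cmod ((p ^^ k) z - \<xi>)} \<and> card {k. \<delta> \<le> cmod ((p ^^ k) z - \<xi>)} \<le> D + 1"
    if z: "cmod z \<le> 1" for z
  proof (cases "\<exists>k. \<delta> \<le> cmod ((p ^^ k) z - \<xi>)")
    case False
    then show ?thesis by simp
  next
    case True
    let ?K = "{k. \<delta> \<le> cmod ((p ^^ k) z - \<xi>)}"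
    have zx: "z \<noteq> \<xi>" using True assms by (auto simp: funpow_p_fix)
    define m where "m = (LEAST k. \<delta> \<le> cmod ((p ^^ k) z - \<xi>))"
    have m: "m \<in> ?K" using True unfolding m_def by (auto intro: LeastI)
    have le: "m \<le> k" if "k \<in> ?K" for k
      using that unfolding m_def by (auto intro: Least_le)
    have im: "\<bar>Im (cayley \<xi> z) + real k * \<tau>\<bar> \<le> 2 / \<delta>" if "k \<in> ?K" for k
    proof -
      let ?v = "(p ^^ k) z"
      have d: "cmod (\<xi> - ?v) * cmod (cayley \<xi> ?v + 1) = 2"
        using z zx by (intro dist_cayley xi) (simp add: funpow_p_eq_xi_iff)
      have "\<delta> * cmod (cayley \<xi> ?v + 1) \<le> cmod (\<xi> - ?v) * cmod (cayley \<xi> ?v + 1)"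
        using that by (intro mult_right_mono) (auto simp: norm_minus_commute)
      then have "cmod (cayley \<xi> ?v + 1) \<le> 2 / \<delta>" using d assms by (simp add: field_simps)
      moreover have "\<bar>Im (cayley \<xi> ?v + 1)\<bar> \<le> cmod (cayley \<xi> ?v + 1)" by (rule abs_Im_le_cmod)
      ultimately show ?thesis using cayley_funpow[OF z zx, of k] by simp
    qed
    have "k - m \<le> D" if k: "k \<in> ?K" for k
    proof -
      have "\<bar>real k * \<tau> - real m * \<tau>\<bar> \<le> 4 / \<delta>" using im[OF k] im[OF m] by (simp add: field_simps)
      then have "real (k - m) * \<bar>\<tau>\<bar> \<le> 4 / \<delta>"
        using le[OF k] by (simp add: of_nat_diff abs_mult flip: left_diff_distrib)
      then have "real (k - m) \<le> 4 / (\<delta> * \<bar>\<tau>\<bar>)" using tau assms by (simp add: field_simps)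
      then show ?thesis unfolding D_def by (simp add: le_nat_floor)
    qed
    then have sub: "?K \<subseteq> {m..m + D}" using le by fastforce
    have "card ?K \<le> card {m..m + D}" by (rule card_mono[OF _ sub]) simp
    then show ?thesis using finite_subset[OF sub] by simp
  qed
  then show ?thesis by blast
qed

end


section \<open>Weighted composition operators: the regular points\<close>

locale bidisc_weighted_map =
  fst: parabolic_disc_map \<phi> \<phi>' \<xi> \<alpha> + snd: parabolic_disc_map \<psi> \<psi>' \<zeta> \<beta>
  for \<phi> \<phi>' \<xi> \<alpha> \<psi> \<psi>' \<zeta> \<beta> +
  fixes w :: bidisc_alg
begin

definition \<Phi> :: "complex \<times> complex \<Rightarrow> complex \<times> complex" where
  "\<Phi> z = (\<phi> (fst z), \<psi> (snd z))"

definition T :: "bidisc_alg \<Rightarrow> bidisc_alg" where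
  "T = weighted_comp w (\<lambda>(z1, z2). (\<phi> z1, \<psi> z2))"

definition c :: complex where
  "c = apply_bidisc w (\<xi>, \<zeta>)"

text \<open>
  The weight that \<open>T ^ n\<close> attaches to composition with \<open>\<Phi> ^ n\<close>.
\<close>

definition W :: "nat \<Rightarrow> complex \<times> complex \<Rightarrow> complex" where
  "W n z = (\<Prod>k<n. apply_bidisc w ((\<Phi> ^^ k) z))"

lemma bounded_clinear_T: "bounded_clinear T"
  unfolding T_def by (rule bounded_clinear_weighted_comp[OF fst.moebius_p snd.moebius_p])

lemma apply_T: "z \<in> closed_bidisc \<Longrightarrow> apply_bidisc (T f) z = apply_bidisc w z * apply_bidisc f (\<Phi> z)"
  unfolding T_def \<Phi>_def by (rule apply_weighted_comp[OF fst.moebius_p snd.moebius_p])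

lemma funpow_\<Phi>: "(\<Phi> ^^ k) z = ((\<phi> ^^ k) (fst z), (\<psi> ^^ k) (snd z))"
  by (induction k) (auto simp: \<Phi>_def)

lemma \<Phi>_bidisc: "z \<in> closed_bidisc \<Longrightarrow> \<Phi> z \<in> closed_bidisc"
  by (auto simp: \<Phi>_def mem_Times_iff fst.p_le_1 snd.p_le_1)

lemma funpow_\<Phi>_bidisc: "z \<in> closed_bidisc \<Longrightarrow> (\<Phi> ^^ k) z \<in> closed_bidisc"
  by (induction k) (auto simp: \<Phi>_bidisc)

lemma apply_funpow_T:
  "z \<in> closed_bidisc \<Longrightarrow> apply_bidisc ((T ^^ n) f) z = W n z * apply_bidisc f ((\<Phi> ^^ n) z)"
proof (induction n arbitrary: f)
  case 0
  then show ?case by (simp add: W_def)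
next
  case (Suc n)
  have "apply_bidisc ((T ^^ Suc n) f) z = apply_bidisc ((T ^^ n) (T f)) z"
    by (simp add: funpow_swap1)
  also have "\<dots> = W n z * apply_bidisc (T f) ((\<Phi> ^^ n) z)" using Suc by blast
  also have "\<dots> = W (Suc n) z * apply_bidisc f ((\<Phi> ^^ Suc n) z)"
    using Suc.prems by (simp add: apply_T funpow_\<Phi>_bidisc W_def mult.assoc)
  finally show ?case .
qed

lemma fixed_point_mem: "(\<xi>, \<zeta>) \<in> torus"
  by (simp add: fst.xi snd.xi)

lemma weight_few_visits:
  assumes e: "e > 0"
  shows "\<exists>N. \<forall>z\<in>closed_bidisc. finite {k. e \<le> cmod (apply_bidisc w ((\<Phi> ^^ k) z) - c)} \<and>
    card {k. e \<le> cmod (apply_bidisc w ((\<Phi> ^^ k) z) - c)} \<le> N"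
proof -
  have p: "(\<xi>, \<zeta>) \<in> closed_bidisc" using fixed_point_mem by auto
  then have "\<exists>d>0. \<forall>x\<in>closed_bidisc. dist x (\<xi>, \<zeta>) < d \<longrightarrow> dist (apply_bidisc w x) c < e"
    using continuous_on_apply_bidisc[of w] e unfolding continuous_on_iff c_def by blast
  then obtain d where d: "d > 0" "\<And>x. x \<in> closed_bidisc \<Longrightarrow> dist x (\<xi>, \<zeta>) < d \<Longrightarrow> dist (apply_bidisc w x) c < e"
    by blast
  obtain N1 where N1: "\<And>z. cmod z \<le> 1 \<Longrightarrow> finite {k. d/2 \<le> cmod ((\<phi> ^^ k) z - \<xi>)} \<and>
    card {k. d/2 \<le> cmod ((\<phi> ^^ k) z - \<xi>)} \<le> N1" using fst.few_visits[of "d/2"] d(1) by auto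
  obtain N2 where N2: "\<And>z. cmod z \<le> 1 \<Longrightarrow> finite {k. d/2 \<le> cmod ((\<psi> ^^ k) z - \<zeta>)} \<and>
    card {k. d/2 \<le> cmod ((\<psi> ^^ k) z - \<zeta>)} \<le> N2" using snd.few_visits[of "d/2"] d(1) by auto
  have "finite {k. e \<le> cmod (apply_bidisc w ((\<Phi> ^^ k) z) - c)} \<and>
    card {k. e \<le> cmod (apply_bidisc w ((\<Phi> ^^ k) z) - c)} \<le> N1 + N2" if z: "z \<in> closed_bidisc" for z
  proof -
    let ?A = "{k. d/2 \<le> cmod ((\<phi> ^^ k) (fst z) - \<xi>)}" and ?B = "{k. d/2 \<le> cmod ((\<psi> ^^ k) (snd z) - \<zeta>)}"
    have A: "finite ?A" "card ?A \<le> N1" and B: "finite ?B" "card ?B \<le> N2"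
      using N1[of "fst z"] N2[of "snd z"] z by (auto simp: mem_Times_iff)
    have sub: "{k. e \<le> cmod (apply_bidisc w ((\<Phi> ^^ k) z) - c)} \<subseteq> ?A \<union> ?B"
    proof (rule subsetI, rule ccontr)
      fix k assume "k \<in> {k. e \<le> cmod (apply_bidisc w ((\<Phi> ^^ k) z) - c)}" "k \<notin> ?A \<union> ?B"
      then have k: "e \<le> cmod (apply_bidisc w ((\<Phi> ^^ k) z) - c)"
        "cmod ((\<phi> ^^ k) (fst z) - \<xi>) < d/2" "cmod ((\<psi> ^^ k) (snd z) - \<zeta>) < d/2"
        by (simp_all add: not_le)
      have "dist ((\<Phi> ^^ k) z) (\<xi>, \<zeta>) \<le> dist ((\<phi> ^^ k) (fst z)) \<xi> + dist ((\<psi> ^^ k) (snd z)) \<zeta>"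
        unfolding funpow_\<Phi> dist_Pair_Pair by (rule sqrt_sum_squares_le_sum) auto
      also have "\<dots> < d" using k by (simp add: dist_norm)
      finally have "dist (apply_bidisc w ((\<Phi> ^^ k) z)) c < e" by (intro d(2) funpow_\<Phi>_bidisc z)
      then show False using k by (simp add: dist_norm)
    qed
    have "card {k. e \<le> cmod (apply_bidisc w ((\<Phi> ^^ k) z) - c)} \<le> card (?A \<union> ?B)"
      by (intro card_mono sub) (use A B in auto)
    also have "\<dots> \<le> N1 + N2" using card_Un_le[of ?A ?B] A B by linarith
    finally show ?thesis using finite_subset[OF sub] A B by auto
  qed
  then show ?thesis by blast
qed

lemma W_upper:
  assumes a: "cmod c < a"
  shows "\<exists>C. \<forall>n. \<forall>z\<in>closed_bidisc. cmod (W n z) \<le> C * a ^ n"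
proof -
  have a0: "a > 0" using a norm_ge_zero[of c] by linarith
  obtain N where N: "\<And>z. z \<in> closed_bidisc \<Longrightarrow> finite {k. a - cmod c \<le> cmod (apply_bidisc w ((\<Phi> ^^ k) z) - c)} \<and>
    card {k. a - cmod c \<le> cmod (apply_bidisc w ((\<Phi> ^^ k) z) - c)} \<le> N"
    using weight_few_visits[of "a - cmod c"] a by auto
  define M where "M = max a (norm w)"
  have "cmod (W n z) \<le> (M / a) ^ N * a ^ n" if z: "z \<in> closed_bidisc" for n z
  proof -
    have sub: "{k. a < cmod (apply_bidisc w ((\<Phi> ^^ k) z))} \<subseteq> {k. a - cmod c \<le> cmod (apply_bidisc w ((\<Phi> ^^ k) z) - c)}"
    proof clarify
      fix k assume "a < cmod (apply_bidisc w ((\<Phi> ^^ k) z))"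
      then show "a - cmod c \<le> cmod (apply_bidisc w ((\<Phi> ^^ k) z) - c)"
        using norm_triangle_ineq2[of "apply_bidisc w ((\<Phi> ^^ k) z)" c] by linarith
    qed
    have "(\<Prod>k<n. cmod (apply_bidisc w ((\<Phi> ^^ k) z))) \<le> (M / a) ^ N * a ^ n"
    proof (rule prod_le_except_few)
      show "cmod (apply_bidisc w ((\<Phi> ^^ k) z)) \<le> M" for k
        using norm_apply_bidisc_le[OF funpow_\<Phi>_bidisc[OF z], of w k] by (simp add: M_def)
      show "finite {k. a < cmod (apply_bidisc w ((\<Phi> ^^ k) z))}"
        using N[OF z] sub finite_subset by blast
      show "card {k. a < cmod (apply_bidisc w ((\<Phi> ^^ k) z))} \<le> N"
        using N[OF z] card_mono[OF _ sub] by linarith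
    qed (use a0 in \<open>auto simp: M_def\<close>)
    then show ?thesis by (simp add: W_def prod_norm)
  qed
  then show ?thesis by blast
qed

lemma resolvent_outer:
  assumes "cmod c < cmod l"
  shows "invertible_op (\<lambda>x. l *\<^sub>C x - T x)"
proof -
  obtain a where a: "cmod c < a" "a < cmod l" using assms dense by blast
  then have a0: "a > 0" using norm_ge_zero[of c] by linarith
  obtain C where C: "\<And>n z. z \<in> closed_bidisc \<Longrightarrow> cmod (W n z) \<le> C * a ^ n" using W_upper[OF a(1)] by blast
  have "norm ((T ^^ n) f) \<le> C * a ^ n * norm f" for n f
  proof (rule norm_bidisc_leI)
    fix z assume z: "z \<in> closed_bidisc"
    have "cmod (W n z) * cmod (apply_bidisc f ((\<Phi> ^^ n) z)) \<le> C * a ^ n * norm f"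
      using C[OF z, of n] by (intro mult_mono norm_apply_bidisc_le funpow_\<Phi>_bidisc z) (auto intro: order_trans[OF norm_ge_zero])
    then show "cmod (apply_bidisc ((T ^^ n) f) z) \<le> C * a ^ n * norm f"
      using z by (simp add: apply_funpow_T norm_mult)
  qed
  then show ?thesis by (rule neumann_invertible[OF bounded_clinear_T _ a0 a(2)])
qed

lemma \<Phi>_torus: "z \<in> torus \<Longrightarrow> \<Phi> z \<in> torus"
  by (auto simp: \<Phi>_def mem_Times_iff fst.p_circle snd.p_circle)

lemma funpow_\<Phi>_torus: "z \<in> torus \<Longrightarrow> (\<Phi> ^^ k) z \<in> torus"
  by (induction k) (auto simp: \<Phi>_torus)

lemma \<Phi>_torus_surj:
  assumes "z \<in> torus"
  shows "\<exists>y\<in>torus. (\<Phi> ^^ k) y = z"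
proof (induction k)
  case 0
  then show ?case using assms by auto
next
  case (Suc k)
  then obtain y where y: "y \<in> torus" "(\<Phi> ^^ k) y = z" by blast
  let ?x = "(\<phi>' (fst y), \<psi>' (snd y))"
  have "?x \<in> torus"
    using y(1) by (auto simp: mem_Times_iff parabolic_disc_map.p_circle[OF fst.inverse_map]
        parabolic_disc_map.p_circle[OF snd.inverse_map])
  moreover have "\<Phi> ?x = y" using y(1) by (auto simp: \<Phi>_def mem_Times_iff fst.p_q snd.p_q)
  then have "(\<Phi> ^^ Suc k) ?x = z" using y(2) by (simp add: funpow_swap1)
  ultimately show ?case by blast
qed

text \<open>
  Only orbits on the torus can be controlled from below, as \<open>w\<close> may have zeros elsewhere; by the maximum principle they
  suffice.
\<close>

lemma W_lower:
  assumes nz: "\<And>z. z \<in> torus \<Longrightarrow> apply_bidisc w z \<noteq> 0" and b: "0 < b" "b < cmod c"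
  shows "\<exists>d>0. \<forall>n. \<forall>z\<in>torus. d * b ^ n \<le> cmod (W n z)"
proof -
  obtain N where N: "\<And>z. z \<in> closed_bidisc \<Longrightarrow> finite {k. cmod c - b \<le> cmod (apply_bidisc w ((\<Phi> ^^ k) z) - c)} \<and>
    card {k. cmod c - b \<le> cmod (apply_bidisc w ((\<Phi> ^^ k) z) - c)} \<le> N"
    using weight_few_visits[of "cmod c - b"] b by auto
  have "compact torus" "torus \<noteq> {}" by (auto intro!: compact_Times)
  moreover have "continuous_on torus (\<lambda>z. cmod (apply_bidisc w z))"
    by (intro continuous_on_norm continuous_on_subset[OF continuous_on_apply_bidisc]) auto
  ultimately obtain y where y: "y \<in> torus" "\<And>z. z \<in> torus \<Longrightarrow> cmod (apply_bidisc w y) \<le> cmod (apply_bidisc w z)"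
    using continuous_attains_inf by metis
  define m where "m = min b (cmod (apply_bidisc w y))"
  have m: "m > 0" "m \<le> b" using b nz[OF y(1)] by (auto simp: m_def)
  define d where "d = inverse ((inverse m / inverse b) ^ N)"
  have d0: "d > 0" using m b by (simp add: d_def)
  have "d * b ^ n \<le> cmod (W n z)" if z: "z \<in> torus" for n z
  proof -
    have zc: "z \<in> closed_bidisc" using z by auto
    let ?w = "\<lambda>k. cmod (apply_bidisc w ((\<Phi> ^^ k) z))"
    have wm: "m \<le> ?w k" for k using y(2)[OF funpow_\<Phi>_torus[OF z]] by (auto simp: m_def min_le_iff_disj)
    have wpos: "?w k > 0" for k using wm[of k] m by linarith
    have sub: "{k. inverse b < inverse (?w k)} \<subseteq> {k. cmod c - b \<le> cmod (apply_bidisc w ((\<Phi> ^^ k) z) - c)}"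
    proof clarify
      fix k assume "inverse b < inverse (?w k)"
      then have "?w k < b" using wpos[of k] b by (simp add: inverse_less_iff_less)
      then show "cmod c - b \<le> cmod (apply_bidisc w ((\<Phi> ^^ k) z) - c)"
        using norm_triangle_ineq2[of c "apply_bidisc w ((\<Phi> ^^ k) z)"] by (simp add: norm_minus_commute)
    qed
    have "(\<Prod>k<n. inverse (?w k)) \<le> (inverse m / inverse b) ^ N * inverse b ^ n"
    proof (rule prod_le_except_few)
      show "inverse (?w k) \<le> inverse m" for k using wm[of k] m by (intro le_imp_inverse_le) auto
      show "finite {k. inverse b < inverse (?w k)}" using N[OF zc] sub finite_subset by blast
      show "card {k. inverse b < inverse (?w k)} \<le> N" using N[OF zc] card_mono[OF _ sub] by linarith
      show "inverse b \<le> inverse m" using m by (intro le_imp_inverse_le) auto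
    qed (use b in auto)
    moreover have "(\<Prod>k<n. inverse (?w k)) = inverse (cmod (W n z))"
      by (simp add: W_def prod_norm[symmetric] prod_inversef[symmetric] o_def)
    moreover have "(inverse m / inverse b) ^ N * inverse b ^ n = inverse (d * b ^ n)"
      by (simp add: d_def power_inverse)
    ultimately have "inverse (cmod (W n z)) \<le> inverse (d * b ^ n)" by simp
    moreover have "cmod (W n z) > 0" using wpos by (simp add: W_def prod_norm[symmetric] prod_pos)
    ultimately show ?thesis using d0 b by (meson inverse_le_imp_le)
  qed
  with d0 show ?thesis by blast
qed

lemma resolvent_inner_bounded_below:
  assumes nz: "\<And>z. z \<in> torus \<Longrightarrow> apply_bidisc w z \<noteq> 0" and l: "cmod l < cmod c"
  shows "\<exists>e>0. \<forall>x. e * norm x \<le> norm (l *\<^sub>C x - T x)"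
proof -
  obtain b where b: "cmod l < b" "b < cmod c" using l dense by blast
  then have b0: "b > 0" using norm_ge_zero[of l] by linarith
  obtain d where d: "d > 0" "\<And>n z. z \<in> torus \<Longrightarrow> d * b ^ n \<le> cmod (W n z)"
    using W_lower[OF nz b0 b(2)] by blast
  have "d * b ^ n * norm f \<le> norm ((T ^^ n) f)" for n f
  proof -
    obtain z where z: "z \<in> torus" "cmod (apply_bidisc f z) = norm f" by (rule bidisc_norm_attained_torus)
    obtain y where y: "y \<in> torus" "(\<Phi> ^^ n) y = z" using \<Phi>_torus_surj[OF z(1)] by blast
    then have yc: "y \<in> closed_bidisc" by auto
    have "d * b ^ n * norm f \<le> cmod (W n y) * cmod (apply_bidisc f ((\<Phi> ^^ n) y))"
      unfolding y(2) z(2) using d(2)[OF y(1)] by (intro mult_right_mono) auto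
    also have "\<dots> = cmod (apply_bidisc ((T ^^ n) f) y)" by (simp add: apply_funpow_T[OF yc] norm_mult)
    also have "\<dots> \<le> norm ((T ^^ n) f)" by (rule norm_apply_bidisc_le[OF yc])
    finally show ?thesis .
  qed
  then show ?thesis by (rule bounded_below_of_powers[OF bounded_clinear_T _ d(1) b(1)])
qed

text \<open>
  The inverse of \<open>T\<close> is composition with the inverse map, weighted by \<open>1 / w\<close> along that map. With \<open>S\<close> for this inverse,
  \<open>l - T = - l T (1 / l - S)\<close>, and \<open>\<bar>1 / l\<bar> > \<bar>1 / c\<bar>\<close>.
\<close>

lemma resolvent_inner_invertible:
  assumes unit: "w dvd 1" and l: "cmod l < cmod c"
  shows "invertible_op (\<lambda>x. l *\<^sub>C x - T x)"
proof -
  obtain v where v: "1 = w * v" using unit by (auto simp: dvd_def)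
  have wv: "apply_bidisc w z * apply_bidisc v z = 1" if "z \<in> closed_bidisc" for z
    using v that by (metis apply_bidisc_simps(2,6))
  define v' where "v' = weighted_comp 1 (\<lambda>(z1, z2). (\<phi>' z1, \<psi>' z2)) v"
  have v': "apply_bidisc v' z = apply_bidisc v (\<phi>' (fst z), \<psi>' (snd z))" if "z \<in> closed_bidisc" for z
    unfolding v'_def apply_weighted_comp[OF fst.moebius_q snd.moebius_q that]
    using that by (simp add: apply_bidisc_simps)
  interpret inv: bidisc_weighted_map \<phi>' \<phi> \<xi> "- \<alpha>" \<psi>' \<psi> \<zeta> "- \<beta>" v'
    by (intro bidisc_weighted_map.intro fst.inverse_map snd.inverse_map)
  have inv_c: "inv.c = inverse c"
    using wv[of "(\<xi>, \<zeta>)"] v'[of "(\<xi>, \<zeta>)"] fst.xi snd.xi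
    by (simp add: inv.c_def c_def fst.fix_q snd.fix_q inverse_unique)
  have \<Phi>\<Phi>: "\<Phi> (inv.\<Phi> z) = z" "inv.\<Phi> (\<Phi> z) = z" if "z \<in> closed_bidisc" for z
    using that by (auto simp: \<Phi>_def inv.\<Phi>_def mem_Times_iff fst.p_q snd.p_q fst.q_p snd.q_p)
  have TT: "T (inv.T f) = f" "inv.T (T f) = f" for f
  proof -
    show "T (inv.T f) = f"
    proof (rule bidisc_eqI)
      fix z assume z: "z \<in> closed_bidisc"
      have "apply_bidisc v' (\<Phi> z) = apply_bidisc v z"
        using v'[OF \<Phi>_bidisc[OF z]] \<Phi>\<Phi>(2)[OF z] by (simp add: inv.\<Phi>_def)
      then show "apply_bidisc (T (inv.T f)) z = apply_bidisc f z"
        using z wv[OF z] by (simp add: apply_T inv.apply_T \<Phi>_bidisc \<Phi>\<Phi> flip: mult.assoc)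
    qed
    show "inv.T (T f) = f"
    proof (rule bidisc_eqI)
      fix z assume z: "z \<in> closed_bidisc"
      have "apply_bidisc v' z = apply_bidisc v (inv.\<Phi> z)"
        using v'[OF z] by (simp add: inv.\<Phi>_def)
      then show "apply_bidisc (inv.T (T f)) z = apply_bidisc f z"
        using z wv[OF inv.\<Phi>_bidisc[OF z]]
        by (simp add: apply_T inv.apply_T inv.\<Phi>_bidisc \<Phi>\<Phi> mult.commute mult.left_commute flip: mult.assoc)
    qed
  qed
  have invT: "invertible_op T"
    unfolding invertible_op_def
    by (intro exI[of _ inv.T] conjI inv.bounded_clinear_T) (auto simp: fun_eq_iff TT)
  note sub = bounded_clinearD[OF bounded_clinear_T]
  show ?thesis
  proof (cases "l = 0")
    case True
    have "(\<lambda>x. l *\<^sub>C x - T x) = (\<lambda>x. (-1) *\<^sub>C x) \<circ> T"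
      using True by (simp add: fun_eq_iff complex_vector.scale_minus_left scaleC_one)
    then show ?thesis using invertible_op_compose[OF invertible_op_scaleC invT, of "-1"] by simp
  next
    case False
    have "cmod inv.c < cmod (inverse l)"
      using less_imp_inverse_less[OF l] False by (simp add: inv_c norm_inverse)
    then have "invertible_op (\<lambda>x. inverse l *\<^sub>C x - inv.T x)" by (rule inv.resolvent_outer)
    then have "invertible_op ((\<lambda>x. (- l) *\<^sub>C x) \<circ> (T \<circ> (\<lambda>x. inverse l *\<^sub>C x - inv.T x)))"
      using False by (intro invertible_op_compose invertible_op_scaleC invT) auto
    moreover have "(\<lambda>x. (- l) *\<^sub>C x) \<circ> (T \<circ> (\<lambda>x. inverse l *\<^sub>C x - inv.T x)) = (\<lambda>x. l *\<^sub>C x - T x)"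
      using False by (simp add: fun_eq_iff sub TT complex_vector.scale_right_diff_distrib scaleC_scaleC
          complex_vector.scale_minus_left scaleC_one)
    ultimately show ?thesis by simp
  qed
qed

end


section \<open>Test functions and functionals\<close>

definition clinear_functional :: "('a::complex_banach \<Rightarrow> complex) \<Rightarrow> bool" where
  "clinear_functional \<Lambda> \<longleftrightarrow> bounded_linear \<Lambda> \<and> (\<forall>b x. \<Lambda> (b *\<^sub>C x) = b * \<Lambda> x)"

lemma clinear_functional_apply:
  assumes z: "z \<in> closed_bidisc"
  shows "clinear_functional (\<lambda>f. apply_bidisc f z)"
  unfolding clinear_functional_def
proof (intro conjI allI)
  show "bounded_linear (\<lambda>f. apply_bidisc f z)"
  proof (rule bounded_linear_intro[where K = 1])
    show "apply_bidisc (r *\<^sub>R f) z = r *\<^sub>R apply_bidisc f z" for r f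
      unfolding apply_bidisc_simps(7)[OF z] by (rule scaleR_conv_of_real[symmetric])
  qed (use norm_apply_bidisc_le[OF z] in \<open>simp_all add: apply_bidisc_simps(3)[OF z]\<close>)
qed (use z in \<open>simp add: apply_bidisc_scaleC\<close>)

lemma clinear_functional_scale: "clinear_functional \<Lambda> \<Longrightarrow> clinear_functional (\<lambda>x. a * \<Lambda> x)"
  by (auto simp: clinear_functional_def bounded_linear_const_mult)

lemma clinear_functional_diff:
  "clinear_functional \<Lambda> \<Longrightarrow> clinear_functional \<Lambda>' \<Longrightarrow> clinear_functional (\<lambda>x. \<Lambda> x - \<Lambda>' x)"
  by (auto simp: clinear_functional_def bounded_linear_sub right_diff_distrib)

lemma clinear_functional_sum:
  "(\<And>i. i \<in> I \<Longrightarrow> clinear_functional (\<Lambda> i)) \<Longrightarrow> clinear_functional (\<lambda>x. \<Sum>i\<in>I. \<Lambda> i x)"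
  by (auto simp: clinear_functional_def bounded_linear_sum sum_distrib_left)

lemma norm_bidisc_le_open:
  assumes le: "\<And>z. z \<in> open_bidisc \<Longrightarrow> cmod (apply_bidisc f z) \<le> K"
  shows "norm f \<le> K"
proof (rule norm_bidisc_leI)
  fix z :: "complex \<times> complex" assume z: "z \<in> closed_bidisc"
  have cl: "closure open_bidisc = closed_bidisc" by (simp add: closure_Times)
  show "cmod (apply_bidisc f z) \<le> K"
    by (rule continuous_le_on_closure[where S = open_bidisc])
      (use z le cl continuous_on_apply_bidisc[of f] in \<open>auto intro!: continuous_on_norm\<close>)
qed

lemma not_upper_semi_Fredholm_bidisc:
  fixes S :: "bidisc_alg \<Rightarrow> bidisc_alg"
  assumes S: "bounded_clinear S" and d: "d > 0"
    and seq: "\<And>\<epsilon>. \<epsilon> > 0 \<Longrightarrow> \<exists>x. bounded (range x) \<and>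
        (\<forall>z\<in>open_bidisc. (\<lambda>n. apply_bidisc (x n) z) \<longlonglongrightarrow> 0) \<and>
        (\<forall>\<^sub>F n in sequentially. d \<le> norm (x n) \<and> norm (S (x n)) \<le> \<epsilon>)"
  shows "\<not> upper_semi_Fredholm S"
proof (rule not_upper_semi_FredholmI[OF S _ _ _ d])
  let ?E = "(\<lambda>z f. apply_bidisc f z) ` open_bidisc"
  have sub: "z \<in> closed_bidisc" if "z \<in> open_bidisc" for z :: "complex \<times> complex" using that by auto
  show "e (x - y) = e x - e y" if "e \<in> ?E" for e x y
    using that apply_bidisc_simps(4)[OF sub] by blast
  show "cmod (e x) \<le> norm x" if "e \<in> ?E" for e x
    using that sub norm_apply_bidisc_le by blast
  show "norm x \<le> K" if "\<And>e. e \<in> ?E \<Longrightarrow> cmod (e x) \<le> K" for x K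
    using that by (intro norm_bidisc_le_open) blast
  show "\<exists>x. bounded (range x) \<and> (\<forall>e\<in>?E. (\<lambda>n. e (x n)) \<longlonglongrightarrow> 0) \<and>
      (\<forall>\<^sub>F n in sequentially. d \<le> norm (x n) \<and> norm (S (x n)) \<le> \<epsilon>)" if "\<epsilon> > 0" for \<epsilon>
    using seq[OF that] by blast
qed

lemma norm_cayley_add_ge:
  assumes "cmod \<xi> = 1" "cmod z \<le> 1" "Re b > 0"
  shows "Re b \<le> cmod (cayley \<xi> z + b)"
  using cayley_Re_nonneg[OF assms(1,2)] complex_Re_le_cmod[of "cayley \<xi> z + b"] by simp

lemma norm_half_plane_kernel_le:
  assumes "cmod \<xi> = 1" "cmod z \<le> 1" "Re b > 0"
  shows "cmod (half_plane_kernel \<xi> b z) \<le> 1 / Re b"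
proof (cases "z = \<xi>")
  case False
  then show ?thesis
    using norm_cayley_add_ge[OF assms] assms(3)
    by (simp add: half_plane_kernel_eq norm_divide frac_le)
qed (use assms in simp)

lemma norm_exp_kernel_le:
  assumes "cmod \<xi> = 1" "cmod z \<le> 1" "Re b > 0" "s \<ge> 0"
  shows "cmod (exp_kernel \<xi> s b z) \<le> 1 / Re b"
proof (cases "z = \<xi>")
  case False
  have "cmod (exp (- of_real s * cayley \<xi> z)) * cmod (half_plane_kernel \<xi> b z) \<le> 1 * (1 / Re b)"
    by (intro mult_mono exp_cayley_le_1 norm_half_plane_kernel_le assms) auto
  then show ?thesis using False by (simp add: exp_kernel_def norm_mult del: norm_exp_eq_Re)
qed (use assms in \<open>simp add: exp_kernel_def\<close>)

text \<open>
  This is \<open>(u + 1) / (u + M)\<close>. It equals \<open>1\<close> at \<open>\<xi>\<close>, is small where \<open>\<bar>u\<bar>\<close> is much smaller than \<open>M\<close>, and changes only by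
  \<open>O(1 / M)\<close> under translation.
\<close>

definition slow_peak :: "complex \<Rightarrow> real \<Rightarrow> complex \<Rightarrow> complex" where
  "slow_peak \<xi> M z = 1 - of_real (M - 1) * half_plane_kernel \<xi> (of_real M) z"

lemma disc_alg_slow_peak: "cmod \<xi> = 1 \<Longrightarrow> M > 0 \<Longrightarrow> disc_alg (slow_peak \<xi> M)"
  unfolding slow_peak_def
  by (intro disc_alg_diff disc_alg_mult disc_alg_const disc_alg_half_plane_kernel) auto

lemma slow_peak_fix [simp]: "slow_peak \<xi> M \<xi> = 1"
  by (simp add: slow_peak_def)

lemma slow_peak_eq:
  assumes "cmod \<xi> = 1" "cmod z \<le> 1" "M > 0" "z \<noteq> \<xi>"
  shows "slow_peak \<xi> M z = (cayley \<xi> z + 1) / (cayley \<xi> z + of_real M)"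
proof -
  have "cayley \<xi> z + of_real M \<noteq> 0"
    using norm_cayley_add_ge[OF assms(1,2), of "of_real M"] assms(3) by auto
  then show ?thesis using assms(4) by (simp add: slow_peak_def half_plane_kernel_eq field_simps)
qed

lemma norm_slow_peak_le_1:
  assumes "cmod \<xi> = 1" "cmod z \<le> 1" "M \<ge> 1"
  shows "cmod (slow_peak \<xi> M z) \<le> 1"
proof (cases "z = \<xi>")
  case False
  let ?u = "cayley \<xi> z"
  have "Re ?u \<ge> 0" by (rule cayley_Re_nonneg[OF assms(1,2)])
  then have "cmod (?u + 1) \<le> cmod (?u + of_real M)"
    unfolding cmod_def using assms(3) by (intro real_sqrt_le_mono) (simp add: power_mono)
  moreover have "cmod (?u + of_real M) > 0"
    using norm_cayley_add_ge[OF assms(1,2), of "of_real M"] assms(3) by auto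
  ultimately show ?thesis
    using assms False by (simp add: slow_peak_eq norm_divide)
qed simp

lemma norm_slow_peak_le:
  assumes "cmod \<xi> = 1" "cmod z \<le> 1" "M > 0" "z \<noteq> \<xi>"
  shows "cmod (slow_peak \<xi> M z) \<le> 2 / cmod (\<xi> - z) / M"
proof -
  let ?u = "cayley \<xi> z"
  have "cmod (?u + 1) = 2 / cmod (\<xi> - z)"
    using dist_cayley[OF assms(1,4)] assms(4) by (simp add: field_simps)
  moreover have "M \<le> cmod (?u + of_real M)"
    using norm_cayley_add_ge[OF assms(1,2), of "of_real M"] assms(3) by simp
  moreover have "cmod (?u + 1) / cmod (?u + of_real M) \<le> cmod (?u + 1) / M"
    using calculation(2) assms(3) by (intro frac_le) auto
  ultimately show ?thesis
    unfolding slow_peak_eq[OF assms] norm_divide by simp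
qed

context parabolic_disc_map
begin

lemma half_plane_kernel_shift:
  assumes z: "cmod z \<le> 1" and M: "M > 0"
  shows "cmod (half_plane_kernel \<xi> (of_real M) (p z) - half_plane_kernel \<xi> (of_real M) z) \<le> \<bar>\<tau>\<bar> / M\<^sup>2"
proof (cases "z = \<xi>")
  case True
  then show ?thesis by (simp add: fix_p)
next
  case False
  let ?a = "cayley \<xi> (p z) + of_real M" and ?b = "cayley \<xi> z + of_real M"
  have a: "M \<le> cmod ?a" and b: "M \<le> cmod ?b"
    using norm_cayley_add_ge[OF xi p_le_1[OF z], of "of_real M"] norm_cayley_add_ge[OF xi z, of "of_real M"] M
    by auto
  then have nz: "?a \<noteq> 0" "?b \<noteq> 0" using M by auto
  have "half_plane_kernel \<xi> (of_real M) (p z) - half_plane_kernel \<xi> (of_real M) z = 1 / ?a - 1 / ?b"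
    using False z by (simp add: half_plane_kernel_eq p_eq_xi_iff)
  also have "\<dots> = (?b - ?a) / (?a * ?b)" using nz by (simp add: field_simps)
  also have "?b - ?a = - \<i> * of_real \<tau>" using cayley_p[OF z False] by simp
  finally have "cmod (half_plane_kernel \<xi> (of_real M) (p z) - half_plane_kernel \<xi> (of_real M) z)
      = \<bar>\<tau>\<bar> / (cmod ?a * cmod ?b)" by (simp add: norm_divide norm_mult)
  also have "\<dots> \<le> \<bar>\<tau>\<bar> / (M * M)"
    using a b M by (intro divide_left_mono mult_mono mult_pos_pos) auto
  finally show ?thesis by (simp add: power2_eq_square)
qed

lemma slow_peak_shift:
  assumes z: "cmod z \<le> 1" and M: "M \<ge> 1"
  shows "cmod (slow_peak \<xi> M (p z) - slow_peak \<xi> M z) \<le> \<bar>\<tau>\<bar> / M"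
proof -
  have "slow_peak \<xi> M (p z) - slow_peak \<xi> M z =
      - (of_real (M - 1) * (half_plane_kernel \<xi> (of_real M) (p z) - half_plane_kernel \<xi> (of_real M) z))"
    by (simp add: slow_peak_def algebra_simps)
  then have "cmod (slow_peak \<xi> M (p z) - slow_peak \<xi> M z) =
      (M - 1) * cmod (half_plane_kernel \<xi> (of_real M) (p z) - half_plane_kernel \<xi> (of_real M) z)"
    using M by (simp only: norm_minus_cancel norm_mult norm_of_real abs_of_nonneg diff_ge_0_iff_ge)
  also have "\<dots> \<le> M * (\<bar>\<tau>\<bar> / M\<^sup>2)"
    using M by (intro mult_mono half_plane_kernel_shift z) auto
  finally show ?thesis using M by (simp add: power2_eq_square)
qed

text \<open>
  Multiplication by \<open>exp (- \<i> s \<tau>)\<close> is the effect of the translation on \<open>exp (- s u)\<close>. The frequency \<open>s\<close> must not be negative,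
  otherwise the exponential is unbounded; adding a full period achieves this for either sign of \<open>\<tau>\<close>.
\<close>

lemma frequency_exists:
  assumes "cmod l = cmod c"
  shows "\<exists>s\<ge>0. c * exp (- (\<i> * of_real (s * \<tau>))) = l"
proof (cases "c = 0")
  case True
  then show ?thesis using assms by auto
next
  case False
  define \<theta> where "\<theta> = Arg (l / c)"
  have "cmod (l / c) = 1" using False assms by (simp add: norm_divide)
  moreover from this have "l / c \<noteq> 0" by (metis norm_zero zero_neq_one)
  ultimately have lc: "l / c = cis \<theta>"
    using cis_Arg[of "l / c"] by (simp only: \<theta>_def sgn_eq of_real_1 div_by_1 not_False_eq_True simp_thms)
  have th: "- pi < \<theta>" "\<theta> \<le> pi" using Arg_bounded[of "l / c"] by (auto simp: \<theta>_def)
  define s where "s = (sgn \<tau> * (2 * pi) - \<theta>) / \<tau>"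
  have st: "s * \<tau> = sgn \<tau> * (2 * pi) - \<theta>" using tau by (simp add: s_def)
  have "s \<ge> 0"
    using th tau pi_gt_zero by (cases "\<tau> > 0") (auto simp: s_def sgn_if field_simps zero_le_divide_iff)
  moreover have "exp (- (\<i> * of_real (s * \<tau>))) = cis \<theta>"
  proof -
    have "exp (- (\<i> * of_real (s * \<tau>))) = cis (- (s * \<tau>))" by (simp add: cis_conv_exp)
    also have "\<dots> = cis (\<theta> - sgn \<tau> * (2 * pi))" by (simp add: st)
    also have "\<dots> = cis \<theta>" using tau by (auto simp: sgn_if complex_eq_iff cos_add sin_add cos_diff sin_diff)
    finally show ?thesis .
  qed
  ultimately show ?thesis using lc False by (intro exI[of _ s]) (simp add: field_simps)
qed

lemma circle_approach:
  assumes a: "cmod a = 1"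
  shows "\<exists>b :: nat \<Rightarrow> complex. (\<forall>n. cmod (b n) = 1) \<and> b \<longlonglongrightarrow> a \<and> (\<forall>y. \<forall>\<^sub>F n in sequentially. b n \<noteq> y)"
proof -
  define b where "b n = a * cis (inverse (real (Suc n)))" for n
  have b1: "cmod (b n) = 1" for n using a by (simp add: b_def norm_mult)
  have ne: "b n \<noteq> a" for n
  proof
    assume "b n = a"
    then have "cis (inverse (real (Suc n))) = 1" using a by (auto simp: b_def)
    then have "sin (inverse (real (Suc n))) = 0" by (simp add: complex_eq_iff del: of_nat_Suc)
    moreover have "sin (inverse (real (Suc n))) > 0"
    proof (rule sin_gt_zero)
      have "inverse (real (Suc n)) \<le> 1" by (simp add: field_simps)
      then show "inverse (real (Suc n)) < pi" using pi_gt3 by linarith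
    qed simp
    ultimately show False by simp
  qed
  have "(\<lambda>n. a * cis (inverse (real (Suc n)))) \<longlonglongrightarrow> a * cis 0"
    by (intro tendsto_intros LIMSEQ_inverse_real_of_nat)
  then have lim: "b \<longlonglongrightarrow> a" by (simp add: b_def[abs_def])
  have "\<forall>\<^sub>F n in sequentially. b n \<noteq> y" for y
  proof (cases "y = a")
    case True
    then show ?thesis using ne by simp
  next
    case False
    then show ?thesis using tendsto_imp_eventually_ne[OF lim] by auto
  qed
  with b1 lim show ?thesis by blast
qed

end

lemma peak_lt_1:
  assumes a: "cmod a = 1" and x: "cmod x \<le> 1" "x \<noteq> a"
  shows "cmod ((1 + cnj a * x) / 2) < 1"
proof -
  let ?y = "cnj a * x"
  have aa: "a * cnj a = 1" using a by (simp add: complex_norm_square[symmetric])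
  have "?y \<noteq> 1"
  proof
    assume "?y = 1"
    then have "a * ?y = a" by simp
    then show False using aa x(2) by (simp add: mult.assoc[symmetric])
  qed
  moreover have y1: "cmod ?y \<le> 1" using a x by (simp add: norm_mult)
  ultimately have "Re ?y < 1"
  proof -
    have "Re ?y \<le> 1" using complex_Re_le_cmod[of ?y] y1 by linarith
    moreover have "Re ?y \<noteq> 1"
    proof
      assume r: "Re ?y = 1"
      have "(Re ?y)\<^sup>2 + (Im ?y)\<^sup>2 \<le> 1" using y1 by (simp add: cmod_def)
      then have "Im ?y = 0" unfolding r by simp
      then show False using r \<open>?y \<noteq> 1\<close> by (simp add: complex_eq_iff)
    qed
    ultimately show ?thesis by linarith
  qed
  then have "(cmod (1 + ?y))\<^sup>2 < 2\<^sup>2"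
  proof -
    have "(cmod (1 + ?y))\<^sup>2 = 1 + 2 * Re ?y + (cmod ?y)\<^sup>2"
      unfolding cmod_power2 by (simp add: power2_eq_square algebra_simps)
    also have "(cmod ?y)\<^sup>2 \<le> 1" using y1 by (simp add: power_le_one)
    finally show ?thesis using \<open>Re ?y < 1\<close> by simp
  qed
  then have "cmod (1 + ?y) < 2" by (rule power2_less_imp_less) simp
  then show ?thesis by (simp add: norm_divide)
qed

lemma peak_le_1:
  assumes "cmod a = 1" "cmod x \<le> 1"
  shows "cmod ((1 + cnj a * x) / 2) \<le> 1"
  using peak_lt_1[OF assms] assms(1) complex_norm_square[of a] by (cases "x = a") (auto simp: mult.commute)

lemma peak_at: "cmod a = 1 \<Longrightarrow> (1 + cnj a * a) / 2 = 1"
  using complex_norm_square[of a] by (simp add: mult.commute)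

lemma disc_alg_peak: "disc_alg (\<lambda>x. (1 + cnj a * x) / 2)"
  by (auto intro!: disc_alg_divide disc_alg_add disc_alg_mult)


section \<open>Points on the circle\<close>

lemma norm_triple_product_diff:
  fixes a b d a' b' d' :: complex
  assumes "cmod b \<le> 1" "cmod d \<le> 1" "cmod a' \<le> 1" "cmod b' \<le> 1"
  shows "cmod (a * b * d - a' * b' * d') \<le> cmod (a - a') + cmod (b - b') + cmod (d - d')"
proof -
  have bd: "cmod b * cmod d \<le> 1" "cmod a' * cmod d \<le> 1" "cmod a' * cmod b' \<le> 1"
    using assms by (auto intro: mult_le_one)
  have "a * b * d - a' * b' * d' = (a - a') * (b * d) + (b - b') * (a' * d) + (d - d') * (a' * b')"
    by (simp add: algebra_simps)
  then have "cmod (a * b * d - a' * b' * d') \<le>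
      cmod ((a - a') * (b * d)) + cmod ((b - b') * (a' * d)) + cmod ((d - d') * (a' * b'))"
    by (metis (no_types, lifting) add_right_mono norm_triangle_ineq order_trans)
  also have "\<dots> \<le> cmod (a - a') * 1 + cmod (b - b') * 1 + cmod (d - d') * 1"
    unfolding norm_mult by (intro add_mono mult_left_mono bd) auto
  finally show ?thesis by simp
qed

context bidisc_weighted_map
begin

lemma continuous_on_funpow_\<Phi>: "continuous_on closed_bidisc (\<Phi> ^^ k)"
proof -
  have "continuous_on closed_bidisc (\<lambda>z. ((\<phi> ^^ k) (fst z), (\<psi> ^^ k) (snd z)))"
    by (intro continuous_on_Pair continuous_on_compose2[OF fst.continuous_on_funpow]
        continuous_on_compose2[OF snd.continuous_on_funpow] continuous_intros) auto
  then show ?thesis by (simp add: funpow_\<Phi> cong: continuous_on_cong)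
qed

lemma continuous_on_apply_orbit: "continuous_on closed_bidisc (\<lambda>z. apply_bidisc f ((\<Phi> ^^ k) z))"
  by (rule continuous_on_compose2[OF continuous_on_apply_bidisc continuous_on_funpow_\<Phi>])
    (intro image_subsetI funpow_\<Phi>_bidisc)

lemma tendsto_apply_orbit:
  assumes "z \<longlonglongrightarrow> q" "\<And>n. z n \<in> closed_bidisc" "q \<in> closed_bidisc"
  shows "(\<lambda>n. apply_bidisc f ((\<Phi> ^^ k) (z n))) \<longlonglongrightarrow> apply_bidisc f ((\<Phi> ^^ k) q)"
  using continuous_on_tendsto_compose[OF continuous_on_apply_orbit assms(1,3)] assms(2) by simp

lemma tendsto_W:
  assumes "z \<longlonglongrightarrow> q" "\<And>n. z n \<in> closed_bidisc" "q \<in> closed_bidisc"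
  shows "(\<lambda>n. W k (z n)) \<longlonglongrightarrow> W k q"
  unfolding W_def by (intro tendsto_prod tendsto_apply_orbit assms)

lemma fixed_point_bidisc: "(\<xi>, \<zeta>) \<in> closed_bidisc"
  using fixed_point_mem by auto

lemma funpow_\<Phi>_fix: "(\<Phi> ^^ k) (\<xi>, \<zeta>) = (\<xi>, \<zeta>)"
  by (simp add: funpow_\<Phi> fst.funpow_p_fix snd.funpow_p_fix)

lemma W_fix: "W k (\<xi>, \<zeta>) = c ^ k"
  by (simp add: W_def funpow_\<Phi>_fix c_def)

text \<open>
  The vectors are \<open>g (u) k (u) exp (- s u) g (v)\<close>, where \<open>u\<close> and \<open>v\<close> are the half-plane coordinates, \<open>g\<close> is a slow peak and
  \<open>k (u) = L / (u + L)\<close> removes the discontinuity of the exponential at infinity. The factors \<open>g\<close> confine the vector to the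
  part of the bidisc where \<open>w\<close> is close to \<open>c\<close>; all factors but the exponential are nearly invariant. Choosing
  \<open>M = m ^ 2\<close> and \<open>L = m ^ 4\<close> leaves the window around \<open>\<bar>u\<bar> = m ^ 3\<close> in which both \<open>g\<close> and \<open>k\<close> are not small. The factor \<open>g (u)\<close>
  makes the vectors tend to zero pointwise on the open bidisc.
\<close>

lemma approximate_eigenvectors:
  assumes l: "cmod l = cmod c"
  shows "\<exists>x. (\<forall>n. norm (x n) \<le> 1) \<and> (\<forall>n. 1 / 4 \<le> norm (x n)) \<and>
    (\<forall>z\<in>open_bidisc. (\<lambda>n. apply_bidisc (x n) z) \<longlonglongrightarrow> 0) \<and> (\<lambda>n. l *\<^sub>C x n - T (x n)) \<longlonglongrightarrow> 0"
proof -
  obtain s where s: "s \<ge> 0" "c * exp (- (\<i> * of_real (s * \<alpha>))) = l"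
    using fst.frequency_exists[OF l] by blast
  define m where "m n = real (Suc n)" for n
  have m1: "m n \<ge> 1" for n by (simp add: m_def)
  define M where "M n = (m n)\<^sup>2" for n
  define L where "L n = (M n)\<^sup>2" for n
  have M1: "M n \<ge> 1" for n using m1 by (simp add: M_def)
  have LM: "L n \<ge> M n" for n using M1[of n] by (simp add: L_def power2_eq_square)
  have L1: "L n \<ge> 1" for n using LM[of n] M1[of n] by linarith
  define g where "g n = slow_peak \<xi> (M n)" for n
  define g' where "g' n = slow_peak \<zeta> (M n)" for n
  define h where "h n z = of_real (L n) * half_plane_kernel \<xi> (of_real (L n)) z" for n z
  define k where "k n z = of_real (L n) * exp_kernel \<xi> s (of_real (L n)) z" for n z
  have kh: "k n z = exp (- of_real s * cayley \<xi> z) * h n z" if "z \<noteq> \<xi>" for n z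
    using that by (simp add: k_def h_def exp_kernel_def)
  have kxi: "k n \<xi> = 0" for n by (simp add: k_def exp_kernel_def)
  have dg: "disc_alg (\<lambda>z. g n z * k n z)" for n
    unfolding g_def k_def using M1[of n] L1[of n] s(1) fst.xi
    by (intro disc_alg_mult disc_alg_const disc_alg_slow_peak disc_alg_exp_kernel) auto
  have dg': "disc_alg (g' n)" for n
    unfolding g'_def using M1[of n] snd.xi by (intro disc_alg_slow_peak) auto
  define x where "x n = of_bidisc_fun (\<lambda>z. g n (fst z) * k n (fst z)) * of_bidisc_fun (\<lambda>z. g' n (snd z))" for n
  have x: "apply_bidisc (x n) z = g n (fst z) * k n (fst z) * g' n (snd z)" if "z \<in> closed_bidisc" for n z
    using that by (simp only: x_def apply_bidisc_simps apply_lift_fst[OF dg] apply_lift_snd[OF dg'])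
  have gle: "cmod (g n z) \<le> 1" if "cmod z \<le> 1" for n z
    unfolding g_def by (rule norm_slow_peak_le_1[OF fst.xi that M1])
  have g'le: "cmod (g' n z) \<le> 1" if "cmod z \<le> 1" for n z
    unfolding g'_def by (rule norm_slow_peak_le_1[OF snd.xi that M1])
  have hle: "cmod (h n z) \<le> 1" if "cmod z \<le> 1" for n z
    using norm_half_plane_kernel_le[OF fst.xi that, of "of_real (L n)"] L1[of n]
    by (simp add: h_def norm_mult field_simps)
  have kle: "cmod (k n z) \<le> 1" if "cmod z \<le> 1" for n z
    using norm_exp_kernel_le[OF fst.xi that _ s(1), of "of_real (L n)"] L1[of n]
    by (simp add: k_def norm_mult field_simps)
  have gsh: "cmod (g n (\<phi> z) - g n z) \<le> \<bar>\<alpha>\<bar> / M n" if "cmod z \<le> 1" for n z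
    unfolding g_def by (rule fst.slow_peak_shift[OF that M1])
  have g'sh: "cmod (g' n (\<psi> z) - g' n z) \<le> \<bar>\<beta>\<bar> / M n" if "cmod z \<le> 1" for n z
    unfolding g'_def by (rule snd.slow_peak_shift[OF that M1])
  have hsh: "cmod (h n (\<phi> z) - h n z) \<le> \<bar>\<alpha>\<bar> / M n" if "cmod z \<le> 1" for n z
  proof -
    have "cmod (h n (\<phi> z) - h n z) =
        L n * cmod (half_plane_kernel \<xi> (of_real (L n)) (\<phi> z) - half_plane_kernel \<xi> (of_real (L n)) z)"
      using L1[of n] by (simp add: h_def norm_mult flip: right_diff_distrib)
    also have "\<dots> \<le> L n * (\<bar>\<alpha>\<bar> / (L n)\<^sup>2)"
      using L1[of n] by (intro mult_left_mono fst.half_plane_kernel_shift that) auto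
    also have "\<dots> = \<bar>\<alpha>\<bar> / L n" using L1[of n] by (simp add: power2_eq_square)
    also have "\<dots> \<le> \<bar>\<alpha>\<bar> / M n" using LM[of n] M1[of n] by (intro divide_left_mono mult_pos_pos) auto
    finally show ?thesis .
  qed
  have xle: "cmod (apply_bidisc (x n) z) \<le> cmod (g n (fst z))"
    "cmod (apply_bidisc (x n) z) \<le> cmod (g' n (snd z))" if "z \<in> closed_bidisc" for n z
  proof -
    have z: "cmod (fst z) \<le> 1" "cmod (snd z) \<le> 1" using that by (auto simp: mem_Times_iff)
    have "cmod (g n (fst z)) * (cmod (k n (fst z)) * cmod (g' n (snd z))) \<le> cmod (g n (fst z)) * 1"
      using kle[OF z(1)] g'le[OF z(2)] by (intro mult_left_mono mult_le_one) auto
    then show "cmod (apply_bidisc (x n) z) \<le> cmod (g n (fst z))"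
      by (simp add: x[OF that] norm_mult mult.assoc)
    have "cmod (g n (fst z)) * cmod (k n (fst z)) * cmod (g' n (snd z)) \<le> 1 * cmod (g' n (snd z))"
      using kle[OF z(1)] gle[OF z(1)] by (intro mult_right_mono mult_le_one) auto
    then show "cmod (apply_bidisc (x n) z) \<le> cmod (g' n (snd z))"
      by (simp add: x[OF that] norm_mult)
  qed
  have upper: "norm (x n) \<le> 1" for n
  proof (rule norm_bidisc_leI)
    fix z assume z: "z \<in> closed_bidisc"
    then have "cmod (g n (fst z)) \<le> 1" by (intro gle) (auto simp: mem_Times_iff)
    then show "cmod (apply_bidisc (x n) z) \<le> 1" using xle(1)[OF z, of n] by linarith
  qed
  have lower: "1 / 4 \<le> norm (x n)" for n
  proof -
    obtain a where a: "cmod a = 1" "a \<noteq> \<xi>" "cayley \<xi> a = \<i> * of_real (m n ^ 3)"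
      using cayley_imaginary_surj[OF fst.xi] by blast
    have az: "(a, \<zeta>) \<in> closed_bidisc" using a(1) snd.xi by simp
    have m0: "m n > 0" using m1[of n] by linarith
    have "cmod (g n a) \<ge> 1 / 2"
    proof -
      have "cmod (\<i> * of_real (m n ^ 3) + 1) \<ge> m n ^ 3"
        using abs_Im_le_cmod[of "\<i> * of_real (m n ^ 3) + 1"] m0 by simp
      moreover have "cmod (\<i> * of_real (m n ^ 3) + of_real (M n)) \<le> 2 * m n ^ 3"
      proof -
        have "M n \<le> m n ^ 3" unfolding M_def using m1 by (intro power_increasing) auto
        then show ?thesis
          using norm_triangle_ineq[of "\<i> * of_real (m n ^ 3)" "of_real (M n)"] m0 M1[of n]
          by (simp add: norm_mult norm_power)
      qed
      moreover have "cmod (\<i> * of_real (m n ^ 3) + of_real (M n)) > 0"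
        using order_trans[OF abs_ge_self abs_Re_le_cmod, of "\<i> * of_real (m n ^ 3) + of_real (M n)"] M1[of n]
        unfolding plus_complex.sel by (simp del: norm_eq_zero zero_less_norm_iff)
      moreover have "cmod (g n a) = cmod (\<i> * of_real (m n ^ 3) + 1) / cmod (\<i> * of_real (m n ^ 3) + of_real (M n))"
        unfolding g_def using slow_peak_eq[OF fst.xi _ _ a(2), of "M n"] a(1,3) M1[of n]
        by (simp add: norm_divide)
      ultimately show ?thesis by (simp only: pos_le_divide_eq)
    qed
    moreover have "cmod (k n a) \<ge> 1 / 2"
    proof -
      have L4: "L n = m n ^ 4" by (simp add: L_def M_def power_mult[symmetric])
      have "m n ^ 3 \<le> m n ^ 4" using m1 by (intro power_increasing) auto
      then have "cmod (\<i> * of_real (m n ^ 3) + of_real (L n)) \<le> 2 * L n"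
        using norm_triangle_ineq[of "\<i> * of_real (m n ^ 3)" "of_real (L n)"] m0 L1[of n]
        by (simp add: norm_mult norm_power L4)
      moreover have "cmod (\<i> * of_real (m n ^ 3) + of_real (L n)) > 0"
        using order_trans[OF abs_ge_self abs_Re_le_cmod, of "\<i> * of_real (m n ^ 3) + of_real (L n)"] L1[of n]
        unfolding plus_complex.sel by (simp del: norm_eq_zero zero_less_norm_iff)
      moreover have "cmod (k n a) = L n / cmod (\<i> * of_real (m n ^ 3) + of_real (L n))"
        using L1[of n] a by (simp add: kh h_def half_plane_kernel_eq norm_mult norm_divide)
      ultimately show ?thesis by (simp only: pos_le_divide_eq)
    qed
    ultimately have "1 / 2 * (1 / 2) \<le> cmod (g n a) * cmod (k n a)" by (intro mult_mono) auto
    then have "1 / 4 \<le> cmod (apply_bidisc (x n) (a, \<zeta>))"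
      by (simp add: x[OF az] norm_mult g'_def)
    then show ?thesis using norm_apply_bidisc_le[OF az, of "x n"] by linarith
  qed
  have Minf: "filterlim M at_top sequentially"
  proof (rule filterlim_at_top_mono[OF filterlim_real_sequentially])
    have "real n \<le> M n" for n
      unfolding M_def m_def power2_eq_square by (simp add: algebra_simps)
    then show "\<forall>\<^sub>F n in sequentially. real n \<le> M n" by simp
  qed
  have pointwise: "(\<lambda>n. apply_bidisc (x n) z) \<longlonglongrightarrow> 0" if z: "z \<in> open_bidisc" for z
  proof -
    have zc: "z \<in> closed_bidisc" and z1: "cmod (fst z) < 1" using z by (auto simp: mem_Times_iff)
    have zx: "fst z \<noteq> \<xi>" using z1 fst.xi by auto
    have lim: "(\<lambda>n. 2 / cmod (\<xi> - fst z) / M n) \<longlonglongrightarrow> 0"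
      by (rule real_tendsto_divide_at_top[OF tendsto_const Minf])
    have le: "cmod (apply_bidisc (x n) z) \<le> 2 / cmod (\<xi> - fst z) / M n" for n
    proof (rule order_trans[OF xle(1)[OF zc]])
      show "cmod (g n (fst z)) \<le> 2 / cmod (\<xi> - fst z) / M n"
        unfolding g_def by (rule norm_slow_peak_le[OF fst.xi _ _ zx]) (use z1 M1[of n] in linarith)+
    qed
    show ?thesis by (rule Lim_null_comparison[OF always_eventually lim]) (use le in blast)
  qed
  have shift: "cmod (l * apply_bidisc (x n) z - c * apply_bidisc (x n) (\<Phi> z)) \<le> cmod l * (2 * \<bar>\<alpha>\<bar> + \<bar>\<beta>\<bar>) / M n"
    if zc: "z \<in> closed_bidisc" for n z
  proof -
    have z: "cmod (fst z) \<le> 1" "cmod (snd z) \<le> 1" using that by (auto simp: mem_Times_iff)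
    show ?thesis
    proof (cases "fst z = \<xi>")
      case True
      then have "apply_bidisc (x n) z = 0" "apply_bidisc (x n) (\<Phi> z) = 0"
        unfolding x[OF zc] x[OF \<Phi>_bidisc[OF zc]] by (simp_all add: \<Phi>_def fst.fix_p kxi)
      then show ?thesis using M1[of n] by simp
    next
      case False
      let ?a = "fst z" and ?b = "snd z"
      let ?e = "exp (- of_real s * cayley \<xi> ?a)"
      have "c * k n (\<phi> ?a) = c * exp (- of_real s * (cayley \<xi> ?a + \<i> * of_real \<alpha>)) * h n (\<phi> ?a)"
        using False z by (simp add: kh fst.p_eq_xi_iff fst.cayley_p)
      also have "\<dots> = (c * exp (- (\<i> * of_real (s * \<alpha>)))) * ?e * h n (\<phi> ?a)"
        by (simp add: exp_add[symmetric] algebra_simps)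
      finally have ck: "c * k n (\<phi> ?a) = l * ?e * h n (\<phi> ?a)" by (simp only: s(2))
      have "c * apply_bidisc (x n) (\<Phi> z) = g n (\<phi> ?a) * (c * k n (\<phi> ?a)) * g' n (\<psi> ?b)"
        unfolding x[OF \<Phi>_bidisc[OF zc]] by (simp add: \<Phi>_def)
      also have "\<dots> = l * ?e * (g n (\<phi> ?a) * h n (\<phi> ?a) * g' n (\<psi> ?b))" unfolding ck by simp
      finally have "l * apply_bidisc (x n) z - c * apply_bidisc (x n) (\<Phi> z) =
          l * ?e * (g n ?a * h n ?a * g' n ?b - g n (\<phi> ?a) * h n (\<phi> ?a) * g' n (\<psi> ?b))"
        using False by (simp add: x[OF zc] kh algebra_simps)
      then have "cmod (l * apply_bidisc (x n) z - c * apply_bidisc (x n) (\<Phi> z)) =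
          cmod l * (cmod ?e * cmod (g n ?a * h n ?a * g' n ?b - g n (\<phi> ?a) * h n (\<phi> ?a) * g' n (\<psi> ?b)))"
        by (simp only: norm_mult mult.assoc)
      also have "\<dots> \<le> cmod l * (1 * (\<bar>\<alpha>\<bar> / M n + \<bar>\<alpha>\<bar> / M n + \<bar>\<beta>\<bar> / M n))"
      proof (intro mult_left_mono mult_mono)
        show "cmod ?e \<le> 1" by (rule exp_cayley_le_1[OF fst.xi z(1) s(1)])
        have "cmod (g n ?a * h n ?a * g' n ?b - g n (\<phi> ?a) * h n (\<phi> ?a) * g' n (\<psi> ?b)) \<le>
            cmod (g n ?a - g n (\<phi> ?a)) + cmod (h n ?a - h n (\<phi> ?a)) + cmod (g' n ?b - g' n (\<psi> ?b))"
          by (intro norm_triple_product_diff hle g'le gle fst.p_le_1 z)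
        then show "cmod (g n ?a * h n ?a * g' n ?b - g n (\<phi> ?a) * h n (\<phi> ?a) * g' n (\<psi> ?b)) \<le>
            \<bar>\<alpha>\<bar> / M n + \<bar>\<alpha>\<bar> / M n + \<bar>\<beta>\<bar> / M n"
          using gsh[OF z(1), of n] hsh[OF z(1), of n] g'sh[OF z(2), of n]
          by (simp add: norm_minus_commute)
      qed auto
      also have "\<dots> = cmod l * (2 * \<bar>\<alpha>\<bar> + \<bar>\<beta>\<bar>) / M n"
        by (simp only: mult_1 flip: add_divide_distrib) simp
      finally show ?thesis .
    qed
  qed
  have resid: "\<exists>K. \<forall>n. norm (l *\<^sub>C x n - T (x n)) \<le> \<epsilon> + K / M n" if e: "\<epsilon> > 0" for \<epsilon>
  proof -
    have "\<exists>d>0. \<forall>y\<in>closed_bidisc. dist y (\<xi>, \<zeta>) < d \<longrightarrow> dist (apply_bidisc w y) c < \<epsilon>"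
      using continuous_on_apply_bidisc[of w] e fixed_point_bidisc unfolding continuous_on_iff c_def by blast
    then obtain d where d: "d > 0" "\<And>y. y \<in> closed_bidisc \<Longrightarrow> dist y (\<xi>, \<zeta>) < d \<Longrightarrow> dist (apply_bidisc w y) c < \<epsilon>"
      by blast
    define K1 where "K1 = 4 / d + \<bar>\<alpha>\<bar> + \<bar>\<beta>\<bar>"
    define K where "K = cmod l * (2 * \<bar>\<alpha>\<bar> + \<bar>\<beta>\<bar>) + (cmod c + norm w) * K1"
    have "norm (l *\<^sub>C x n - T (x n)) \<le> \<epsilon> + K / M n" for n
    proof (rule norm_bidisc_leI)
      fix z assume zc: "z \<in> closed_bidisc"
      then have z: "cmod (fst z) \<le> 1" "cmod (snd z) \<le> 1" by (auto simp: mem_Times_iff)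
      let ?y = "apply_bidisc (x n) (\<Phi> z)"
      have y1: "cmod ?y \<le> 1" using norm_apply_bidisc_le[OF \<Phi>_bidisc[OF zc]] upper[of n] order_trans by blast
      have M0: "M n > 0" using M1[of n] by linarith
      have K1: "K1 > 0" using d(1) by (simp add: K1_def add_pos_nonneg)
      have "cmod (c - apply_bidisc w z) * cmod ?y \<le> \<epsilon> + (cmod c + norm w) * K1 / M n"
      proof (cases "dist z (\<xi>, \<zeta>) < d")
        case True
        then have "cmod (c - apply_bidisc w z) \<le> \<epsilon>" using d(2)[OF zc] by (simp add: dist_norm norm_minus_commute)
        then have "cmod (c - apply_bidisc w z) * cmod ?y \<le> \<epsilon> * 1" using y1 e by (intro mult_mono) auto
        moreover have "(cmod c + norm w) * K1 / M n \<ge> 0" using K1 M0 by simp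
        ultimately show ?thesis by linarith
      next
        case False
        have "dist z (\<xi>, \<zeta>) \<le> dist (fst z) \<xi> + dist (snd z) \<zeta>"
          unfolding dist_prod_def by (simp add: sqrt_sum_squares_le_sum)
        with False have far: "d / 2 \<le> cmod (\<xi> - fst z) \<or> d / 2 \<le> cmod (\<zeta> - snd z)"
          by (auto simp: dist_norm norm_minus_commute)
        have "cmod ?y \<le> K1 / M n"
          using far
        proof
          assume f: "d / 2 \<le> cmod (\<xi> - fst z)"
          then have ne: "fst z \<noteq> \<xi>" using d(1) by auto
          have "2 / cmod (\<xi> - fst z) \<le> 2 / (d / 2)" using f d(1) by (intro frac_le) auto
          then have "2 / cmod (\<xi> - fst z) / M n \<le> 4 / d / M n" using M0 by (intro divide_right_mono) auto
          moreover have "cmod (g n (fst z)) \<le> 2 / cmod (\<xi> - fst z) / M n"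
            unfolding g_def by (rule norm_slow_peak_le[OF fst.xi z(1) M0 ne])
          moreover have "cmod ?y \<le> cmod (g n (\<phi> (fst z)))" using xle(1)[OF \<Phi>_bidisc[OF zc]] by (simp add: \<Phi>_def)
          moreover have "cmod (g n (\<phi> (fst z))) \<le> cmod (g n (fst z)) + \<bar>\<alpha>\<bar> / M n"
            using gsh[OF z(1), of n] norm_triangle_ineq2[of "g n (\<phi> (fst z))" "g n (fst z)"] by linarith
          moreover have "\<bar>\<beta>\<bar> / M n \<ge> 0" using M0 by simp
          ultimately show ?thesis unfolding K1_def add_divide_distrib by linarith
        next
          assume f: "d / 2 \<le> cmod (\<zeta> - snd z)"
          then have ne: "snd z \<noteq> \<zeta>" using d(1) by auto
          have "2 / cmod (\<zeta> - snd z) \<le> 2 / (d / 2)" using f d(1) by (intro frac_le) auto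
          then have "2 / cmod (\<zeta> - snd z) / M n \<le> 4 / d / M n" using M0 by (intro divide_right_mono) auto
          moreover have "cmod (g' n (snd z)) \<le> 2 / cmod (\<zeta> - snd z) / M n"
            unfolding g'_def by (rule norm_slow_peak_le[OF snd.xi z(2) M0 ne])
          moreover have "cmod ?y \<le> cmod (g' n (\<psi> (snd z)))" using xle(2)[OF \<Phi>_bidisc[OF zc]] by (simp add: \<Phi>_def)
          moreover have "cmod (g' n (\<psi> (snd z))) \<le> cmod (g' n (snd z)) + \<bar>\<beta>\<bar> / M n"
            using g'sh[OF z(2), of n] norm_triangle_ineq2[of "g' n (\<psi> (snd z))" "g' n (snd z)"] by linarith
          moreover have "\<bar>\<alpha>\<bar> / M n \<ge> 0" using M0 by simp
          ultimately show ?thesis unfolding K1_def add_divide_distrib by linarith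
        qed
        moreover have "cmod (c - apply_bidisc w z) \<le> cmod c + norm w"
          using norm_triangle_ineq4[of c "apply_bidisc w z"] norm_apply_bidisc_le[OF zc, of w] by linarith
        ultimately have "cmod (c - apply_bidisc w z) * cmod ?y \<le> (cmod c + norm w) * (K1 / M n)"
          by (intro mult_mono) auto
        then show ?thesis using e by simp
      qed
      moreover have "apply_bidisc (l *\<^sub>C x n - T (x n)) z =
          (l * apply_bidisc (x n) z - c * ?y) + (c - apply_bidisc w z) * ?y"
        by (simp add: apply_bidisc_simps(4)[OF zc] apply_bidisc_scaleC[OF zc] apply_T[OF zc] algebra_simps)
      then have "cmod (apply_bidisc (l *\<^sub>C x n - T (x n)) z) \<le>
          cmod (l * apply_bidisc (x n) z - c * ?y) + cmod (c - apply_bidisc w z) * cmod ?y"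
        by (metis norm_triangle_ineq norm_mult)
      ultimately show "cmod (apply_bidisc (l *\<^sub>C x n - T (x n)) z) \<le> \<epsilon> + K / M n"
        using shift[OF zc, of n] by (simp add: K_def add_divide_distrib)
    qed
    then show ?thesis by blast
  qed
  have "(\<lambda>n. l *\<^sub>C x n - T (x n)) \<longlonglongrightarrow> 0"
  proof (rule tendstoI)
    fix e :: real assume e: "e > 0"
    then obtain K where K: "\<And>n. norm (l *\<^sub>C x n - T (x n)) \<le> e / 2 + K / M n" using resid[of "e / 2"] by auto
    have "(\<lambda>n. K / M n) \<longlonglongrightarrow> 0" by (rule real_tendsto_divide_at_top[OF tendsto_const Minf])
    then have "\<forall>\<^sub>F n in sequentially. K / M n < e / 2" by (rule order_tendstoD) (use e in auto)
    then show "\<forall>\<^sub>F n in sequentially. dist (l *\<^sub>C x n - T (x n)) 0 < e"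
    proof eventually_elim
      case (elim n)
      then show ?case unfolding dist_norm diff_0_right using K[of n] by linarith
    qed
  qed
  with upper lower pointwise show ?thesis by blast
qed

lemma not_upper_circle:
  assumes "cmod l = cmod c"
  shows "\<not> upper_semi_Fredholm (\<lambda>x. l *\<^sub>C x - T x)"
proof -
  obtain x where x: "\<And>n. norm (x n) \<le> 1" "\<And>n. 1 / 4 \<le> norm (x n)"
    "\<And>z. z \<in> open_bidisc \<Longrightarrow> (\<lambda>n. apply_bidisc (x n) z) \<longlonglongrightarrow> 0" "(\<lambda>n. l *\<^sub>C x n - T (x n)) \<longlonglongrightarrow> 0"
    using approximate_eigenvectors[OF assms] by blast
  have bdd: "bounded (range x)" using x(1) by (auto simp: bounded_iff)
  show ?thesis
  proof (rule not_upper_semi_Fredholm_bidisc[where d = "1/4"])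
    show "bounded_clinear (\<lambda>x. l *\<^sub>C x - T x)" by (intro bounded_clinear_resolvent bounded_clinear_T)
    fix e :: real assume "e > 0"
    then have "\<forall>\<^sub>F n in sequentially. norm (l *\<^sub>C x n - T (x n)) < e"
      using order_tendstoD(2)[OF tendsto_norm_zero[OF x(4)]] by blast
    then have "\<forall>\<^sub>F n in sequentially. 1 / 4 \<le> norm (x n) \<and> norm (l *\<^sub>C x n - T (x n)) \<le> e"
      by eventually_elim (use x(2) in auto)
    then show "\<exists>x. bounded (range x) \<and> (\<forall>z\<in>open_bidisc. (\<lambda>n. apply_bidisc (x n) z) \<longlonglongrightarrow> 0) \<and>
        (\<forall>\<^sub>F n in sequentially. 1 / 4 \<le> norm (x n) \<and> norm (l *\<^sub>C x n - T (x n)) \<le> e)"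
      using bdd x(3) by blast
  qed simp
qed

lemma circle_subset_ap_spectrum:
  assumes "cmod l = cmod c"
  shows "l \<in> ap_spectrum T"
proof -
  obtain x where x: "\<And>n. 1 / 4 \<le> norm (x n)" "(\<lambda>n. l *\<^sub>C x n - T (x n)) \<longlonglongrightarrow> 0"
    using approximate_eigenvectors[OF assms] by blast
  show ?thesis by (rule ap_spectrumI[OF bounded_clinear_T, of "1/4" x]) (use x in auto)
qed

text \<open>
  In the dual space, evaluation at \<open>z\<close> is mapped by \<open>T\<close> to \<open>w z\<close> times evaluation at \<open>\<Phi> z\<close>. This is the corresponding partial sum
  of a formal eigenfunctional for \<open>l\<close>, so \<open>l - T\<close> reduces it to its two end terms.
\<close>

definition orbit_sum :: "complex \<Rightarrow> nat \<Rightarrow> complex \<times> complex \<Rightarrow> bidisc_alg \<Rightarrow> complex" where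
  "orbit_sum l n z f = (\<Sum>k<n. W k z / l ^ k * apply_bidisc f ((\<Phi> ^^ k) z))"

lemma clinear_functional_orbit_sum: "z \<in> closed_bidisc \<Longrightarrow> clinear_functional (orbit_sum l n z)"
  unfolding orbit_sum_def
  by (intro clinear_functional_sum clinear_functional_scale clinear_functional_apply funpow_\<Phi>_bidisc)

lemma orbit_sum_resolvent:
  assumes z: "z \<in> closed_bidisc" and l: "l \<noteq> 0"
  shows "orbit_sum l n z (l *\<^sub>C f - T f) = l * (apply_bidisc f z - W n z / l ^ n * apply_bidisc f ((\<Phi> ^^ n) z))"
proof (induction n)
  case 0
  then show ?case by (simp add: orbit_sum_def W_def)
next
  case (Suc n)
  note zn = funpow_\<Phi>_bidisc[OF z, of n]
  have "orbit_sum l (Suc n) z (l *\<^sub>C f - T f) = orbit_sum l n z (l *\<^sub>C f - T f) +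
      W n z / l ^ n * (l * apply_bidisc f ((\<Phi> ^^ n) z) - apply_bidisc w ((\<Phi> ^^ n) z) * apply_bidisc f ((\<Phi> ^^ Suc n) z))"
    by (simp add: orbit_sum_def apply_bidisc_simps(4)[OF zn] apply_bidisc_scaleC[OF zn] apply_T[OF zn])
  also have "\<dots> = l * (apply_bidisc f z - W (Suc n) z / l ^ Suc n * apply_bidisc f ((\<Phi> ^^ Suc n) z))"
    unfolding Suc using l by (simp add: W_def field_simps)
  finally show ?case .
qed

text \<open>
  The functional is the difference of the orbit sums at a point \<open>z j\<close> close to the fixed point and at the fixed point itself, which
  makes it small on prescribed elements. Its \<open>n\<close> terms all have nearly equal size, and they add up in phase on a test
  function that behaves like \<open>exp (- s u)\<close> along the orbit of \<open>z j\<close> and vanishes at the fixed point. Only the end terms survive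
  \<open>l - T\<close>, so the functional stays bounded on its range while \<open>n\<close> grows. The second coordinate of \<open>z j\<close> can be kept at its fixed point.
\<close>

lemma not_lower_circle:
  assumes l: "cmod l = cmod c" and c0: "c \<noteq> 0"
  shows "\<not> fin_codim_range (\<lambda>x. l *\<^sub>C x - T x)"
proof (rule not_fin_codim_rangeI)
  fix B :: "bidisc_alg set" and N :: nat assume B: "finite B"
  have l0: "l \<noteq> 0" using l c0 by auto
  obtain s where s: "s \<ge> 0" "c * exp (- (\<i> * of_real (s * \<alpha>))) = l"
    using fst.frequency_exists[OF l] by blast
  define K where "K = 5 * cmod l + 1"
  have K: "K > 0" by (simp add: K_def add_nonneg_pos)
  obtain n :: nat where n: "real N * K / (7 / 16) \<le> real n" using real_arch_simple by blast
  \<comment> \<open>points of the unit circle that tend to \<open>\<xi>\<close>; the number \<open>n\<close> of orbit steps is fixed before they are chosen\<close>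
  have "\<forall>j. \<exists>z. cmod z = 1 \<and> z \<noteq> \<xi> \<and> cayley \<xi> z = \<i> * of_real (real (Suc j))"
    using cayley_imaginary_surj[OF fst.xi] by blast
  from choice[OF this] obtain a where a: "\<And>j. cmod (a j) = 1" "\<And>j. a j \<noteq> \<xi>"
    "\<And>j. cayley \<xi> (a j) = \<i> * of_real (real (Suc j))" by blast
  have "a \<longlonglongrightarrow> \<xi>"
  proof (rule LIM_zero_cancel, rule Lim_null_comparison)
    show "(\<lambda>j. 2 * inverse (real (Suc j))) \<longlonglongrightarrow> 0"
      using tendsto_mult_right_zero[OF LIMSEQ_inverse_real_of_nat] .
    show "\<forall>\<^sub>F j in sequentially. cmod (a j - \<xi>) \<le> 2 * inverse (real (Suc j))"
    proof (intro always_eventually allI)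
      fix j
      have "cmod (\<xi> - a j) * real (Suc j) \<le> cmod (\<xi> - a j) * cmod (cayley \<xi> (a j) + 1)"
        using abs_Im_le_cmod[of "cayley \<xi> (a j) + 1"] by (intro mult_left_mono) (auto simp: a(3))
      also have "\<dots> = 2" by (rule dist_cayley[OF fst.xi a(2)])
      finally show "cmod (a j - \<xi>) \<le> 2 * inverse (real (Suc j))"
        by (simp add: norm_minus_commute field_simps)
    qed
  qed
  define z where "z j = (a j, \<zeta>)" for j
  have zc: "z j \<in> closed_bidisc" for j using a(1) snd.xi by (simp add: z_def)
  have zlim: "z \<longlonglongrightarrow> (\<xi>, \<zeta>)" unfolding z_def by (intro tendsto_Pair tendsto_const) fact
  let ?p = "(\<xi>, \<zeta>)"
  note p = fixed_point_bidisc
  have ev1: "\<forall>\<^sub>F j in sequentially. \<forall>k\<in>{..n}. cmod (W k (z j) - c ^ k) < cmod c ^ k / 4"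
  proof (rule eventually_ball_finite, simp, rule ballI)
    fix k
    have "(\<lambda>j. W k (z j)) \<longlonglongrightarrow> c ^ k" using tendsto_W[OF zlim zc p] by (simp add: W_fix)
    from tendstoD[OF this, of "cmod c ^ k / 4"]
    show "\<forall>\<^sub>F j in sequentially. cmod (W k (z j) - c ^ k) < cmod c ^ k / 4" using c0 by (simp add: dist_norm)
  qed
  have ev2: "\<forall>\<^sub>F j in sequentially. \<forall>b\<in>B. cmod (orbit_sum l n (z j) b - orbit_sum l n ?p b) < K"
  proof (rule eventually_ball_finite[OF B], rule ballI)
    fix b
    have "(\<lambda>j. orbit_sum l n (z j) b) \<longlonglongrightarrow> orbit_sum l n ?p b"
      unfolding orbit_sum_def using l0
      by (intro tendsto_intros tendsto_W tendsto_apply_orbit zlim zc p) auto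
    from tendstoD[OF this K] show "\<forall>\<^sub>F j in sequentially. cmod (orbit_sum l n (z j) b - orbit_sum l n ?p b) < K"
      by (simp add: dist_norm)
  qed
  from eventually_conj[OF ev1 ev2] obtain j where j: "\<And>k. k \<le> n \<Longrightarrow> cmod (W k (z j) - c ^ k) < cmod c ^ k / 4"
    "\<And>b. b \<in> B \<Longrightarrow> cmod (orbit_sum l n (z j) b - orbit_sum l n ?p b) < K"
    by (auto simp: eventually_sequentially)
  define \<Lambda> where "\<Lambda> f = of_real (1 / K) * (orbit_sum l n (z j) f - orbit_sum l n ?p f)" for f
  have lin: "clinear_functional \<Lambda>"
    unfolding \<Lambda>_def by (intro clinear_functional_scale clinear_functional_diff clinear_functional_orbit_sum zc p)
  have normL: "cmod (\<Lambda> f) = cmod (orbit_sum l n (z j) f - orbit_sum l n ?p f) / K" for f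
    using K by (simp add: \<Lambda>_def norm_mult norm_divide)
  have small: "cmod (\<Lambda> (l *\<^sub>C f - T f)) \<le> norm f" for f
  proof -
    have gen: "cmod (orbit_sum l n y (l *\<^sub>C f - T f)) \<le> cmod l * (norm f + cmod (W n y) / cmod l ^ n * norm f)"
      if y: "y \<in> closed_bidisc" for y
    proof -
      have "cmod (apply_bidisc f y - W n y / l ^ n * apply_bidisc f ((\<Phi> ^^ n) y)) \<le>
          cmod (apply_bidisc f y) + cmod (W n y) / cmod l ^ n * cmod (apply_bidisc f ((\<Phi> ^^ n) y))"
        by (metis norm_triangle_ineq4 norm_mult norm_divide norm_power)
      also have "\<dots> \<le> norm f + cmod (W n y) / cmod l ^ n * norm f"
        by (intro add_mono mult_left_mono norm_apply_bidisc_le funpow_\<Phi>_bidisc y) auto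
      finally show ?thesis unfolding orbit_sum_resolvent[OF y l0] norm_mult by (intro mult_left_mono) auto
    qed
    have "cmod l ^ n > 0" using l0 by simp
    then have cl: "cmod c ^ n = cmod l ^ n" "cmod l ^ n > 0" using l by simp_all
    have "cmod (W n (z j)) \<le> 2 * cmod l ^ n"
      using j(1)[of n] norm_triangle_ineq2[of "W n (z j)" "c ^ n"] cl by (simp add: norm_power)
    then have W2: "cmod (W n (z j)) / cmod l ^ n \<le> 2" using cl by (simp add: field_simps)
    have W1: "cmod (W n ?p) / cmod l ^ n = 1" using cl l0 by (simp add: W_fix norm_power)
    have "cmod (orbit_sum l n (z j) (l *\<^sub>C f - T f)) \<le> cmod l * (norm f + 2 * norm f)"
      by (rule order_trans[OF gen[OF zc]]) (intro mult_left_mono add_mono mult_right_mono W2; simp)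
    moreover have "cmod (orbit_sum l n ?p (l *\<^sub>C f - T f)) \<le> cmod l * (norm f + norm f)"
      using gen[OF p] W1 by simp
    ultimately have "cmod (orbit_sum l n (z j) (l *\<^sub>C f - T f) - orbit_sum l n ?p (l *\<^sub>C f - T f)) \<le> 5 * cmod l * norm f"
      using norm_triangle_ineq4[of "orbit_sum l n (z j) (l *\<^sub>C f - T f)" "orbit_sum l n ?p (l *\<^sub>C f - T f)"]
      by (simp add: algebra_simps)
    also have "\<dots> \<le> K * norm f" by (simp add: K_def algebra_simps)
    finally show ?thesis using K by (simp add: normL field_simps)
  qed
  have onB: "cmod (\<Lambda> b) \<le> 1" if "b \<in> B" for b
    using j(2)[OF that] K by (simp add: normL field_simps)
  \<comment> \<open>A test function adapted to the chosen point: the kernel is centred there, and \<open>M\<close> is so large that it is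
    nearly constant along the \<open>n\<close> steps.\<close>
  define M where "M = 4 * (real n * \<bar>\<alpha>\<bar>) + 1"
  have M: "M \<ge> 1" by (simp add: M_def)
  define y where "y = real (Suc j)"
  define g where "g v = of_real M * exp_kernel \<xi> s (of_real M - \<i> * of_real y) v" for v
  have dg: "disc_alg g"
    unfolding g_def using M s(1) fst.xi by (intro disc_alg_mult disc_alg_const disc_alg_exp_kernel) auto
  define f where "f = of_bidisc_fun (\<lambda>v. g (fst v))"
  have f: "apply_bidisc f v = g (fst v)" if "v \<in> closed_bidisc" for v
    unfolding f_def by (rule apply_lift_fst[OF dg that])
  have fle: "norm f \<le> 1"
  proof (rule norm_bidisc_leI)
    fix v assume v: "v \<in> closed_bidisc"
    then have "cmod (exp_kernel \<xi> s (of_real M - \<i> * of_real y) (fst v)) \<le> 1 / M"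
      using norm_exp_kernel_le[OF fst.xi _ _ s(1), of "fst v" "of_real M - \<i> * of_real y"] M
      by (auto simp: mem_Times_iff)
    then show "cmod (apply_bidisc f v) \<le> 1" using M by (simp add: f[OF v] g_def norm_mult field_simps)
  qed
  have fp: "orbit_sum l n ?p f = 0"
    by (simp add: orbit_sum_def funpow_\<Phi>_fix f[OF p] g_def exp_kernel_def)
  define r where "r k = W k (z j) / c ^ k" for k
  define t where "t k = of_real M / (of_real M + \<i> * of_real (real k * \<alpha>))" for k
  define e where "e = exp (- of_real s * (\<i> * of_real y))"
  have e1: "cmod e = 1" by (simp add: e_def)
  have summand: "W k (z j) / l ^ k * apply_bidisc f ((\<Phi> ^^ k) (z j)) = e * (r k * t k)" for k
  proof -
    have aj: "cmod (a j) \<le> 1" using a(1)[of j] by simp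
    let ?v = "(\<phi> ^^ k) (a j)"
    have vx: "?v \<noteq> \<xi>" using fst.funpow_p_eq_xi_iff[OF aj] a(2) by blast
    have cv: "cayley \<xi> ?v = \<i> * of_real y + \<i> * of_real (real k * \<alpha>)"
      using fst.cayley_funpow[OF aj a(2)[of j], of k] by (simp only: a(3) y_def)
    have "apply_bidisc f ((\<Phi> ^^ k) (z j)) = g ?v"
      using f[OF funpow_\<Phi>_bidisc[OF zc]] by (simp add: funpow_\<Phi> z_def)
    also have "\<dots> = exp (- of_real s * cayley \<xi> ?v) * (of_real M / (cayley \<xi> ?v + (of_real M - \<i> * of_real y)))"
      using vx by (simp add: g_def exp_kernel_def half_plane_kernel_eq)
    also have "cayley \<xi> ?v + (of_real M - \<i> * of_real y) = of_real M + \<i> * of_real (real k * \<alpha>)"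
      unfolding cv by simp
    also have "exp (- of_real s * cayley \<xi> ?v) = e * exp (- (\<i> * of_real (s * \<alpha>))) ^ k"
      unfolding cv e_def by (simp add: exp_of_nat_mult[symmetric] exp_add[symmetric] algebra_simps)
    also have "exp (- (\<i> * of_real (s * \<alpha>))) = l / c" using s(2) c0 by (simp add: field_simps)
    finally have "apply_bidisc f ((\<Phi> ^^ k) (z j)) = e * (l / c) ^ k * t k" by (simp add: t_def)
    then show ?thesis using l0 by (simp add: r_def power_divide)
  qed
  have Re_ge: "7 / 16 \<le> Re (r k * t k)" if k: "k < n" for k
  proof -
    have eq: "cmod (r k - 1) = cmod (W k (z j) - c ^ k) / cmod c ^ k"
    proof -
      have "r k - 1 = (W k (z j) - c ^ k) / c ^ k" using c0 by (simp add: r_def diff_divide_distrib)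
      then show ?thesis by (simp add: norm_divide norm_power)
    qed
    have "cmod c ^ k > 0" using c0 by simp
    then have r1: "cmod (r k - 1) \<le> 1 / 4"
      unfolding eq using j(1)[of k] k by (subst pos_divide_le_eq) auto
    have den: "M \<le> cmod (of_real M + \<i> * of_real (real k * \<alpha>))"
      using abs_Re_le_cmod[of "of_real M + \<i> * of_real (real k * \<alpha>)"] M by simp
    then have den0: "of_real M + \<i> * of_real (real k * \<alpha>) \<noteq> 0" using M by auto
    have "cmod (t k - 1) = real k * \<bar>\<alpha>\<bar> / cmod (of_real M + \<i> * of_real (real k * \<alpha>))"
    proof -
      have "t k - 1 = (of_real M - (of_real M + \<i> * of_real (real k * \<alpha>))) / (of_real M + \<i> * of_real (real k * \<alpha>))"
        unfolding t_def diff_divide_distrib divide_self[OF den0] ..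
      then show ?thesis by (simp add: norm_divide norm_mult abs_mult)
    qed
    also have "\<dots> \<le> real n * \<bar>\<alpha>\<bar> / M"
      using k den M by (intro frac_le mult_right_mono) auto
    also have "\<dots> \<le> 1 / 4" using M by (subst pos_divide_le_eq) (linarith, simp add: M_def)
    finally have t1: "cmod (t k - 1) \<le> 1 / 4" .
    have "r k * t k - 1 = (r k - 1) * (t k - 1) + (r k - 1) + (t k - 1)" by (simp add: algebra_simps)
    then have "cmod (r k * t k - 1) \<le> cmod (r k - 1) * cmod (t k - 1) + cmod (r k - 1) + cmod (t k - 1)"
      by (metis (no_types, lifting) add_right_mono norm_mult norm_triangle_ineq order_trans)
    also have "\<dots> \<le> 1 / 4 * (1 / 4) + 1 / 4 + 1 / 4" using r1 t1 by (intro add_mono mult_mono) auto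
    finally have "\<bar>Re (r k * t k - 1)\<bar> \<le> 9 / 16" using abs_Re_le_cmod[of "r k * t k - 1"] by linarith
    moreover have "Re (r k * t k - 1) = Re (r k * t k) - 1" by (simp only: minus_complex.sel one_complex.sel)
    ultimately show ?thesis by linarith
  qed
  have "orbit_sum l n (z j) f = e * (\<Sum>k<n. r k * t k)"
    unfolding orbit_sum_def summand sum_distrib_left ..
  then have "cmod (orbit_sum l n (z j) f) = cmod (\<Sum>k<n. r k * t k)" by (simp add: norm_mult e1)
  moreover have "(\<Sum>k<n. 7 / 16) \<le> (\<Sum>k<n. Re (r k * t k))" by (intro sum_mono) (use Re_ge in auto)
  moreover have "(\<Sum>k<n. Re (r k * t k)) \<le> cmod (\<Sum>k<n. r k * t k)"
    unfolding Re_sum[symmetric] by (rule complex_Re_le_cmod)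
  ultimately have "7 / 16 * real n \<le> cmod (orbit_sum l n (z j) f)" by simp
  then have "real N * K \<le> cmod (orbit_sum l n (z j) f)" using n by (simp add: field_simps)
  then have "real N \<le> cmod (\<Lambda> f)" using K by (simp add: normL fp field_simps)
  then show "\<exists>\<Lambda>. bounded_linear \<Lambda> \<and> (\<forall>c x. \<Lambda> (c *\<^sub>C x) = c * \<Lambda> x) \<and>
      (\<forall>x. cmod (\<Lambda> (l *\<^sub>C x - T x)) \<le> norm x) \<and> (\<forall>b\<in>B. cmod (\<Lambda> b) \<le> 1) \<and>
      (\<exists>f. norm f \<le> 1 \<and> real N \<le> cmod (\<Lambda> f))"
    using lin small onB fle unfolding clinear_functional_def by blast
qed

end


section \<open>Zeros with a coordinate on the circle: infinite codimension\<close>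

lemma apply_bidisc_power: "z \<in> closed_bidisc \<Longrightarrow> apply_bidisc (f ^ n) z = apply_bidisc f z ^ n"
  by (induction n) (simp_all only: power_0 power_Suc apply_bidisc_simps)

context bidisc_weighted_map
begin

lemma weight_orbit_tendsto:
  assumes z: "z \<in> closed_bidisc"
  shows "(\<lambda>k. apply_bidisc w ((\<Phi> ^^ k) z)) \<longlonglongrightarrow> c"
proof (rule tendstoI)
  fix e :: real assume "e > 0"
  then have "finite {k. e \<le> cmod (apply_bidisc w ((\<Phi> ^^ k) z) - c)}"
    using weight_few_visits z by blast
  then have "\<forall>\<^sub>F k in sequentially. \<not> e \<le> cmod (apply_bidisc w ((\<Phi> ^^ k) z) - c)"
    unfolding cofinite_eq_sequentially[symmetric] eventually_cofinite by simp
  then show "\<forall>\<^sub>F k in sequentially. dist (apply_bidisc w ((\<Phi> ^^ k) z)) c < e"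
    by eventually_elim (simp add: dist_norm)
qed

lemma last_zero_on_orbit:
  assumes z: "z \<in> closed_bidisc" "apply_bidisc w z = 0" and c0: "c \<noteq> 0"
  shows "\<exists>k. apply_bidisc w ((\<Phi> ^^ k) z) = 0 \<and> (\<forall>j\<ge>1. apply_bidisc w ((\<Phi> ^^ j) ((\<Phi> ^^ k) z)) \<noteq> 0)"
proof -
  let ?Z = "{k. apply_bidisc w ((\<Phi> ^^ k) z) = 0}"
  have "\<forall>\<^sub>F k in sequentially. apply_bidisc w ((\<Phi> ^^ k) z) \<noteq> 0"
    by (rule tendsto_imp_eventually_ne[OF weight_orbit_tendsto[OF z(1)] c0])
  then have fin: "finite ?Z" unfolding cofinite_eq_sequentially[symmetric] eventually_cofinite by simp
  have "0 \<in> ?Z" using z by simp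
  then have M: "Max ?Z \<in> ?Z" using Max_in[OF fin] by blast
  have "apply_bidisc w ((\<Phi> ^^ j) ((\<Phi> ^^ Max ?Z) z)) \<noteq> 0" if "j \<ge> 1" for j
  proof
    assume "apply_bidisc w ((\<Phi> ^^ j) ((\<Phi> ^^ Max ?Z) z)) = 0"
    then have "j + Max ?Z \<in> ?Z" by (simp add: funpow_add)
    from Max_ge[OF fin this] that show False by simp
  qed
  with M show ?thesis by blast
qed

text \<open>
  The coefficients for which \<open>coef l (k + 1) * w = l * coef l k\<close> at the orbit point \<open>k + 1\<close>, so that the weight along the orbit is absorbed into \<open>l\<close>.
\<close>

definition coef :: "complex \<Rightarrow> nat \<Rightarrow> complex \<times> complex \<Rightarrow> complex" where
  "coef l k z = (\<Prod>j<k. l / apply_bidisc w ((\<Phi> ^^ Suc j) z))"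

lemma coef_0 [simp]: "coef l 0 z = 1"
  by (simp add: coef_def)

lemma coef_Suc: "coef l (Suc k) z = coef l k z * (l / apply_bidisc w ((\<Phi> ^^ Suc k) z))"
  by (simp add: coef_def)

text \<open>
  The ratio of consecutive coefficients tends to \<open>l / c\<close>.
\<close>

lemma coef_tail:
  assumes z: "z \<in> closed_bidisc" and l: "cmod l < cmod c"
  shows "(\<lambda>m. l * coef l m z) \<longlonglongrightarrow> 0"
proof -
  obtain b where b: "cmod l < b" "b < cmod c" using l dense by blast
  have b0: "b > 0" using b(1) norm_ge_zero[of l] by linarith
  have "(\<lambda>k. apply_bidisc w ((\<Phi> ^^ Suc k) z)) \<longlonglongrightarrow> c"
    using LIMSEQ_Suc[OF weight_orbit_tendsto[OF z]] .
  from order_tendstoD(1)[OF tendsto_norm[OF this] b(2)]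
  obtain N where N: "\<And>k. k \<ge> N \<Longrightarrow> b < cmod (apply_bidisc w ((\<Phi> ^^ Suc k) z))"
    unfolding eventually_sequentially by blast
  have "summable (\<lambda>m. l * coef l m z)"
  proof (rule summable_ratio_test)
    show "cmod l / b < 1" using b b0 by simp
    fix m assume "m \<ge> N"
    then have "cmod l / cmod (apply_bidisc w ((\<Phi> ^^ Suc m) z)) \<le> cmod l / b"
      using N[of m] b0 by (intro frac_le) auto
    then have "cmod (l * coef l m z) * (cmod l / cmod (apply_bidisc w ((\<Phi> ^^ Suc m) z))) \<le> cmod (l * coef l m z) * (cmod l / b)"
      by (intro mult_left_mono) auto
    then show "norm (l * coef l (Suc m) z) \<le> cmod l / b * norm (l * coef l m z)"
      by (simp add: coef_Suc norm_mult norm_divide mult_ac)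
  qed
  then show ?thesis by (rule summable_LIMSEQ_zero)
qed

end

context bidisc_weighted_map
begin

interpretation inv: bidisc_weighted_map \<phi>' \<phi> \<xi> "- \<alpha>" \<psi>' \<psi> \<zeta> "- \<beta>" w
  by (intro bidisc_weighted_map.intro fst.inverse_map snd.inverse_map)

lemma \<Phi>_inv: "z \<in> closed_bidisc \<Longrightarrow> \<Phi> (inv.\<Phi> z) = z" "z \<in> closed_bidisc \<Longrightarrow> inv.\<Phi> (\<Phi> z) = z"
  by (auto simp: \<Phi>_def inv.\<Phi>_def mem_Times_iff fst.p_q snd.p_q fst.q_p snd.q_p)

lemma funpow_\<Phi>_inv: "z \<in> closed_bidisc \<Longrightarrow> (\<Phi> ^^ k) ((inv.\<Phi> ^^ k) z) = z"
proof (induction k)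
  case (Suc k)
  then show ?case
    using \<Phi>_inv(1)[OF inv.funpow_\<Phi>_bidisc[OF Suc.prems, of k]] by (simp add: funpow_swap1[of \<Phi>])
qed simp

text \<open>
  For infinite \<open>m\<close> and a zero \<open>z\<close> of \<open>w\<close> this would be an eigenfunctional of the dual of \<open>T\<close>: along the backward orbit the
  coefficients reproduce themselves, and the weight at \<open>z\<close> kills the term that would leave the sum.
\<close>

definition back_sum :: "complex \<Rightarrow> nat \<Rightarrow> complex \<times> complex \<Rightarrow> bidisc_alg \<Rightarrow> complex" where
  "back_sum l m z f = (\<Sum>k\<le>m. inv.coef l k z * apply_bidisc f ((inv.\<Phi> ^^ k) z))"

lemma clinear_functional_back_sum: "z \<in> closed_bidisc \<Longrightarrow> clinear_functional (back_sum l m z)"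
  unfolding back_sum_def
  by (intro clinear_functional_sum clinear_functional_scale clinear_functional_apply inv.funpow_\<Phi>_bidisc)

lemma back_sum_resolvent:
  assumes z: "z \<in> closed_bidisc" and nz: "\<And>j. j < m \<Longrightarrow> apply_bidisc w ((inv.\<Phi> ^^ Suc j) z) \<noteq> 0"
  shows "back_sum l m z (l *\<^sub>C f - T f) =
    l * inv.coef l m z * apply_bidisc f ((inv.\<Phi> ^^ m) z) - apply_bidisc w z * apply_bidisc f (\<Phi> z)"
  using nz
proof (induction m)
  case 0
  then show ?case
    by (simp add: back_sum_def apply_bidisc_simps(4)[OF z] apply_bidisc_scaleC[OF z] apply_T[OF z])
next
  case (Suc m)
  let ?y = "(inv.\<Phi> ^^ Suc m) z"
  have yc: "?y \<in> closed_bidisc" by (rule inv.funpow_\<Phi>_bidisc[OF z])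
  have \<Phi>y: "\<Phi> ?y = (inv.\<Phi> ^^ m) z"
    using \<Phi>_inv(1)[OF inv.funpow_\<Phi>_bidisc[OF z, of m]] by simp
  have coef: "inv.coef l (Suc m) z * apply_bidisc w ?y = l * inv.coef l m z"
    using Suc.prems[of m] by (simp add: inv.coef_Suc)
  have "back_sum l (Suc m) z (l *\<^sub>C f - T f) = back_sum l m z (l *\<^sub>C f - T f) +
      inv.coef l (Suc m) z * (l * apply_bidisc f ?y - apply_bidisc w ?y * apply_bidisc f ((inv.\<Phi> ^^ m) z))"
    unfolding back_sum_def sum.atMost_Suc apply_bidisc_simps(4)[OF yc] apply_bidisc_scaleC[OF yc] apply_T[OF yc] \<Phi>y ..
  also have "\<dots> = back_sum l m z (l *\<^sub>C f - T f) + l * inv.coef l (Suc m) z * apply_bidisc f ?y -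
      (inv.coef l (Suc m) z * apply_bidisc w ?y) * apply_bidisc f ((inv.\<Phi> ^^ m) z)"
    by (simp only: algebra_simps)
  also have "\<dots> = l * inv.coef l (Suc m) z * apply_bidisc f ?y - apply_bidisc w z * apply_bidisc f (\<Phi> z)"
    unfolding coef using Suc by simp
  finally show ?case .
qed

text \<open>
  The functional is a large multiple \<open>R\<close> of the difference of the back sums at \<open>z n\<close> and at \<open>q\<close>. It is small on prescribed elements
  because \<open>z n\<close> tends to \<open>q\<close>; it is small on the range of \<open>l - T\<close> because \<open>w\<close> is small at \<open>z n\<close> and the coefficients at the far end
  are small. It is large on high powers of \<open>P n\<close>, which single out the evaluation at \<open>z n\<close>, whose coefficient is \<open>1\<close>.
\<close>

lemma not_lower_of_zero:
  assumes q: "q \<in> closed_bidisc" "apply_bidisc w q = 0"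
    and z: "z \<longlonglongrightarrow> q" "\<And>n. z n \<in> closed_bidisc"
    and P: "\<And>n. norm (P n) \<le> 1" "\<And>n. apply_bidisc (P n) (z n) = 1"
    and Pq: "\<And>k. \<forall>\<^sub>F n in sequentially. cmod (apply_bidisc (P n) ((inv.\<Phi> ^^ k) q)) < 1"
    and Pz: "\<And>k. \<forall>\<^sub>F n in sequentially. cmod (apply_bidisc (P n) ((inv.\<Phi> ^^ Suc k) (z n))) < 1"
    and tail: "\<And>\<epsilon>. \<epsilon> > 0 \<Longrightarrow> \<exists>m. (\<forall>j<m. apply_bidisc w ((inv.\<Phi> ^^ Suc j) q) \<noteq> 0) \<and> cmod (l * inv.coef l m q) < \<epsilon>"
  shows "\<not> fin_codim_range (\<lambda>x. l *\<^sub>C x - T x)"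
proof (rule not_fin_codim_rangeI)
  fix B :: "bidisc_alg set" and N :: nat assume B: "finite B"
  define R where "R = 2 * real N + 1"
  have R: "R > 0" by (simp add: R_def)
  define \<epsilon> where "\<epsilon> = 1 / (4 * R)"
  have e: "\<epsilon> > 0" using R by (simp add: \<epsilon>_def)
  obtain m where m: "\<And>j. j < m \<Longrightarrow> apply_bidisc w ((inv.\<Phi> ^^ Suc j) q) \<noteq> 0" "cmod (l * inv.coef l m q) < \<epsilon>"
    using tail[OF e] by blast
  note lim = inv.tendsto_apply_orbit[OF z q(1)]
  have coef_lim: "(\<lambda>n. inv.coef l k (z n)) \<longlonglongrightarrow> inv.coef l k q" if "k \<le> m" for k
    unfolding inv.coef_def by (intro tendsto_prod tendsto_divide tendsto_const lim m) (use that in auto)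
  have ev1: "\<forall>\<^sub>F n in sequentially. \<forall>j\<in>{..<m}. apply_bidisc w ((inv.\<Phi> ^^ Suc j) (z n)) \<noteq> 0"
    by (intro eventually_ball_finite ballI tendsto_imp_eventually_ne[OF lim] m) auto
  have "(\<lambda>n. apply_bidisc w (z n)) \<longlonglongrightarrow> 0" using lim[of w 0] q(2) by simp
  from tendstoD[OF this e] have ev2: "\<forall>\<^sub>F n in sequentially. cmod (apply_bidisc w (z n)) < \<epsilon>"
    by (simp add: dist_norm)
  have "(\<lambda>n. l * inv.coef l m (z n)) \<longlonglongrightarrow> l * inv.coef l m q"
    by (intro tendsto_intros coef_lim) simp
  from order_tendstoD(2)[OF tendsto_norm[OF this] m(2)]
  have ev3: "\<forall>\<^sub>F n in sequentially. cmod (l * inv.coef l m (z n)) < \<epsilon>" .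
  have ev4: "\<forall>\<^sub>F n in sequentially. \<forall>b\<in>B. cmod (back_sum l m (z n) b - back_sum l m q b) < 1 / R"
  proof (rule eventually_ball_finite[OF B], rule ballI)
    fix b
    have "(\<lambda>n. back_sum l m (z n) b) \<longlonglongrightarrow> back_sum l m q b"
      unfolding back_sum_def by (intro tendsto_sum tendsto_mult coef_lim lim) auto
    from tendstoD[OF this, of "1 / R"] R
    show "\<forall>\<^sub>F n in sequentially. cmod (back_sum l m (z n) b - back_sum l m q b) < 1 / R"
      by (simp add: dist_norm)
  qed
  have ev5: "\<forall>\<^sub>F n in sequentially. \<forall>k\<in>{..m}. cmod (apply_bidisc (P n) ((inv.\<Phi> ^^ k) q)) < 1"
    by (intro eventually_ball_finite ballI Pq) auto
  have ev6: "\<forall>\<^sub>F n in sequentially. \<forall>k\<in>{..<m}. cmod (apply_bidisc (P n) ((inv.\<Phi> ^^ Suc k) (z n))) < 1"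
    by (intro eventually_ball_finite ballI Pz) auto
  from eventually_happens'[OF sequentially_bot eventually_conj[OF ev1 eventually_conj[OF ev2 eventually_conj[OF ev3
      eventually_conj[OF ev4 eventually_conj[OF ev5 ev6]]]]]]
  obtain n where ev: "\<forall>j\<in>{..<m}. apply_bidisc w ((inv.\<Phi> ^^ Suc j) (z n)) \<noteq> 0"
    "cmod (apply_bidisc w (z n)) < \<epsilon>" "cmod (l * inv.coef l m (z n)) < \<epsilon>"
    "\<forall>b\<in>B. cmod (back_sum l m (z n) b - back_sum l m q b) < 1 / R"
    "\<forall>k\<in>{..m}. cmod (apply_bidisc (P n) ((inv.\<Phi> ^^ k) q)) < 1"
    "\<forall>k\<in>{..<m}. cmod (apply_bidisc (P n) ((inv.\<Phi> ^^ Suc k) (z n))) < 1"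
    by blast
  have n: "\<And>j. j < m \<Longrightarrow> apply_bidisc w ((inv.\<Phi> ^^ Suc j) (z n)) \<noteq> 0"
    "cmod (apply_bidisc w (z n)) < \<epsilon>" "cmod (l * inv.coef l m (z n)) < \<epsilon>"
    "\<And>b. b \<in> B \<Longrightarrow> cmod (back_sum l m (z n) b - back_sum l m q b) < 1 / R"
    "\<And>k. k \<le> m \<Longrightarrow> cmod (apply_bidisc (P n) ((inv.\<Phi> ^^ k) q)) < 1"
    "\<And>k. k < m \<Longrightarrow> cmod (apply_bidisc (P n) ((inv.\<Phi> ^^ Suc k) (z n))) < 1"
    using ev by blast+
  define \<Lambda> where "\<Lambda> f = of_real R * (back_sum l m (z n) f - back_sum l m q f)" for f
  have lin: "clinear_functional \<Lambda>"
    unfolding \<Lambda>_def by (intro clinear_functional_scale clinear_functional_diff clinear_functional_back_sum z q)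
  have normL: "cmod (\<Lambda> f) = R * cmod (back_sum l m (z n) f - back_sum l m q f)" for f
    using R by (simp add: \<Lambda>_def norm_mult)
  have gen: "cmod (back_sum l m y (l *\<^sub>C f - T f)) \<le> 2 * \<epsilon> * norm f"
    if y: "y \<in> closed_bidisc" "\<And>j. j < m \<Longrightarrow> apply_bidisc w ((inv.\<Phi> ^^ Suc j) y) \<noteq> 0"
      "cmod (apply_bidisc w y) < \<epsilon>" "cmod (l * inv.coef l m y) < \<epsilon>" for y f
  proof -
    have eq: "back_sum l m y (l *\<^sub>C f - T f) =
        l * inv.coef l m y * apply_bidisc f ((inv.\<Phi> ^^ m) y) - apply_bidisc w y * apply_bidisc f (\<Phi> y)"
      by (rule back_sum_resolvent[OF y(1)]) (rule y(2))
    have "cmod (back_sum l m y (l *\<^sub>C f - T f)) \<le>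
        cmod (l * inv.coef l m y) * cmod (apply_bidisc f ((inv.\<Phi> ^^ m) y)) + cmod (apply_bidisc w y) * cmod (apply_bidisc f (\<Phi> y))"
      unfolding eq using norm_triangle_ineq4[of "l * inv.coef l m y * apply_bidisc f ((inv.\<Phi> ^^ m) y)" "apply_bidisc w y * apply_bidisc f (\<Phi> y)"]
      by (simp only: norm_mult)
    also have "\<dots> \<le> \<epsilon> * norm f + \<epsilon> * norm f"
      using y(3,4) e by (intro add_mono mult_mono norm_apply_bidisc_le inv.funpow_\<Phi>_bidisc \<Phi>_bidisc y(1)) auto
    finally show ?thesis by simp
  qed
  have small: "cmod (\<Lambda> (l *\<^sub>C f - T f)) \<le> norm f" for f
  proof -
    have "cmod (back_sum l m (z n) (l *\<^sub>C f - T f)) \<le> 2 * \<epsilon> * norm f" by (rule gen[OF z(2) n(1,2,3)])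
    moreover have "cmod (back_sum l m q (l *\<^sub>C f - T f)) \<le> 2 * \<epsilon> * norm f"
      by (rule gen[OF q(1) m(1)]) (use q(2) e m(2) in auto)
    ultimately have "cmod (back_sum l m (z n) (l *\<^sub>C f - T f) - back_sum l m q (l *\<^sub>C f - T f)) \<le> 4 * \<epsilon> * norm f"
      using norm_triangle_ineq4[of "back_sum l m (z n) (l *\<^sub>C f - T f)" "back_sum l m q (l *\<^sub>C f - T f)"] by simp
    then have "cmod (\<Lambda> (l *\<^sub>C f - T f)) \<le> R * (4 * \<epsilon> * norm f)"
      unfolding normL using R by (intro mult_left_mono) auto
    also have "\<dots> = norm f" using R by (simp add: \<epsilon>_def)
    finally show ?thesis .
  qed
  have onB: "cmod (\<Lambda> b) \<le> 1" if "b \<in> B" for b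
    using n(4)[OF that] R by (simp add: normL field_simps)
  have pw: "(\<lambda>i. a * apply_bidisc (P n ^ i) y) \<longlonglongrightarrow> 0"
    if "y \<in> closed_bidisc" "cmod (apply_bidisc (P n) y) < 1" for a y
    using that by (simp add: apply_bidisc_power LIMSEQ_power_zero tendsto_mult_right_zero)
  have "(\<lambda>i. back_sum l m (z n) (P n ^ i) - back_sum l m q (P n ^ i)) \<longlonglongrightarrow> 1 - 0"
  proof (rule tendsto_diff)
    have "(\<lambda>i. \<Sum>k<m. inv.coef l (Suc k) (z n) * apply_bidisc (P n ^ i) ((inv.\<Phi> ^^ Suc k) (z n))) \<longlonglongrightarrow> 0"
      by (intro tendsto_null_sum pw inv.funpow_\<Phi>_bidisc z n(6)) auto
    then have "(\<lambda>i. 1 + (\<Sum>k<m. inv.coef l (Suc k) (z n) * apply_bidisc (P n ^ i) ((inv.\<Phi> ^^ Suc k) (z n)))) \<longlonglongrightarrow> 1 + 0"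
      by (intro tendsto_add tendsto_const)
    moreover have "back_sum l m (z n) (P n ^ i) =
        1 + (\<Sum>k<m. inv.coef l (Suc k) (z n) * apply_bidisc (P n ^ i) ((inv.\<Phi> ^^ Suc k) (z n)))" for i
      unfolding back_sum_def sum.atMost_shift using z(2)[of n] P(2)[of n] by (simp add: apply_bidisc_power)
    ultimately show "(\<lambda>i. back_sum l m (z n) (P n ^ i)) \<longlonglongrightarrow> 1" by simp
    show "(\<lambda>i. back_sum l m q (P n ^ i)) \<longlonglongrightarrow> 0"
      unfolding back_sum_def by (intro tendsto_null_sum pw inv.funpow_\<Phi>_bidisc q n(5)) auto
  qed
  from order_tendstoD(1)[OF tendsto_norm[OF this], of "1/2"]
  obtain i where i: "1 / 2 < cmod (back_sum l m (z n) (P n ^ i) - back_sum l m q (P n ^ i))"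
    by (auto simp: eventually_sequentially)
  have "real N \<le> R * (1 / 2)" by (simp add: R_def)
  also have "\<dots> \<le> cmod (\<Lambda> (P n ^ i))" unfolding normL using i R by (intro mult_left_mono) auto
  finally have big: "real N \<le> cmod (\<Lambda> (P n ^ i))" .
  have "norm (P n ^ i) \<le> 1"
    using norm_power_ineq[of "P n" i] power_le_one[OF norm_ge_zero P(1), of n i] by linarith
  then show "\<exists>\<Lambda>. bounded_linear \<Lambda> \<and> (\<forall>c x. \<Lambda> (c *\<^sub>C x) = c * \<Lambda> x) \<and>
      (\<forall>x. cmod (\<Lambda> (l *\<^sub>C x - T x)) \<le> norm x) \<and> (\<forall>b\<in>B. cmod (\<Lambda> b) \<le> 1) \<and>
      (\<exists>f. norm f \<le> 1 \<and> real N \<le> cmod (\<Lambda> f))"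
    using lin small onB big unfolding clinear_functional_def by blast
qed

text \<open>
  A coordinate \<open>\<pi>\<close> with \<open>\<bar>\<pi> (z n)\<bar> = 1\<close> provides the functions \<open>P n\<close>, provided that it separates \<open>z n\<close> from the other points of the two
  backward orbits.
\<close>

lemma not_lower_of_zero_coordinate:
  fixes \<pi> :: "complex \<times> complex \<Rightarrow> complex" and Q :: "complex \<Rightarrow> bidisc_alg"
  assumes q: "q \<in> closed_bidisc" "apply_bidisc w q = 0"
    and z: "z \<longlonglongrightarrow> q" "\<And>n. z n \<in> closed_bidisc"
    and \<pi>: "\<And>v. v \<in> closed_bidisc \<Longrightarrow> cmod (\<pi> v) \<le> 1" "\<And>n. cmod (\<pi> (z n)) = 1"
    and Q: "\<And>a v. v \<in> closed_bidisc \<Longrightarrow> apply_bidisc (Q a) v = (1 + cnj a * \<pi> v) / 2"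
    and away: "\<And>k. \<forall>\<^sub>F n in sequentially. \<pi> (z n) \<noteq> \<pi> ((inv.\<Phi> ^^ k) q)"
      "\<And>k. \<forall>\<^sub>F n in sequentially. \<pi> (z n) \<noteq> \<pi> ((inv.\<Phi> ^^ Suc k) (z n))"
    and tail: "\<And>\<epsilon>. \<epsilon> > 0 \<Longrightarrow> \<exists>m. (\<forall>j<m. apply_bidisc w ((inv.\<Phi> ^^ Suc j) q) \<noteq> 0) \<and> cmod (l * inv.coef l m q) < \<epsilon>"
  shows "\<not> fin_codim_range (\<lambda>x. l *\<^sub>C x - T x)"
proof (rule not_lower_of_zero[OF q z _ _ _ _ tail, where P = "\<lambda>n. Q (\<pi> (z n))"])
  have lt: "cmod (apply_bidisc (Q (\<pi> (z n))) v) < 1" if "v \<in> closed_bidisc" "\<pi> (z n) \<noteq> \<pi> v" for n v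
    unfolding Q[OF that(1)] by (rule peak_lt_1[OF \<pi>(2) \<pi>(1)[OF that(1)]]) (use that(2) in auto)
  show "norm (Q (\<pi> (z n))) \<le> 1" for n
    by (rule norm_bidisc_leI) (simp only: Q peak_le_1[OF \<pi>(2) \<pi>(1)])
  show "apply_bidisc (Q (\<pi> (z n))) (z n) = 1" for n
    unfolding Q[OF z(2)] by (rule peak_at[OF \<pi>(2)])
  show "\<forall>\<^sub>F n in sequentially. cmod (apply_bidisc (Q (\<pi> (z n))) ((inv.\<Phi> ^^ k) q)) < 1" for k
    using away(1)[of k] by eventually_elim (rule lt[OF inv.funpow_\<Phi>_bidisc[OF q(1)]])
  show "\<forall>\<^sub>F n in sequentially. cmod (apply_bidisc (Q (\<pi> (z n))) ((inv.\<Phi> ^^ Suc k) (z n))) < 1" for k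
    using away(2)[of k] by eventually_elim (rule lt[OF inv.funpow_\<Phi>_bidisc[OF z(2)]])
qed

lemma not_lower_of_zero_fst:
  assumes q: "q \<in> closed_bidisc" "apply_bidisc w q = 0" "cmod (fst q) = 1"
    and tail: "\<And>\<epsilon>. \<epsilon> > 0 \<Longrightarrow> \<exists>m. (\<forall>j<m. apply_bidisc w ((inv.\<Phi> ^^ Suc j) q) \<noteq> 0) \<and> cmod (l * inv.coef l m q) < \<epsilon>"
  shows "\<not> fin_codim_range (\<lambda>x. l *\<^sub>C x - T x)"
proof -
  obtain b where b: "\<And>n. cmod (b n) = 1" "b \<longlonglongrightarrow> fst q" "\<And>y. \<forall>\<^sub>F n in sequentially. b n \<noteq> y"
    using fst.circle_approach[OF q(3)] by blast
  have zq: "(\<lambda>n. (b n, snd q)) \<longlonglongrightarrow> q" using tendsto_Pair[OF b(2) tendsto_const[of "snd q"]] by simp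
  have ne: "\<forall>\<^sub>F n in sequentially. b n \<noteq> (\<phi>' ^^ Suc k) (b n)" for k
    using b(3)[of \<xi>]
  proof eventually_elim
    case (elim n)
    show ?case using inv.fst.funpow_p_eq_iff[OF eq_refl[OF b(1)] elim, of "Suc k"] by (metis nat.distinct(2))
  qed
  show ?thesis
    by (rule not_lower_of_zero_coordinate[OF q(1,2) zq _ _ _ apply_lift_fst[OF disc_alg_peak] _ _ tail])
      (use q(1) b(1,3) ne in \<open>auto simp: mem_Times_iff inv.funpow_\<Phi> simp del: funpow.simps\<close>)
qed

lemma not_lower_of_zero_snd:
  assumes q: "q \<in> closed_bidisc" "apply_bidisc w q = 0" "cmod (snd q) = 1"
    and tail: "\<And>\<epsilon>. \<epsilon> > 0 \<Longrightarrow> \<exists>m. (\<forall>j<m. apply_bidisc w ((inv.\<Phi> ^^ Suc j) q) \<noteq> 0) \<and> cmod (l * inv.coef l m q) < \<epsilon>"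
  shows "\<not> fin_codim_range (\<lambda>x. l *\<^sub>C x - T x)"
proof -
  obtain b where b: "\<And>n. cmod (b n) = 1" "b \<longlonglongrightarrow> snd q" "\<And>y. \<forall>\<^sub>F n in sequentially. b n \<noteq> y"
    using snd.circle_approach[OF q(3)] by blast
  have zq: "(\<lambda>n. (fst q, b n)) \<longlonglongrightarrow> q" using tendsto_Pair[OF tendsto_const[of "fst q"] b(2)] by simp
  have ne: "\<forall>\<^sub>F n in sequentially. b n \<noteq> (\<psi>' ^^ Suc k) (b n)" for k
    using b(3)[of \<zeta>]
  proof eventually_elim
    case (elim n)
    show ?case using inv.snd.funpow_p_eq_iff[OF eq_refl[OF b(1)] elim, of "Suc k"] by (metis nat.distinct(2))
  qed
  show ?thesis
    by (rule not_lower_of_zero_coordinate[OF q(1,2) zq _ _ _ apply_lift_snd[OF disc_alg_peak] _ _ tail])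
      (use q(1) b(1,3) ne in \<open>auto simp: mem_Times_iff inv.funpow_\<Phi> simp del: funpow.simps\<close>)
qed

lemma fst_orbit_circle:
  assumes "cmod (fst q) = 1" shows "cmod (fst ((inv.\<Phi> ^^ k) q)) = 1"
  using assms by (induction k) (auto simp: inv.\<Phi>_def inv.fst.p_circle)

lemma snd_orbit_circle:
  assumes "cmod (snd q) = 1" shows "cmod (snd ((inv.\<Phi> ^^ k) q)) = 1"
  using assms by (induction k) (auto simp: inv.\<Phi>_def inv.snd.p_circle)

text \<open>
  The tail condition needs weights without zeros further back, so \<open>q\<close> is replaced by the last zero on its backward orbit; the
  coordinate on the unit circle stays there.
\<close>

lemma not_lower_inner:
  assumes q: "q \<in> closed_bidisc" "apply_bidisc w q = 0" "cmod (fst q) = 1 \<or> cmod (snd q) = 1"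
    and l: "cmod l < cmod c"
  shows "\<not> fin_codim_range (\<lambda>x. l *\<^sub>C x - T x)"
proof -
  have "inv.c \<noteq> 0" using l by auto
  from inv.last_zero_on_orbit[OF q(1,2) this] obtain k where
    k: "apply_bidisc w ((inv.\<Phi> ^^ k) q) = 0"
      "\<And>j. j \<ge> 1 \<Longrightarrow> apply_bidisc w ((inv.\<Phi> ^^ j) ((inv.\<Phi> ^^ k) q)) \<noteq> 0" by blast
  let ?q = "(inv.\<Phi> ^^ k) q"
  have qc: "?q \<in> closed_bidisc" by (rule inv.funpow_\<Phi>_bidisc[OF q(1)])
  have tail: "\<exists>m. (\<forall>j<m. apply_bidisc w ((inv.\<Phi> ^^ Suc j) ?q) \<noteq> 0) \<and> cmod (l * inv.coef l m ?q) < \<epsilon>"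
    if "\<epsilon> > 0" for \<epsilon>
  proof -
    have "(\<lambda>m. l * inv.coef l m ?q) \<longlonglongrightarrow> 0" by (rule inv.coef_tail[OF qc l])
    from order_tendstoD(2)[OF tendsto_norm_zero[OF this] that] obtain m where "cmod (l * inv.coef l m ?q) < \<epsilon>"
      by (auto simp: eventually_sequentially)
    moreover have "\<forall>j<m. apply_bidisc w ((inv.\<Phi> ^^ Suc j) ?q) \<noteq> 0"
      by (intro allI impI k(2)) simp
    ultimately show ?thesis by blast
  qed
  show ?thesis
    using q(3) not_lower_of_zero_fst[OF qc k(1) fst_orbit_circle tail]
      not_lower_of_zero_snd[OF qc k(1) snd_orbit_circle tail] by blast
qed

lemma not_lower_zero:
  assumes "c = 0"
  shows "\<not> fin_codim_range (\<lambda>x. 0 *\<^sub>C x - T x)"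
  by (rule not_lower_of_zero_fst[of "(\<xi>, \<zeta>)"])
    (use assms fst.xi snd.xi in \<open>auto simp: c_def intro!: exI[of _ 0]\<close>)

section \<open>Zeros on the torus: approximate null vectors\<close>

lemma peak_power_small:
  assumes P: "\<And>z. z \<in> closed_bidisc \<Longrightarrow> cmod (apply_bidisc P z) \<le> 1"
    "\<And>z. z \<in> closed_bidisc \<Longrightarrow> z \<noteq> p \<Longrightarrow> cmod (apply_bidisc P z) < 1"
    and H: "continuous_on closed_bidisc H" "H p = 0" and p: "p \<in> closed_bidisc" and e: "e > 0"
  shows "\<forall>\<^sub>F n in sequentially. \<forall>z\<in>closed_bidisc. cmod (H z * apply_bidisc P z ^ n) \<le> e"
proof -
  have "compact (closed_bidisc :: (complex \<times> complex) set)" by (intro compact_Times compact_cball)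
  obtain d where d: "d > 0" "\<And>z. z \<in> closed_bidisc \<Longrightarrow> dist z p < d \<Longrightarrow> cmod (H z) < e"
    using H p e unfolding continuous_on_iff by (metis dist_0_norm dist_commute)
  let ?A = "closed_bidisc - ball p d"
  have cA: "compact ?A" using compact_diff[OF \<open>compact closed_bidisc\<close> open_ball] .
  obtain B where B: "\<And>z. z \<in> closed_bidisc \<Longrightarrow> cmod (H z) \<le> B"
    using compact_imp_bounded[OF compact_continuous_image[OF H(1) \<open>compact closed_bidisc\<close>]]
    by (auto simp: bounded_iff)
  have "\<exists>r. 0 \<le> r \<and> r < 1 \<and> (\<forall>z\<in>?A. cmod (apply_bidisc P z) \<le> r)"
  proof (cases "?A = {}")
    case False
    have "continuous_on ?A (\<lambda>z. cmod (apply_bidisc P z))"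
      by (intro continuous_on_norm continuous_on_subset[OF continuous_on_apply_bidisc]) auto
    from continuous_attains_sup[OF cA False this] obtain y where
      y: "y \<in> ?A" "\<And>z. z \<in> ?A \<Longrightarrow> cmod (apply_bidisc P z) \<le> cmod (apply_bidisc P y)" by blast
    moreover have "y \<noteq> p" using y(1) d(1) by auto
    ultimately show ?thesis using P(2)[of y] by (intro exI[of _ "cmod (apply_bidisc P y)"]) auto
  next
    case True
    then show ?thesis by (intro exI[of _ 0]) (simp only: ball_empty, simp)
  qed
  then obtain r where r: "0 \<le> r" "r < 1" "\<And>z. z \<in> ?A \<Longrightarrow> cmod (apply_bidisc P z) \<le> r" by blast
  have "(\<lambda>n. B * r ^ n) \<longlonglongrightarrow> 0" using r by (intro tendsto_mult_right_zero LIMSEQ_power_zero) auto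
  from order_tendstoD(2)[OF this e] show ?thesis
  proof eventually_elim
    case (elim n)
    show ?case
    proof
      fix z assume z: "z \<in> closed_bidisc"
      show "cmod (H z * apply_bidisc P z ^ n) \<le> e"
      proof (cases "dist z p < d")
        case True
        have "cmod (H z) * cmod (apply_bidisc P z) ^ n \<le> e * 1"
          using d(2)[OF z True] P(1)[OF z] e by (intro mult_mono power_le_one) auto
        then show ?thesis by (simp add: norm_mult norm_power)
      next
        case False
        then have "z \<in> ?A" using z by (simp add: dist_commute)
        then have "cmod (H z) * cmod (apply_bidisc P z) ^ n \<le> B * r ^ n"
          using B[OF z] r(1,3) by (intro mult_mono power_mono) (auto intro: order_trans[OF norm_ge_zero])
        then show ?thesis using elim by (simp add: norm_mult norm_power)
      qed
    qed
  qed
qed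

lemma torus_peak:
  assumes p: "p \<in> torus"
  shows "\<exists>P. apply_bidisc P p = 1 \<and> (\<forall>z\<in>closed_bidisc. cmod (apply_bidisc P z) \<le> 1) \<and>
    (\<forall>z\<in>closed_bidisc. z \<noteq> p \<longrightarrow> cmod (apply_bidisc P z) < 1)"
proof -
  obtain a b where ab: "p = (a, b)" "cmod a = 1" "cmod b = 1" using p by auto
  define P where "P = of_bidisc_fun (\<lambda>v. (1 + cnj a * fst v) / 2) * of_bidisc_fun (\<lambda>v. (1 + cnj b * snd v) / 2)"
  have P: "apply_bidisc P (x, y) = (1 + cnj a * x) / 2 * ((1 + cnj b * y) / 2)" if "(x, y) \<in> closed_bidisc" for x y
    unfolding P_def apply_bidisc_simps(6)[OF that] apply_lift_fst[OF disc_alg_peak that] apply_lift_snd[OF disc_alg_peak that]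
    by simp
  have "cmod (apply_bidisc P (x, y)) \<le> 1 \<and> ((x, y) \<noteq> p \<longrightarrow> cmod (apply_bidisc P (x, y)) < 1)"
    if xy: "(x, y) \<in> closed_bidisc" for x y
  proof -
    have x: "cmod x \<le> 1" and y: "cmod y \<le> 1" using xy by auto
    let ?s = "cmod ((1 + cnj a * x) / 2)" and ?t = "cmod ((1 + cnj b * y) / 2)"
    have le: "?s \<le> 1" "?t \<le> 1" by (intro peak_le_1 ab x y)+
    have lt: "?s < 1 \<or> ?t < 1" if "(x, y) \<noteq> p"
      using that peak_lt_1[OF ab(2) x] peak_lt_1[OF ab(3) y] ab(1) by auto
    have st: "cmod (apply_bidisc P (x, y)) = ?s * ?t" unfolding P[OF xy] norm_mult ..
    have "?s * ?t \<le> ?s * 1" "?s * ?t \<le> 1 * ?t" using le by (intro mult_left_mono mult_right_mono; simp)+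
    then have st': "?s * ?t \<le> ?s" "?s * ?t \<le> ?t" by (simp_all only: mult_1 mult_1_right)
    show ?thesis
      unfolding st
    proof (intro conjI impI)
      show "?s * ?t \<le> 1" using st'(1) le(1) by (rule order_trans)
      show "?s * ?t < 1" if "(x, y) \<noteq> p" using lt[OF that] st' by (meson le_less_trans)
    qed
  qed
  moreover have "apply_bidisc P p = 1" using P[of a b] ab peak_at by simp
  ultimately show ?thesis by (intro exI[of _ P]) auto
qed

text \<open>
  With \<open>q\<close> the last zero on the forward orbit, the vector is the sum of \<open>coef l k q\<close> times a power of a peak function moved to
  \<open>\<Phi> ^ (k + 1) q\<close>. The operator \<open>T\<close> moves each peak one step back and multiplies it by a weight that is nearly
  constant on it; so \<open>l - T\<close> leaves the last term, where the coefficient is small, and the first peak moved to \<open>q\<close>, where the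
  weight vanishes. High powers of the peak function vanish pointwise on the open bidisc.
\<close>

lemma not_upper_inner:
  assumes q0: "q0 \<in> torus" "apply_bidisc w q0 = 0" and l: "cmod l < cmod c"
  shows "\<not> upper_semi_Fredholm (\<lambda>x. l *\<^sub>C x - T x)"
proof -
  have c0: "c \<noteq> 0" using l by auto
  have "q0 \<in> closed_bidisc" using q0(1) by auto
  from last_zero_on_orbit[OF this q0(2) c0] obtain k where
    k: "apply_bidisc w ((\<Phi> ^^ k) q0) = 0"
      "\<And>j. j \<ge> 1 \<Longrightarrow> apply_bidisc w ((\<Phi> ^^ j) ((\<Phi> ^^ k) q0)) \<noteq> 0" by blast
  define q where "q = (\<Phi> ^^ k) q0"
  have qt: "q \<in> torus" unfolding q_def by (rule funpow_\<Phi>_torus[OF q0(1)])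
  then have qc: "q \<in> closed_bidisc" by auto
  have wq: "apply_bidisc w q = 0" using k(1) by (simp add: q_def)
  have wj: "apply_bidisc w ((\<Phi> ^^ Suc j) q) \<noteq> 0" for j using k(2)[of "Suc j"] by (simp add: q_def)
  define p where "p = \<Phi> q"
  have pt: "p \<in> torus" unfolding p_def by (rule \<Phi>_torus[OF qt])
  then have pc: "p \<in> closed_bidisc" by auto
  have pk: "(\<Phi> ^^ k) p = (\<Phi> ^^ Suc k) q" for k by (simp add: p_def funpow_swap1)
  obtain P where P: "apply_bidisc P p = 1" "\<And>z. z \<in> closed_bidisc \<Longrightarrow> cmod (apply_bidisc P z) \<le> 1"
    "\<And>z. z \<in> closed_bidisc \<Longrightarrow> z \<noteq> p \<Longrightarrow> cmod (apply_bidisc P z) < 1" using torus_peak[OF pt] by blast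
  \<comment> \<open>Only the common fixed point, where the weight \<open>c\<close> is not zero, is periodic; hence only the first peak is felt at \<open>p\<close>.\<close>
  have back_ne: "(inv.\<Phi> ^^ Suc k) p \<noteq> p" for k
  proof
    assume eq: "(inv.\<Phi> ^^ Suc k) p = p"
    have "q \<noteq> (\<xi>, \<zeta>)" using wq c0 by (auto simp: c_def)
    then have "fst q \<noteq> \<xi> \<or> snd q \<noteq> \<zeta>" by (auto simp: prod_eq_iff)
    then have "fst p \<noteq> \<xi> \<or> snd p \<noteq> \<zeta>"
      using qc by (auto simp: p_def \<Phi>_def mem_Times_iff fst.p_eq_xi_iff snd.p_eq_xi_iff)
    moreover have "cmod (fst p) \<le> 1" "cmod (snd p) \<le> 1" using pc by (auto simp: mem_Times_iff)
    moreover have "(\<phi>' ^^ Suc k) (fst p) = fst p" "(\<psi>' ^^ Suc k) (snd p) = snd p"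
      using eq unfolding inv.funpow_\<Phi> by (metis fst_conv snd_conv)+
    ultimately show False
      using inv.fst.funpow_p_eq_iff[of "fst p" "Suc k"] inv.snd.funpow_p_eq_iff[of "snd p" "Suc k"] by blast
  qed
  \<comment> \<open>Weight \<open>1\<close> turns the operator into composition with the inverse map, which moves the peaks.\<close>
  interpret one: bidisc_weighted_map \<phi>' \<phi> \<xi> "- \<alpha>" \<psi>' \<psi> \<zeta> "- \<beta>" 1
    by (intro bidisc_weighted_map.intro fst.inverse_map snd.inverse_map)
  have one_W: "one.W n z = 1" if "z \<in> closed_bidisc" for n z
    unfolding one.W_def using apply_bidisc_simps(2)[OF one.funpow_\<Phi>_bidisc[OF that]] by simp
  define E where "E n k = (one.T ^^ k) (P ^ n)" for n k
  have E: "apply_bidisc (E n k) z = apply_bidisc P ((inv.\<Phi> ^^ k) z) ^ n" if "z \<in> closed_bidisc" for n k z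
    unfolding E_def one.apply_funpow_T[OF that] one_W[OF that]
    using apply_bidisc_power[OF inv.funpow_\<Phi>_bidisc[OF that]] by simp
  have Ele: "norm (E n k) \<le> 1" for n k
  proof (rule norm_bidisc_leI)
    fix z assume z: "z \<in> closed_bidisc"
    show "cmod (apply_bidisc (E n k) z) \<le> 1"
      unfolding E[OF z] norm_power by (intro power_le_one P(2) inv.funpow_\<Phi>_bidisc z) simp
  qed
  let ?b = "\<lambda>k. coef l k q"
  define x where "x m n = (\<Sum>k\<le>m. ?b k *\<^sub>C E n k)" for m n
  have apply_sum: "apply_bidisc (\<Sum>k\<in>I. f k) z = (\<Sum>k\<in>I. apply_bidisc (f k) z)" if "z \<in> closed_bidisc"
    for f :: "nat \<Rightarrow> bidisc_alg" and I z
  proof -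
    have "linear (\<lambda>f. apply_bidisc f z)"
      using clinear_functional_apply[OF that] bounded_linear.linear unfolding clinear_functional_def by blast
    then show ?thesis by (rule linear_sum)
  qed
  have x: "apply_bidisc (x m n) z = (\<Sum>k\<le>m. ?b k * apply_bidisc P ((inv.\<Phi> ^^ k) z) ^ n)" if "z \<in> closed_bidisc" for m n z
    unfolding x_def apply_sum[OF that] apply_bidisc_scaleC[OF that] E[OF that] ..
  have residual: "apply_bidisc (l *\<^sub>C x m n - T (x m n)) z =
      l * ?b m * apply_bidisc P ((inv.\<Phi> ^^ m) z) ^ n - apply_bidisc w z * apply_bidisc P (\<Phi> z) ^ n
      - (\<Sum>k<m. ?b (Suc k) * (apply_bidisc w z - apply_bidisc w ((\<Phi> ^^ Suc k) q)) * apply_bidisc P ((inv.\<Phi> ^^ k) z) ^ n)"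
    if z: "z \<in> closed_bidisc" for m n z
  proof -
    let ?e = "\<lambda>k. apply_bidisc P ((inv.\<Phi> ^^ k) z) ^ n" and ?w = "apply_bidisc w z"
    have inv_Suc: "(inv.\<Phi> ^^ Suc k) (\<Phi> z) = (inv.\<Phi> ^^ k) z" for k
      using \<Phi>_inv(2)[OF z] by (simp add: funpow_swap1)
    have "apply_bidisc (T (x m n)) z = ?w * (\<Sum>k\<le>m. ?b k * apply_bidisc P ((inv.\<Phi> ^^ k) (\<Phi> z)) ^ n)"
      unfolding apply_T[OF z] x[OF \<Phi>_bidisc[OF z]] ..
    also have "\<dots> = ?w * (apply_bidisc P (\<Phi> z) ^ n + (\<Sum>k<m. ?b (Suc k) * ?e k))"
      unfolding sum.atMost_shift inv_Suc by simp
    finally have Tx: "apply_bidisc (T (x m n)) z = ?w * apply_bidisc P (\<Phi> z) ^ n + (\<Sum>k<m. ?b (Suc k) * ?w * ?e k)"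
      by (simp add: distrib_left sum_distrib_left mult_ac)
    have "l * apply_bidisc (x m n) z = l * ?b m * ?e m + (\<Sum>k<m. l * ?b k * ?e k)"
      unfolding x[OF z] by (simp add: lessThan_Suc_atMost[symmetric] distrib_left sum_distrib_left mult_ac)
    also have "(\<Sum>k<m. l * ?b k * ?e k) = (\<Sum>k<m. ?b (Suc k) * apply_bidisc w ((\<Phi> ^^ Suc k) q) * ?e k)"
    proof (rule sum.cong[OF refl])
      fix k
      have "?b (Suc k) * apply_bidisc w ((\<Phi> ^^ Suc k) q) = l * ?b k"
        using wj[of k] by (simp add: coef_Suc)
      then show "l * ?b k * ?e k = ?b (Suc k) * apply_bidisc w ((\<Phi> ^^ Suc k) q) * ?e k" by simp
    qed
    finally have lx: "l * apply_bidisc (x m n) z = l * ?b m * ?e m + (\<Sum>k<m. ?b (Suc k) * apply_bidisc w ((\<Phi> ^^ Suc k) q) * ?e k)" .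
    have "(\<Sum>k<m. ?b (Suc k) * (?w - apply_bidisc w ((\<Phi> ^^ Suc k) q)) * ?e k) =
        (\<Sum>k<m. ?b (Suc k) * ?w * ?e k) - (\<Sum>k<m. ?b (Suc k) * apply_bidisc w ((\<Phi> ^^ Suc k) q) * ?e k)"
      unfolding sum_subtractf[symmetric] by (rule sum.cong) (simp_all add: algebra_simps)
    then show ?thesis
      unfolding apply_bidisc_simps(4)[OF z] apply_bidisc_scaleC[OF z] lx Tx by simp
  qed
  show ?thesis
  proof (rule not_upper_semi_Fredholm_bidisc[where d = "1/2"])
    show "bounded_clinear (\<lambda>x. l *\<^sub>C x - T x)" by (intro bounded_clinear_resolvent bounded_clinear_T)
    fix \<epsilon> :: real assume e: "\<epsilon> > 0"
    have "(\<lambda>m. l * ?b m) \<longlonglongrightarrow> 0" by (rule coef_tail[OF qc l])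
    from order_tendstoD(2)[OF tendsto_norm_zero[OF this], of "\<epsilon> / 3"] e
    obtain m where m: "cmod (l * ?b m) < \<epsilon> / 3" by (auto simp: eventually_sequentially)
    define \<delta> where "\<delta> = \<epsilon> / (3 * real (Suc m))"
    have de: "\<delta> > 0" using e by (simp add: \<delta>_def)
    have evw: "\<forall>\<^sub>F n in sequentially. \<forall>y\<in>closed_bidisc. cmod (apply_bidisc w (inv.\<Phi> y) * apply_bidisc P y ^ n) \<le> \<epsilon> / 3"
    proof (rule peak_power_small[OF P(2,3) _ _ pc])
      show "continuous_on closed_bidisc (\<lambda>y. apply_bidisc w (inv.\<Phi> y))"
        using inv.continuous_on_apply_orbit[of w 1] by simp
      show "apply_bidisc w (inv.\<Phi> p) = 0" using wq \<Phi>_inv(2)[OF qc] by (simp add: p_def)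
    qed (use e in auto)
    have evk: "\<forall>\<^sub>F n in sequentially. \<forall>k\<in>{..<m}. \<forall>y\<in>closed_bidisc.
        cmod (?b (Suc k) * (apply_bidisc w ((\<Phi> ^^ k) y) - apply_bidisc w ((\<Phi> ^^ Suc k) q)) * apply_bidisc P y ^ n) \<le> \<delta>"
    proof (rule eventually_ball_finite, simp, rule ballI)
      fix k
      show "\<forall>\<^sub>F n in sequentially. \<forall>y\<in>closed_bidisc.
          cmod (?b (Suc k) * (apply_bidisc w ((\<Phi> ^^ k) y) - apply_bidisc w ((\<Phi> ^^ Suc k) q)) * apply_bidisc P y ^ n) \<le> \<delta>"
      proof (rule peak_power_small[OF P(2,3) _ _ pc])
        show "continuous_on closed_bidisc (\<lambda>y. ?b (Suc k) * (apply_bidisc w ((\<Phi> ^^ k) y) - apply_bidisc w ((\<Phi> ^^ Suc k) q)))"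
          by (intro continuous_intros continuous_on_apply_orbit)
      qed (use de pk in auto)
    qed
    have evp: "\<forall>\<^sub>F n in sequentially. 1 / 2 \<le> norm (x m n)"
    proof -
      have "(\<lambda>n. \<Sum>k<m. ?b (Suc k) * apply_bidisc P ((inv.\<Phi> ^^ Suc k) p) ^ n) \<longlonglongrightarrow> 0"
        by (intro tendsto_null_sum tendsto_mult_right_zero LIMSEQ_power_zero P(3) inv.funpow_\<Phi>_bidisc pc back_ne)
      then have "(\<lambda>n. 1 + (\<Sum>k<m. ?b (Suc k) * apply_bidisc P ((inv.\<Phi> ^^ Suc k) p) ^ n)) \<longlonglongrightarrow> 1 + 0"
        by (intro tendsto_add tendsto_const)
      moreover have "apply_bidisc (x m n) p = 1 + (\<Sum>k<m. ?b (Suc k) * apply_bidisc P ((inv.\<Phi> ^^ Suc k) p) ^ n)" for n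
        unfolding x[OF pc] sum.atMost_shift using P(1) by simp
      ultimately have "(\<lambda>n. apply_bidisc (x m n) p) \<longlonglongrightarrow> 1" by simp
      from order_tendstoD(1)[OF tendsto_norm[OF this], of "1/2"]
      have "\<forall>\<^sub>F n in sequentially. 1 / 2 < cmod (apply_bidisc (x m n) p)" by simp
      then show ?thesis by eventually_elim (use norm_apply_bidisc_le[OF pc] in \<open>meson less_imp_le order_trans\<close>)
    qed
    have evr: "\<forall>\<^sub>F n in sequentially. norm (l *\<^sub>C x m n - T (x m n)) \<le> \<epsilon>"
      using evw evk
    proof eventually_elim
      case (elim n)
      show ?case
      proof (rule norm_bidisc_leI)
        fix z assume z: "z \<in> closed_bidisc"
        let ?A = "l * ?b m * apply_bidisc P ((inv.\<Phi> ^^ m) z) ^ n"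
        let ?B = "apply_bidisc w z * apply_bidisc P (\<Phi> z) ^ n"
        let ?C = "\<lambda>k. ?b (Suc k) * (apply_bidisc w z - apply_bidisc w ((\<Phi> ^^ Suc k) q)) * apply_bidisc P ((inv.\<Phi> ^^ k) z) ^ n"
        have A: "cmod ?A \<le> \<epsilon> / 3"
        proof -
          have "cmod (l * ?b m) * cmod (apply_bidisc P ((inv.\<Phi> ^^ m) z)) ^ n \<le> \<epsilon> / 3 * 1"
            using m e by (intro mult_mono power_le_one P(2) inv.funpow_\<Phi>_bidisc z) auto
          then show ?thesis by (simp add: norm_mult norm_power)
        qed
        have B: "cmod ?B \<le> \<epsilon> / 3"
          using elim(1) \<Phi>_bidisc[OF z] \<Phi>_inv(2)[OF z] by metis
        have C: "cmod (?C k) \<le> \<delta>" if "k < m" for k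
        proof -
          have "(inv.\<Phi> ^^ k) z \<in> closed_bidisc" by (rule inv.funpow_\<Phi>_bidisc[OF z])
          with elim(2) that funpow_\<Phi>_inv[OF z, of k] show ?thesis by (metis lessThan_iff)
        qed
        have "cmod (\<Sum>k<m. ?C k) \<le> real m * \<delta>"
          using sum_norm_bound[of "{..<m}" ?C \<delta>] C by simp
        also have "\<dots> \<le> real (Suc m) * \<delta>" using de by (intro mult_right_mono) auto
        also have "\<dots> = \<epsilon> / 3" by (simp add: \<delta>_def del: of_nat_Suc)
        finally have S: "cmod (\<Sum>k<m. ?C k) \<le> \<epsilon> / 3" .
        show "cmod (apply_bidisc (l *\<^sub>C x m n - T (x m n)) z) \<le> \<epsilon>"
          unfolding residual[OF z]
          using A B S norm_triangle_ineq4[of "?A - ?B" "\<Sum>k<m. ?C k"] norm_triangle_ineq4[of ?A ?B] by linarith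
      qed
    qed
    have bdd: "bounded (range (x m))"
    proof -
      have "norm (x m n) \<le> (\<Sum>k\<le>m. cmod (?b k))" for n
        unfolding x_def
      proof (rule order_trans[OF norm_sum sum_mono])
        fix k
        show "norm (?b k *\<^sub>C E n k) \<le> cmod (?b k)"
          unfolding norm_scaleC using mult_left_mono[OF Ele, of "cmod (?b k)" n k] by simp
      qed
      then show ?thesis unfolding bounded_iff by blast
    qed
    have pw: "(\<lambda>n. apply_bidisc (x m n) z) \<longlonglongrightarrow> 0" if "z \<in> open_bidisc" for z
    proof -
      have zc: "z \<in> closed_bidisc" using that by auto
      have "cmod (apply_bidisc P ((inv.\<Phi> ^^ k) z)) < 1" for k
      proof (rule P(3)[OF inv.funpow_\<Phi>_bidisc[OF zc]])
        have "cmod ((\<phi>' ^^ k) (fst z)) < 1"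
          using that by (induction k) (auto simp: mem_Times_iff fst.q_lt_1)
        then show "(inv.\<Phi> ^^ k) z \<noteq> p" using pt by (auto simp: inv.funpow_\<Phi>)
      qed
      then show ?thesis
        unfolding x[OF zc] by (intro tendsto_null_sum tendsto_mult_right_zero LIMSEQ_power_zero)
    qed
    show "\<exists>x. bounded (range x) \<and> (\<forall>z\<in>open_bidisc. (\<lambda>n. apply_bidisc (x n) z) \<longlonglongrightarrow> 0) \<and>
        (\<forall>\<^sub>F n in sequentially. 1 / 2 \<le> norm (x n) \<and> norm (l *\<^sub>C x n - T (x n)) \<le> \<epsilon>)"
      using bdd pw eventually_conj[OF evp evr] by blast
  qed simp
qed

end

section \<open>Zeros reach the boundary\<close>

text \<open>
  Otherwise choose a zero \<open>(a, b)\<close> with \<open>\<bar>b\<bar>\<close> maximal, so that \<open>\<bar>b\<bar> < 1\<close>. For slightly larger \<open>\<bar>b'\<bar>\<close> the slice of \<open>w\<close> at height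
  \<open>b'\<close> has no zero, and the maximum principle for its reciprocal bounds \<open>\<bar>w (a, b')\<bar>\<close> below by the minimum over
  \<open>\<bar>z1\<bar> = 1\<close>, a bound that does not depend on \<open>b'\<close>. This contradicts continuity at \<open>(a, b)\<close>.
\<close>
lemma zero_reaches_boundary:
  assumes z: "z \<in> closed_bidisc" "apply_bidisc w z = 0"
  shows "\<exists>q\<in>closed_bidisc. apply_bidisc w q = 0 \<and> (cmod (fst q) = 1 \<or> cmod (snd q) = 1)"
proof (rule ccontr)
  assume neg: "\<not> ?thesis"
  let ?w = "apply_bidisc w"
  have nz: "?w (a, b) \<noteq> 0" if "cmod a = 1 \<and> cmod b \<le> 1 \<or> cmod a \<le> 1 \<and> cmod b = 1" for a b
  proof -
    have "(a, b) \<in> closed_bidisc" "cmod (fst (a, b)) = 1 \<or> cmod (snd (a, b)) = 1" using that by auto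
    then show ?thesis using neg by blast
  qed
  let ?Z = "{v \<in> closed_bidisc. ?w v = 0}"
  have cbd: "compact (closed_bidisc :: (complex \<times> complex) set)" by (intro compact_Times compact_cball)
  have "closed ?Z"
    using continuous_closed_preimage_constant[OF continuous_on_apply_bidisc compact_imp_closed[OF cbd], of w 0] .
  then have "compact ?Z" using compact_Int_closed[OF cbd, of ?Z] by (simp add: Int_absorb1 Collect_subset Int_def) 
  moreover have "?Z \<noteq> {}" using z by blast
  moreover have "continuous_on ?Z (\<lambda>v. cmod (snd v))" by (intro continuous_intros)
  ultimately obtain y where y: "y \<in> ?Z" "\<And>v. v \<in> ?Z \<Longrightarrow> cmod (snd v) \<le> cmod (snd y)"
    using continuous_attains_sup by (metis (no_types, lifting))
  define a b where "a = fst y" and "b = snd y"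
  have ab: "cmod a \<le> 1" "cmod b \<le> 1" "?w (a, b) = 0" using y(1) by (auto simp: a_def b_def mem_Times_iff)
  have b1: "cmod b < 1" using nz[of a b] ab by fastforce
  have "compact (sphere 0 1 \<times> cball 0 1 :: (complex \<times> complex) set)" "sphere 0 1 \<times> cball 0 1 \<noteq> ({} :: (complex \<times> complex) set)"
    by (auto intro!: compact_Times)
  moreover have "continuous_on (sphere 0 1 \<times> cball 0 1) (\<lambda>v. cmod (?w v))"
    by (intro continuous_on_norm continuous_on_subset[OF continuous_on_apply_bidisc]) auto
  ultimately obtain u where u: "u \<in> sphere 0 1 \<times> cball 0 1" "\<And>v. v \<in> sphere 0 1 \<times> cball 0 1 \<Longrightarrow> cmod (?w u) \<le> cmod (?w v)"
    using continuous_attains_inf by (metis (no_types, lifting))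
  define d where "d = cmod (?w u)"
  have d0: "d > 0" using u(1) nz[of "fst u" "snd u"] by (auto simp: d_def mem_Times_iff)
  have far: "d \<le> cmod (?w (a, b'))" if b': "cmod b < cmod b'" "cmod b' \<le> 1" for b'
  proof -
    have nzb: "?w (v, b') \<noteq> 0" if "cmod v \<le> 1" for v
      using y(2)[of "(v, b')"] that b' by (auto simp: b_def)
    have "disc_alg (\<lambda>v. 1 / ?w (v, b'))"
      by (intro disc_alg_divide disc_alg_const disc_alg_slice_fst b' nzb)
    moreover have "cmod (1 / ?w (v, b')) \<le> 1 / d" if "cmod v = 1" for v
      using u(2)[of "(v, b')"] that b' d0 by (auto simp: d_def norm_divide intro!: frac_le)
    ultimately have "cmod (1 / ?w (a, b')) \<le> 1 / d" using ab(1) by (rule disc_alg_max_modulus)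
    then show ?thesis using d0 nzb[OF ab(1)] by (simp add: norm_divide field_simps)
  qed
  obtain e where e: "e > 0" "\<And>v. v \<in> closed_bidisc \<Longrightarrow> dist v (a, b) < e \<Longrightarrow> cmod (?w v) < d"
  proof -
    have "(a, b) \<in> closed_bidisc" using ab by simp
    then have "\<exists>e>0. \<forall>v\<in>closed_bidisc. dist v (a, b) < e \<longrightarrow> dist (?w v) (?w (a, b)) < d"
      using continuous_on_apply_bidisc[of w] d0 unfolding continuous_on_iff by blast
    then show ?thesis using ab(3) that by (auto simp: dist_norm)
  qed
  define r where "r = min (e / 2) ((1 - cmod b) / 2)"
  have r: "r > 0" "r < e" "cmod b + r \<le> 1" using e(1) b1 by (auto simp: r_def min_def field_simps)
  \<comment> \<open>a point beyond \<open>b\<close> at distance \<open>r\<close> in the direction of \<open>b\<close>, or in any direction if \<open>b = 0\<close>\<close>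
  define b' where "b' = (if b = 0 then of_real r else b + of_real (r / cmod b) * b)"
  have "cmod b' = cmod b + r" 
  proof (cases "b = 0")
    case False
    have "b' = of_real (1 + r / cmod b) * b" using False by (simp add: b'_def algebra_simps)
    then have "cmod b' = \<bar>1 + r / cmod b\<bar> * cmod b" by (simp only: norm_mult norm_of_real)
    also have "\<dots> = cmod b + r" using False r(1) by (simp add: abs_of_pos add_pos_pos field_simps)
    finally show ?thesis .
  qed (use r in \<open>simp add: b'_def\<close>)
  moreover have "dist (a, b') (a, b) = r"
    using r(1) by (auto simp: dist_Pair_Pair dist_norm b'_def norm_mult norm_divide)
  ultimately have "d \<le> cmod (?w (a, b'))" "cmod (?w (a, b')) < d"
    using r ab(1) by (auto intro!: far e(2))
  then show False by simp
qed

section \<open>The spectra\<close>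

lemma image_mult_sphere: "(\<lambda>z. c * z) ` sphere 0 1 = {l. cmod l = cmod (c :: complex)}"
proof (cases "c = 0")
  case True
  moreover have "\<exists>x. cmod x = 1" by (rule exI[of _ 1]) simp
  ultimately show ?thesis by (auto simp: image_iff)
next
  case False
  have "l \<in> (\<lambda>z. c * z) ` sphere 0 1" if "cmod l = cmod c" for l
    by (rule image_eqI[of _ _ "l / c"]) (use False that in \<open>auto simp: norm_divide\<close>)
  then show ?thesis by (auto simp: norm_mult)
qed

lemma image_mult_cball: "(\<lambda>z. c * z) ` cball 0 1 = {l. cmod l \<le> cmod (c :: complex)}"
proof (cases "c = 0")
  case True
  moreover have "\<exists>x. cmod x \<le> 1" by (rule exI[of _ 0]) simp
  ultimately show ?thesis by (auto simp: image_iff)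
next
  case False
  have "l \<in> (\<lambda>z. c * z) ` cball 0 1" if "cmod l \<le> cmod c" for l
    by (rule image_eqI[of _ _ "l / c"]) (use False that in \<open>auto simp: norm_divide\<close>)
  then show ?thesis by (auto simp: norm_mult mult_left_le)
qed

context bidisc_weighted_map
begin

lemma outer_regular:
  assumes "cmod c < cmod l"
  shows "l \<notin> op_spectrum T" "l \<notin> sf_spectrum T" "l \<notin> lsf_spectrum T" "l \<notin> ap_spectrum T"
proof -
  note inv = resolvent_outer[OF assms]
  show "l \<notin> op_spectrum T" using inv by (simp add: op_spectrum_def)
  show "l \<notin> sf_spectrum T" "l \<notin> lsf_spectrum T"
    using invertible_imp_lower[OF inv] by (simp_all add: sf_spectrum_def lsf_spectrum_def semi_Fredholm_def)
  show "l \<notin> ap_spectrum T"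
    using invertible_imp_bounded_below[OF inv] ap_spectrum_bounded_below by blast
qed

lemma singular_of_not_lower:
  assumes "\<not> fin_codim_range (\<lambda>x. l *\<^sub>C x - T x)"
  shows "l \<in> op_spectrum T" "l \<in> lsf_spectrum T"
    "\<not> upper_semi_Fredholm (\<lambda>x. l *\<^sub>C x - T x) \<Longrightarrow> l \<in> sf_spectrum T"
  using assms invertible_imp_lower[of "\<lambda>x. l *\<^sub>C x - T x"]
  by (auto simp: op_spectrum_def lsf_spectrum_def sf_spectrum_def semi_Fredholm_def lower_semi_Fredholm_def)

lemma circle_not_lower: "cmod l = cmod c \<Longrightarrow> \<not> fin_codim_range (\<lambda>x. l *\<^sub>C x - T x)"
  using not_lower_circle[of l] not_lower_zero by (cases "c = 0") auto

lemma circle_singular: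
  assumes "cmod l = cmod c"
  shows "l \<in> op_spectrum T" "l \<in> lsf_spectrum T" "l \<in> sf_spectrum T"
  using singular_of_not_lower[OF circle_not_lower[OF assms]] not_upper_circle[OF assms] by auto

lemma spectra_unit:
  assumes "w dvd 1"
  shows "op_spectrum T = {l. cmod l = cmod c}" "sf_spectrum T = {l. cmod l = cmod c}"
proof -
  have "l \<notin> op_spectrum T \<and> l \<notin> sf_spectrum T" if "cmod l < cmod c" for l
    using resolvent_inner_invertible[OF assms that] invertible_imp_lower
    by (auto simp: op_spectrum_def sf_spectrum_def semi_Fredholm_def)
  then show "op_spectrum T = {l. cmod l = cmod c}" "sf_spectrum T = {l. cmod l = cmod c}"
    using outer_regular circle_singular by (auto simp: set_eq_iff) (metis linorder_neqE)+
qed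

lemma spectra_torus_zero:
  assumes "\<not> invertible_on_torus w"
  shows "op_spectrum T = {l. cmod l \<le> cmod c}" "sf_spectrum T = {l. cmod l \<le> cmod c}"
proof -
  obtain q where q: "q \<in> torus" "apply_bidisc w q = 0" using assms by (auto simp: invertible_on_torus_iff)
  have "l \<in> op_spectrum T \<and> l \<in> sf_spectrum T" if "cmod l < cmod c" for l
  proof -
    have "\<not> fin_codim_range (\<lambda>x. l *\<^sub>C x - T x)" by (rule not_lower_inner[of q]) (use q that in auto)
    then show ?thesis using singular_of_not_lower not_upper_inner[OF q that] by blast
  qed
  then show "op_spectrum T = {l. cmod l \<le> cmod c}" "sf_spectrum T = {l. cmod l \<le> cmod c}"
    using outer_regular circle_singular by (auto simp: set_eq_iff le_less) (metis linorder_neqE)+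
qed

lemma spectra_interior_zero:
  assumes "\<not> w dvd 1" "invertible_on_torus w"
  shows "ap_spectrum T = {l. cmod l = cmod c}" "sf_spectrum T = {l. cmod l = cmod c}"
    "op_spectrum T = {l. cmod l \<le> cmod c}" "lsf_spectrum T = {l. cmod l \<le> cmod c}"
proof -
  obtain v where "v \<in> closed_bidisc" "apply_bidisc w v = 0" using assms(1) unfolding bidisc_unit_iff by blast
  from zero_reaches_boundary[OF this] obtain q where
    q: "q \<in> closed_bidisc" "apply_bidisc w q = 0" "cmod (fst q) = 1 \<or> cmod (snd q) = 1" by blast
  have low: "l \<in> op_spectrum T \<and> l \<in> lsf_spectrum T" if "cmod l < cmod c" for l
    using singular_of_not_lower(1,2)[OF not_lower_inner[OF q that]] by blast
  have up: "l \<notin> ap_spectrum T \<and> l \<notin> sf_spectrum T" if l: "cmod l < cmod c" for l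
  proof -
    have nz: "apply_bidisc w z \<noteq> 0" if "z \<in> torus" for z
      using assms(2) that unfolding invertible_on_torus_iff by blast
    obtain e where e: "e > 0" "\<And>x. e * norm x \<le> norm (l *\<^sub>C x - T x)"
      using resolvent_inner_bounded_below[OF nz l] by blast
    have "upper_semi_Fredholm (\<lambda>x. l *\<^sub>C x - T x)"
      by (rule bounded_below_imp_upper[OF bounded_clinear_resolvent[OF bounded_clinear_T] e])
    then show ?thesis using ap_spectrum_bounded_below[OF e] by (auto simp: sf_spectrum_def semi_Fredholm_def)
  qed
  show "ap_spectrum T = {l. cmod l = cmod c}" "sf_spectrum T = {l. cmod l = cmod c}"
    using outer_regular circle_singular circle_subset_ap_spectrum up by (auto simp: set_eq_iff) (metis linorder_neqE)+
  show "op_spectrum T = {l. cmod l \<le> cmod c}" "lsf_spectrum T = {l. cmod l \<le> cmod c}"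
    using outer_regular circle_singular low by (auto simp: set_eq_iff le_less) (metis linorder_neqE)+
qed

end

theorem proposition4p8:
  fixes \<phi> \<psi> :: "complex \<Rightarrow> complex" and \<xi> \<zeta> c :: complex
    and w :: bidisc_alg and T :: "bidisc_alg \<Rightarrow> bidisc_alg"
  assumes "parabolic_moebius \<phi>" and "parabolic_moebius \<psi>"
    and "\<xi> \<in> cball 0 1" and "\<phi> \<xi> = \<xi>"
    and "\<zeta> \<in> cball 0 1" and "\<psi> \<zeta> = \<zeta>"
    and "T = weighted_comp w (\<lambda>(z\<^sub>1, z\<^sub>2). (\<phi> z\<^sub>1, \<psi> z\<^sub>2))"
    and "c = apply_bidisc w (\<xi>, \<zeta>)"
  shows "(w dvd 1 \<longrightarrow>
           op_spectrum T = (\<lambda>z. c * z) ` sphere 0 1 \<and>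
           sf_spectrum T = (\<lambda>z. c * z) ` sphere 0 1) \<and>
         (\<not> invertible_on_torus w \<longrightarrow>
           op_spectrum T = (\<lambda>z. c * z) ` cball 0 1 \<and>
           sf_spectrum T = (\<lambda>z. c * z) ` cball 0 1) \<and>
         (\<not> w dvd 1 \<and> invertible_on_torus w \<longrightarrow>
           ap_spectrum T = (\<lambda>z. c * z) ` sphere 0 1 \<and>
           sf_spectrum T = (\<lambda>z. c * z) ` sphere 0 1 \<and>
           op_spectrum T = (\<lambda>z. c * z) ` cball 0 1 \<and>
           lsf_spectrum T = (\<lambda>z. c * z) ` cball 0 1)"
proof -
  obtain \<phi>' \<alpha> where 1: "parabolic_disc_map \<phi> \<phi>' \<xi> \<alpha>"
    using parabolic_moebius_normal_form[OF assms(1,3,4)] by blast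
  obtain \<psi>' \<beta> where 2: "parabolic_disc_map \<psi> \<psi>' \<zeta> \<beta>"
    using parabolic_moebius_normal_form[OF assms(2,5,6)] by blast
  interpret op: bidisc_weighted_map \<phi> \<phi>' \<xi> \<alpha> \<psi> \<psi>' \<zeta> \<beta> w
    by (intro bidisc_weighted_map.intro 1 2)
  have T: "T = op.T" by (simp add: assms(7) op.T_def)
  have c: "c = op.c" by (simp add: assms(8) op.c_def)
  show ?thesis
    unfolding T c image_mult_sphere image_mult_cball
    by (intro conjI impI; (elim conjE)?;
        (rule op.spectra_unit op.spectra_torus_zero op.spectra_interior_zero; assumption))
qed

end
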